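(* Let $\mathcal{H}$ be any invariant multiplicity-one subspace of $L^2(N)$ with reducing isomorphism $V:\mathcal{H}\to L^2(\Lambda\times\mathbb{R})$ and associated multiplier $\chi=\{\chi_a\}_{a>0}$, and let $\alpha,\beta>0$ be any lattice parameters. Suppose that $I\subseteq\Lambda$ is dilation congruent with the Shannon set $[-1,-1/2)\cup[1/2,1)$, let $g\in L^2(I\times\mathbb{R})$, and let $\psi=V^{-1}g$. If $\widehat{\mathcal T}(g,\alpha,\beta)=\{\hat T_{k,l,m}g:k\in\alpha\mathbb{Z},l\in\beta\mathbb{Z},m\in\mathbb{Z}\}$ is a Parseval frame for $L^2(I\times\mathbb{R})$, then the wavelet systems $$\mathcal U(\psi,\alpha,\beta)=\{D_jT_{(k,l,m)}\psi: j\in\mathbb{Z},k\in\alpha\mathbb{Z},l\in\beta\mathbb{Z},m\in\mathbb{Z}\}$$ and $$\widehat{\mathcal U}(g,\alpha,\beta,\chi)=\{\hat D^\chi_j\hat T_{k,l,m}g: j\in\mathbb{Z},k\in\alpha\mathbb{Z},l\in\beta\mathbb{Z},m\in\mathbb{Z}\}$$ are Parseval frames for $\mathcal{H}$ and $L^2(\Lambda\times\mathbb{R})$, respectively.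
   Context: All sets and functions are Lebesgue measurable, and sets whose symmetric difference is Lebesgue null are identified. A system $\{\psi_j\}$ in a separable Hilbert space $\mathcal{K}$ is a Parseval frame for $\mathcal{K}$ if $\|f\|^2=\sum_j|\langle f,\psi_j\rangle|^2$ for all $f\in\mathcal{K}$. Subsets $I,J$ of $\mathbb{R}$ are dilation congruent if there is a bijection $\delta:I\to J$ and an integer-valued function $j$ on $I$ with $\delta(\lambda)=2^{j(\lambda)}\lambda$. Heisenberg group: $N=\mathbb{R}^3$ with $(x_1,x_2,x_3)(y_1,y_2,y_3)=(x_1+y_1,x_2+y_2,x_3+y_3+x_1y_2)$, Haar measure = Lebesgue measure, and dilations $a\cdot x=(a^{1/2}x_1,a^{1/2}x_2,ax_3)$, $a>0$. On $L^2(N)$: $T_x\phi=\phi(x^{-1}\,\cdot)$, $D_a\phi=a^{-1}\phi(a^{-1}\cdot)$, $D_j:=D_{2^j}$ for $j\in\mathbb{Z}$. $\Lambda=\mathbb{R}\setminus\{0\}$. For $\lambda\in\Lambda$, $\pi_\lambda(x)f(t)=e^{2\pi i\lambda x_3}e^{-2\pi i\lambda x_2t}f(t-x_1)$ on $L^2(\mathbb{R})$. The Fourier transform $\hat\phi(\lambda)=\int_N\phi(x)\pi_\lambda(x)\,dx$ extends to a unitary isomorphism from $L^2(N)$ onto the space of Hilbert–Schmidt operator fields $L^2(\Lambda,\mathcal{HS}(L^2(\mathbb{R})),|\lambda|d\lambda)$. A closed subspace $\mathcal{H}\subseteq L^2(N)$ is translation invariant if $T_x\mathcal{H}\subseteq\mathcal{H}$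 for all $x\in N$; then there is an a.e. unique measurable field of orthogonal projections $\hat P_\lambda$ on $L^2(\mathbb{R})$ such that the projection $P$ onto $\mathcal{H}$ satisfies $\widehat{P\phi}(\lambda)=\hat\phi(\lambda)\hat P_\lambda$. It is multiplicity-one if $\operatorname{rank}\hat P_\lambda=1$ for a.e. $\lambda$, and an invariant multiplicity-one subspace if in addition $D_a\mathcal{H}\subseteq\mathcal{H}$ for all $a>0$. In that case choose a measurable field of unit vectors $e=\{e_\lambda\}_{\lambda\in\Lambda}$ with $\hat P_\lambda L^2(\mathbb{R})=\mathbb{C}e_\lambda$ a.e.; the associated reducing isomorphism $V:\mathcal{H}\to L^2(\Lambda\times\mathbb{R})$ is $(V\eta)(\lambda,\cdot)=\hat\eta(\lambda)(e_\lambda)$, a unitary map, where $L^2(\Lambda\times\mathbb{R})$, and $L^2(I\times\mathbb{R})$ for $I\subseteq\Lambda$, carry the measure $|\lambda|\,d\lambda\,dt$ (and $L^2(I\times\mathbb{R})\subseteq L^2(\Lambda\times\mathbb{R})$ by extension by zero). Its associated multiplier is the family $\chi=\{\chi_a\}_{a>0}$ of measurable unimodular functions on $\Lambda$ with $C_ae_\lambda=\chi_a(\lambda)e_{a\lambda}$ for a.e. $\lambda$, where $C_af(t)=a^{1/4}f(a^{1/2}t)$. On $L^2(\Lambda\times\mathbb{R})$: $\hat T_{k,l,m}f(\lambda,t)=e^{2\pi i\lambda m}e^{-2\pi i\lambda lt}f(\lambda,t-k)$, $\hat D^\chi_af(\lambda,t)=\chi_a(\lambda)\,a^{3/4}f(a\lambda,a^{-1/2}t)$,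 and $\hat D^\chi_j:=\hat D^\chi_{2^j}$ for $j\in\mathbb{Z}$. *)

theory Defs
  imports "HOL-Analysis.Analysis"
begin

text \<open>
  Elements of an \<open>L\<^sup>2\<close> space are represented by functions; all notions below respect equality
  almost everywhere, and vector identities in \<open>L\<^sup>2\<close> are stated as identities a.e.
\<close>

section \<open>Square-integrable functions and Parseval frames\<close>

definition L2 :: "'a measure \<Rightarrow> ('a \<Rightarrow> complex) set" where
  "L2 M = {f. f \<in> borel_measurable M \<and> integrable M (\<lambda>x. (cmod (f x))\<^sup>2)}"

definition L2_inner :: "'a measure \<Rightarrow> ('a \<Rightarrow> complex) \<Rightarrow> ('a \<Rightarrow> complex) \<Rightarrow> complex" where
  "L2_inner M f g = (LINT x|M. f x * cnj (g x))"

definition L2_norm :: "'a measure \<Rightarrow> ('a \<Rightarrow> complex) \<Rightarrow> real" where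
  "L2_norm M f = sqrt (LINT x|M. (cmod (f x))\<^sup>2)"

definition closed_L2_subspace :: "'a measure \<Rightarrow> ('a \<Rightarrow> complex) set \<Rightarrow> bool" where
  "closed_L2_subspace M H \<longleftrightarrow>
     H \<subseteq> L2 M \<and> (\<lambda>_. 0) \<in> H \<and>
     (\<forall>f\<in>H. \<forall>g\<in>H. (\<lambda>x. f x + g x) \<in> H) \<and>
     (\<forall>c. \<forall>f\<in>H. (\<lambda>x. c * f x) \<in> H) \<and>
     (\<forall>s. \<forall>f\<in>L2 M. (\<forall>n::nat. s n \<in> H) \<and> (\<lambda>n. L2_norm M (\<lambda>x. s n x - f x)) \<longlonglongrightarrow> 0 \<longrightarrow> f \<in> H)"

text \<open>\<open>p\<close> is (a representative of) the orthogonal projection of \<open>f\<close> onto \<open>H\<close>.\<close>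

definition is_L2_projection ::
  "'a measure \<Rightarrow> ('a \<Rightarrow> complex) set \<Rightarrow> ('a \<Rightarrow> complex) \<Rightarrow> ('a \<Rightarrow> complex) \<Rightarrow> bool" where
  "is_L2_projection M H f p \<longleftrightarrow> p \<in> H \<and> (\<forall>h\<in>H. L2_inner M (\<lambda>x. f x - p x) h = 0)"

definition parseval_frame ::
  "'a measure \<Rightarrow> ('a \<Rightarrow> complex) set \<Rightarrow> 'i set \<Rightarrow> ('i \<Rightarrow> 'a \<Rightarrow> complex) \<Rightarrow> bool" where
  "parseval_frame M K J \<psi> \<longleftrightarrow>
     (\<forall>i\<in>J. \<psi> i \<in> K) \<and>
     (\<forall>f\<in>K. ((\<lambda>i. (cmod (L2_inner M f (\<psi> i)))\<^sup>2) has_sum (L2_norm M f)\<^sup>2) J)"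

section \<open>Operators on \<open>L\<^sup>2(\<real>)\<close>\<close>

abbreviation L2R :: "(real \<Rightarrow> complex) set" where
  "L2R \<equiv> L2 lebesgue"

type_synonym operator = "(real \<Rightarrow> complex) \<Rightarrow> (real \<Rightarrow> complex)"

text \<open>Boundedness and linearity together imply that the operator respects equality a.e.\<close>

definition bounded_operator :: "operator \<Rightarrow> bool" where
  "bounded_operator A \<longleftrightarrow>
     (\<forall>f\<in>L2R. A f \<in> L2R) \<and>
     (\<forall>a b. \<forall>f\<in>L2R. \<forall>g\<in>L2R.
        AE t in lebesgue. A (\<lambda>s. a * f s + b * g s) t = a * A f t + b * A g t) \<and>
     (\<exists>C. \<forall>f\<in>L2R. L2_norm lebesgue (A f) \<le> C * L2_norm lebesgue f)"

definition orthonormal_basis :: "(nat \<Rightarrow> real \<Rightarrow> complex) \<Rightarrow> bool" where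
  "orthonormal_basis u \<longleftrightarrow>
     (\<forall>n. u n \<in> L2R) \<and>
     (\<forall>m n. L2_inner lebesgue (u m) (u n) = (if m = n then 1 else 0)) \<and>
     (\<forall>f\<in>L2R. (\<forall>n. L2_inner lebesgue f (u n) = 0) \<longrightarrow> (AE t in lebesgue. f t = 0))"

text \<open>The squared Hilbert--Schmidt norm; its value does not depend on the chosen basis.\<close>

definition hs_norm_sq :: "operator \<Rightarrow> ennreal" where
  "hs_norm_sq A =
     (let u = (SOME u. orthonormal_basis u) in \<Sum>n. ennreal ((L2_norm lebesgue (A (u n)))\<^sup>2))"

definition hilbert_schmidt :: "operator \<Rightarrow> bool" where
  "hilbert_schmidt A \<longleftrightarrow> bounded_operator A \<and> hs_norm_sq A < \<infinity>"

definition orthogonal_projection :: "operator \<Rightarrow> bool" where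
  "orthogonal_projection P \<longleftrightarrow>
     bounded_operator P \<and>
     (\<forall>f\<in>L2R. AE t in lebesgue. P (P f) t = P f t) \<and>
     (\<forall>f\<in>L2R. \<forall>g\<in>L2R. L2_inner lebesgue (P f) g = L2_inner lebesgue f (P g))"

text \<open>The range of \<open>A\<close> is the complex line (or zero space) spanned by \<open>u\<close>.\<close>

definition range_is_span :: "operator \<Rightarrow> (real \<Rightarrow> complex) \<Rightarrow> bool" where
  "range_is_span A u \<longleftrightarrow>
     (\<forall>f\<in>L2R. \<exists>c. AE t in lebesgue. A f t = c * u t) \<and>
     (\<forall>c. \<exists>f\<in>L2R. AE t in lebesgue. A f t = c * u t)"

definition rank_one :: "operator \<Rightarrow> bool" where
  "rank_one A \<longleftrightarrow>
     (\<exists>u\<in>L2R. \<not> (AE t in lebesgue. u t = 0) \<and> range_is_span A u)"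

section \<open>The Heisenberg group\<close>

type_synonym heis = "real \<times> real \<times> real"

fun heis_mult :: "heis \<Rightarrow> heis \<Rightarrow> heis" where
  "heis_mult (x1, x2, x3) (y1, y2, y3) = (x1 + y1, x2 + y2, x3 + y3 + x1 * y2)"

fun heis_inv :: "heis \<Rightarrow> heis" where
  "heis_inv (x1, x2, x3) = (- x1, - x2, - x3 + x1 * x2)"

lemma heis_mult_inv:
  "heis_mult (heis_inv x) x = (0, 0, 0)" "heis_mult x (heis_inv x) = (0, 0, 0)"
  by (cases x; simp)+

fun heis_dilate :: "real \<Rightarrow> heis \<Rightarrow> heis" where
  "heis_dilate a (x1, x2, x3) = (a powr (1/2) * x1, a powr (1/2) * x2, a * x3)"

abbreviation L2N :: "(heis \<Rightarrow> complex) set" where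
  "L2N \<equiv> L2 lebesgue"

definition transl :: "heis \<Rightarrow> (heis \<Rightarrow> complex) \<Rightarrow> (heis \<Rightarrow> complex)" where
  "transl x \<phi> = (\<lambda>y. \<phi> (heis_mult (heis_inv x) y))"

definition dil :: "real \<Rightarrow> (heis \<Rightarrow> complex) \<Rightarrow> (heis \<Rightarrow> complex)" where
  "dil a \<phi> = (\<lambda>y. complex_of_real (inverse a) * \<phi> (heis_dilate (inverse a) y))"

definition translation_invariant :: "(heis \<Rightarrow> complex) set \<Rightarrow> bool" where
  "translation_invariant H \<longleftrightarrow>
     closed_L2_subspace lebesgue H \<and> (\<forall>x. \<forall>\<phi>\<in>H. transl x \<phi> \<in> H)"

section \<open>The group Fourier transform\<close>

definition Lam :: "real set" where
  "Lam = UNIV - {0}"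

fun schrodinger_rep :: "real \<Rightarrow> heis \<Rightarrow> operator" where
  "schrodinger_rep \<omega> (x1, x2, x3) f =
     (\<lambda>t. cis (2 * pi * \<omega> * x3) * cis (- 2 * pi * \<omega> * x2 * t) * f (t - x1))"

text \<open>
  The operator \<open>\<integral> \<phi>(x) \<pi>\<^sub>\<omega>(x) dx\<close> for integrable \<open>\<phi>\<close>. For \<open>f\<close> in \<open>L\<^sup>2(\<real>)\<close> the integral below converges
  absolutely for a.e. \<open>t\<close> and represents the value of this operator at \<open>f\<close>.
\<close>

definition fourier_L1 :: "(heis \<Rightarrow> complex) \<Rightarrow> real \<Rightarrow> operator" where
  "fourier_L1 \<phi> \<omega> f = (\<lambda>t. LINT x|lebesgue. \<phi> x * schrodinger_rep \<omega> x f t)"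

definition measurable_operator_field :: "(real \<Rightarrow> operator) \<Rightarrow> bool" where
  "measurable_operator_field A \<longleftrightarrow>
     (\<forall>f\<in>L2R. \<forall>g\<in>L2R.
        (\<lambda>\<omega>. L2_inner lebesgue (A \<omega> f) g) \<in> borel_measurable (lebesgue_on Lam))"

text \<open>The squared norm in \<open>L\<^sup>2(\<Lambda>, HS(L\<^sup>2(\<real>)), \<bar>\<omega>\<bar> d\<omega>)\<close>, and this space itself.\<close>

definition field_norm_sq :: "(real \<Rightarrow> operator) \<Rightarrow> ennreal" where
  "field_norm_sq A = (\<integral>\<^sup>+ \<omega>. ennreal \<bar>\<omega>\<bar> * hs_norm_sq (A \<omega>) \<partial>lebesgue_on Lam)"

definition hs_field :: "(real \<Rightarrow> operator) \<Rightarrow> bool" where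
  "hs_field A \<longleftrightarrow>
     measurable_operator_field A \<and>
     (AE \<omega> in lebesgue_on Lam. hilbert_schmidt (A \<omega>)) \<and>
     field_norm_sq A < \<infinity>"

text \<open>
  \<open>A\<close> is (a representative of) the Fourier transform of the square-integrable function \<open>\<phi>\<close>, i.e. the
  value at \<open>\<phi>\<close> of the continuous extension of \<open>fourier_L1\<close> from \<open>L\<^sup>1 \<inter> L\<^sup>2\<close> to \<open>L\<^sup>2\<close>.
\<close>

definition is_fourier :: "(heis \<Rightarrow> complex) \<Rightarrow> (real \<Rightarrow> operator) \<Rightarrow> bool" where
  "is_fourier \<phi> A \<longleftrightarrow>
     \<phi> \<in> L2N \<and> hs_field A \<and>
     (\<exists>s :: nat \<Rightarrow> heis \<Rightarrow> complex.
        (\<forall>n. s n \<in> L2N \<and> integrable lebesgue (s n)) \<and>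
        (\<lambda>n. L2_norm lebesgue (\<lambda>x. s n x - \<phi> x)) \<longlonglongrightarrow> 0 \<and>
        (\<lambda>n. field_norm_sq (\<lambda>\<omega> f t. fourier_L1 (s n) \<omega> f t - A \<omega> f t)) \<longlonglongrightarrow> 0)"

section \<open>Invariant multiplicity-one subspaces\<close>

text \<open>
  \<open>P\<close> is the field of orthogonal projections attached to \<open>H\<close>: the Fourier transform of the projection
  of \<open>\<phi>\<close> onto \<open>H\<close> is obtained by composing that of \<open>\<phi>\<close> with \<open>P \<omega>\<close> on the right.
\<close>

definition projection_field :: "(heis \<Rightarrow> complex) set \<Rightarrow> (real \<Rightarrow> operator) \<Rightarrow> bool" where
  "projection_field H P \<longleftrightarrow>
     measurable_operator_field P \<and>
     (AE \<omega> in lebesgue_on Lam. orthogonal_projection (P \<omega>)) \<and>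
     (\<forall>\<phi>\<in>L2N. \<forall>p A. is_L2_projection lebesgue H \<phi> p \<longrightarrow> is_fourier \<phi> A \<longrightarrow>
        is_fourier p (\<lambda>\<omega> f. A \<omega> (P \<omega> f)))"

definition multiplicity_one :: "(heis \<Rightarrow> complex) set \<Rightarrow> bool" where
  "multiplicity_one H \<longleftrightarrow>
     translation_invariant H \<and>
     (\<exists>P. projection_field H P \<and> (AE \<omega> in lebesgue_on Lam. rank_one (P \<omega>)))"

definition invariant_multiplicity_one :: "(heis \<Rightarrow> complex) set \<Rightarrow> bool" where
  "invariant_multiplicity_one H \<longleftrightarrow>
     multiplicity_one H \<and> (\<forall>a>0. \<forall>\<phi>\<in>H. dil a \<phi> \<in> H)"

definition unit_vector_field :: "(real \<Rightarrow> real \<Rightarrow> complex) \<Rightarrow> bool" where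
  "unit_vector_field e \<longleftrightarrow>
     (\<forall>\<omega>\<in>Lam. e \<omega> \<in> L2R \<and> L2_norm lebesgue (e \<omega>) = 1) \<and>
     (\<forall>f\<in>L2R. (\<lambda>\<omega>. L2_inner lebesgue (e \<omega>) f) \<in> borel_measurable (lebesgue_on Lam))"

text \<open>The measure \<open>\<bar>\<omega>\<bar> d\<omega> dt\<close> on \<open>\<Lambda> \<times> \<real>\<close>, and its square-integrable functions vanishing off \<open>I \<times> \<real>\<close>.\<close>

definition dual_measure :: "(real \<times> real) measure" where
  "dual_measure = density (lebesgue_on (Lam \<times> UNIV)) (\<lambda>(\<omega>, t). ennreal \<bar>\<omega>\<bar>)"

definition L2_dual :: "real set \<Rightarrow> (real \<times> real \<Rightarrow> complex) set" where
  "L2_dual I = {f \<in> L2 dual_measure. AE (\<omega>, t) in dual_measure. \<omega> \<notin> I \<longrightarrow> f (\<omega>, t) = 0}"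

text \<open>
  \<open>V\<close> is the reducing isomorphism of \<open>H\<close> given by the unit vector field \<open>e\<close>, acting on
  representatives.
\<close>

definition reducing_isomorphism ::
  "(heis \<Rightarrow> complex) set \<Rightarrow> (real \<Rightarrow> real \<Rightarrow> complex) \<Rightarrow>
   ((heis \<Rightarrow> complex) \<Rightarrow> (real \<times> real \<Rightarrow> complex)) \<Rightarrow> bool" where
  "reducing_isomorphism H e V \<longleftrightarrow>
     unit_vector_field e \<and>
     (\<exists>P. projection_field H P \<and> (AE \<omega> in lebesgue_on Lam. range_is_span (P \<omega>) (e \<omega>))) \<and>
     (\<forall>\<eta>\<in>H. V \<eta> \<in> L2_dual Lam \<and>
        (\<exists>A. is_fourier \<eta> A \<and>
             (AE \<omega> in lebesgue_on Lam. AE t in lebesgue. V \<eta> (\<omega>, t) = A \<omega> (e \<omega>) t)))"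

definition C_dil :: "real \<Rightarrow> operator" where
  "C_dil a f = (\<lambda>t. complex_of_real (a powr (1/4)) * f (a powr (1/2) * t))"

definition associated_multiplier ::
  "(real \<Rightarrow> real \<Rightarrow> complex) \<Rightarrow> (real \<Rightarrow> real \<Rightarrow> complex) \<Rightarrow> bool" where
  "associated_multiplier e chi \<longleftrightarrow>
     (\<forall>a>0. chi a \<in> borel_measurable (lebesgue_on Lam) \<and>
        (\<forall>\<omega>\<in>Lam. cmod (chi a \<omega>) = 1) \<and>
        (AE \<omega> in lebesgue_on Lam. AE t in lebesgue.
           C_dil a (e \<omega>) t = chi a \<omega> * e (a * \<omega>) t))"

section \<open>Wavelet systems\<close>

fun That :: "real \<times> real \<times> real \<Rightarrow> (real \<times> real \<Rightarrow> complex) \<Rightarrow> (real \<times> real \<Rightarrow> complex)" where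
  "That (k, l, m) f =
     (\<lambda>(\<omega>, t). cis (2 * pi * \<omega> * m) * cis (- 2 * pi * \<omega> * l * t) * f (\<omega>, t - k))"

definition Dhat ::
  "(real \<Rightarrow> real \<Rightarrow> complex) \<Rightarrow> real \<Rightarrow> (real \<times> real \<Rightarrow> complex) \<Rightarrow> (real \<times> real \<Rightarrow> complex)" where
  "Dhat chi a f =
     (\<lambda>(\<omega>, t). chi a \<omega> * complex_of_real (a powr (3/4)) * f (a * \<omega>, a powr (-1/2) * t))"

definition lattice :: "real \<Rightarrow> real \<Rightarrow> (real \<times> real \<times> real) set" where
  "lattice \<alpha> \<beta> =
     {(\<alpha> * of_int p, \<beta> * of_int q, of_int m) | p q m :: int. True}"

definition wavelet_system :: "(heis \<Rightarrow> complex) \<Rightarrow> int \<times> heis \<Rightarrow> (heis \<Rightarrow> complex)" where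
  "wavelet_system \<psi> = (\<lambda>(j, x). dil (2 powi j) (transl x \<psi>))"

definition dual_wavelet_system ::
  "(real \<times> real \<Rightarrow> complex) \<Rightarrow> (real \<Rightarrow> real \<Rightarrow> complex) \<Rightarrow> int \<times> heis \<Rightarrow> (real \<times> real \<Rightarrow> complex)" where
  "dual_wavelet_system g chi = (\<lambda>(j, x). Dhat chi (2 powi j) (That x g))"

text \<open>Dilation congruence, with measurable data and up to null sets.\<close>

definition dilation_congruent :: "real set \<Rightarrow> real set \<Rightarrow> bool" where
  "dilation_congruent I J \<longleftrightarrow>
     (\<exists>I' J' (\<delta> :: real \<Rightarrow> real) (j :: real \<Rightarrow> int).
        sym_diff I I' \<in> null_sets lebesgue \<and> sym_diff J J' \<in> null_sets lebesgue \<and>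
        bij_betw \<delta> I' J' \<and>
        j \<in> measurable (lebesgue_on I') (count_space UNIV) \<and>
        (\<forall>\<omega>\<in>I'. \<delta> \<omega> = 2 powi (j \<omega>) * \<omega>))"

definition shannon_set :: "real set" where
  "shannon_set = {-1..< -1/2} \<union> {1/2..<1}"

end

theory Submission
  imports Defs "HOL-Probability.Characteristic_Functions"
begin

text \<open>Write \<open>U\<close> for the wavelet system. The reducing isomorphism \<open>V\<close> is an isometry that carries left translation by
\<open>x\<close> to \<open>That x\<close> and dilation by \<open>a\<close> to \<open>Dhat chi a\<close>, so it carries \<open>U\<close> to the dual system; the frame identity for
\<open>U\<close> is therefore the frame identity of the dual system at the vectors \<open>V \<phi>\<close>, and the theorem splits into a
statement about \<open>V\<close> and a statement on the dual side.

The dual side (\<open>dual_parseval_frame\<close>) rests on a tiling. For \<open>a = 2\<^sup>j\<close> the operator \<open>Dhat chi a\<close> is unitary and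
maps functions over \<open>I\<close> to functions over \<open>a\<^sup>-\<^sup>1 I\<close>. The coefficients of \<open>f\<close> at scale \<open>j\<close> are thus the
coefficients, with respect to the given frame over \<open>I\<close>, of the part of \<open>f\<close> over \<open>2\<^sup>-\<^sup>j I\<close> pulled back to \<open>I\<close>,
and their energies add up to the energy of that part. Dilation congruence with the Shannon set says that the
dyadic dilates of \<open>I\<close> partition the line up to a null set (\<open>dyadic_tiling\<close>), so summing over \<open>j\<close> gives the
energy of \<open>f\<close>.

That \<open>V\<close> is an isometry (\<open>reducing_isomorphism_norm\<close>) is Plancherel's theorem for the Heisenberg group in
disguise. For \<open>\<phi>\<close> in \<open>L\<^sup>1 \<inter> L\<^sup>2\<close> the operator at frequency \<open>\<omega>\<close> is an integral operator whose kernel is a partial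
Fourier transform of \<open>\<phi>\<close>; its Hilbert--Schmidt norm is the norm of the kernel, and the substitution
\<open>v = \<omega> t\<close> produces exactly the weight \<open>\<bar>\<omega>\<bar>\<close>, so that Plancherel's theorem on the plane finishes the computation
(\<open>Plancherel_heis\<close>). The theorem on the plane is two applications of the one on the line (\<open>Plancherel_real\<close>), which is
Fourier inversion at \<open>0\<close> for the autocorrelation, regularised by Gaussians. Density extends the isometry to
\<open>L\<^sup>2\<close> (\<open>fourier_isometry\<close>). If \<open>\<phi>\<close> lies in \<open>H\<close>, then its Fourier transform factors through the rank-one projection onto
\<open>e \<omega>\<close>, whence its Hilbert--Schmidt norm is the norm of its value at \<open>e \<omega>\<close>, which is \<open>V \<phi>\<close>.

The two intertwining relations are changes of variables for integrable functions. They pass to \<open>L\<^sup>2\<close> because the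
operator norm is bounded by the Hilbert--Schmidt norm: along a subsequence of any approximation, almost every
operator converges strongly (\<open>fourier_pointwise\<close>). The Hilbert--Schmidt norm is defined through a chosen orthonormal
basis, so this also needs that such a basis exists (\<open>orthonormal_basis_exists\<close>) and that Parseval's identity
holds for it, that is, completeness of \<open>L\<^sup>2\<close> (\<open>L2_complete\<close>).\<close>

section \<open>Square-integrable functions\<close>

abbreviation energy :: "'a measure \<Rightarrow> ('a \<Rightarrow> complex) \<Rightarrow> ennreal" where
  "energy M f \<equiv> \<integral>\<^sup>+x. ennreal ((cmod (f x))\<^sup>2) \<partial>M"

abbreviation L2_lim :: "'a measure \<Rightarrow> (nat \<Rightarrow> 'a \<Rightarrow> complex) \<Rightarrow> ('a \<Rightarrow> complex) \<Rightarrow> bool" where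
  "L2_lim M s f \<equiv> (\<lambda>n. L2_norm M (\<lambda>x. s n x - f x)) \<longlonglongrightarrow> 0"

lemma cnj_measurable [measurable]: "cnj \<in> borel_measurable borel"
  by (intro borel_measurable_continuous_onI continuous_intros)

lemma L2_measurable: "f \<in> L2 M \<Longrightarrow> f \<in> borel_measurable M"
  and L2_integrable_sq: "f \<in> L2 M \<Longrightarrow> integrable M (\<lambda>x. (cmod (f x))\<^sup>2)"
  by (auto simp: L2_def)

lemma L2_iff_nn:
  "f \<in> L2 M \<longleftrightarrow> f \<in> borel_measurable M \<and> energy M f < \<infinity>"
  unfolding L2_def by (auto simp: integrable_iff_bounded)

lemma L2_norm_nonneg [simp]: "0 \<le> L2_norm M f"
  by (simp add: L2_norm_def)

lemma L2_norm_sq: "(L2_norm M f)\<^sup>2 = (LINT x|M. (cmod (f x))\<^sup>2)"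
  by (simp add: L2_norm_def)

lemma L2_norm_nn:
  "f \<in> L2 M \<Longrightarrow> ennreal ((L2_norm M f)\<^sup>2) = energy M f"
  unfolding L2_norm_sq by (rule nn_integral_eq_integral[symmetric]) (auto simp: L2_def)

lemma L2_integrable_mult:
  assumes "f \<in> L2 M" "g \<in> L2 M"
  shows "integrable M (\<lambda>x. f x * cnj (g x))"
proof (rule Bochner_Integration.integrable_bound)
  show "integrable M (\<lambda>x. (cmod (f x))\<^sup>2 + (cmod (g x))\<^sup>2)"
    using assms by (auto simp: L2_def)
  have [measurable]: "f \<in> borel_measurable M" "g \<in> borel_measurable M"
    using assms by (auto simp: L2_def)
  show "(\<lambda>x. f x * cnj (g x)) \<in> borel_measurable M" by measurable
  have "norm (f x * cnj (g x)) \<le> norm ((cmod (f x))\<^sup>2 + (cmod (g x))\<^sup>2)" for x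
  proof -
    have "cmod (f x) * cmod (g x) \<le> 2 * (cmod (f x) * cmod (g x))" by simp
    also have "\<dots> \<le> (cmod (f x))\<^sup>2 + (cmod (g x))\<^sup>2"
      using sum_squares_bound[of "cmod (f x)" "cmod (g x)"] by simp
    finally show ?thesis by (simp add: norm_mult)
  qed
  then show "AE x in M. norm (f x * cnj (g x)) \<le> norm ((cmod (f x))\<^sup>2 + (cmod (g x))\<^sup>2)" by simp
qed

lemma L2_zero [simp]: "(\<lambda>_. 0) \<in> L2 M"
  by (simp add: L2_def)

lemma L2_scale: "f \<in> L2 M \<Longrightarrow> (\<lambda>x. c * f x) \<in> L2 M"
  by (auto simp: L2_def norm_mult power_mult_distrib)

lemma L2_add:
  assumes "f \<in> L2 M" "g \<in> L2 M"
  shows "(\<lambda>x. f x + g x) \<in> L2 M"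
proof -
  have [measurable]: "f \<in> borel_measurable M" "g \<in> borel_measurable M"
    using assms by (auto simp: L2_def)
  have "integrable M (\<lambda>x. (cmod (f x + g x))\<^sup>2)"
  proof (rule Bochner_Integration.integrable_bound)
    show "integrable M (\<lambda>x. 2 * (cmod (f x))\<^sup>2 + 2 * (cmod (g x))\<^sup>2)"
      using assms by (auto simp: L2_def)
    have "norm ((cmod (f x + g x))\<^sup>2) \<le> norm (2 * (cmod (f x))\<^sup>2 + 2 * (cmod (g x))\<^sup>2)" for x
    proof -
      have "(cmod (f x + g x))\<^sup>2 \<le> (cmod (f x) + cmod (g x))\<^sup>2"
        by (intro power_mono norm_triangle_ineq) simp
      also have "\<dots> \<le> 2 * (cmod (f x))\<^sup>2 + 2 * (cmod (g x))\<^sup>2"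
        using sum_squares_bound[of "cmod (f x)" "cmod (g x)"] by (simp add: power2_sum)
      finally show ?thesis by simp
    qed
    then show "AE x in M. norm ((cmod (f x + g x))\<^sup>2) \<le> norm (2 * (cmod (f x))\<^sup>2 + 2 * (cmod (g x))\<^sup>2)"
      by simp
  qed measurable
  then show ?thesis by (simp add: L2_def)
qed

lemma L2_uminus: "f \<in> L2 M \<Longrightarrow> (\<lambda>x. - f x) \<in> L2 M"
  using L2_scale[of f M "-1"] by simp

lemma L2_diff: "f \<in> L2 M \<Longrightarrow> g \<in> L2 M \<Longrightarrow> (\<lambda>x. f x - g x) \<in> L2 M"
  using L2_add[of f M "\<lambda>x. - g x"] L2_uminus[of g M] by simp

lemma L2_sum: "(\<And>i. i \<in> A \<Longrightarrow> f i \<in> L2 M) \<Longrightarrow> (\<lambda>x. \<Sum>i\<in>A. f i x) \<in> L2 M"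
  by (induction A rule: infinite_finite_induct) (auto intro: L2_add)

lemma L2_inner_cnj: "L2_inner M g f = cnj (L2_inner M f g)"
  unfolding L2_inner_def
  by (subst Bochner_Integration.integral_cnj[symmetric]) (simp add: mult.commute)

lemma L2_inner_add_left:
  "f \<in> L2 M \<Longrightarrow> g \<in> L2 M \<Longrightarrow> h \<in> L2 M \<Longrightarrow>
   L2_inner M (\<lambda>x. f x + g x) h = L2_inner M f h + L2_inner M g h"
  unfolding L2_inner_def
  by (simp add: distrib_right L2_integrable_mult)

lemma L2_inner_scale_left: "L2_inner M (\<lambda>x. c * f x) h = c * L2_inner M f h"
  unfolding L2_inner_def by (simp add: mult.assoc)

lemma L2_inner_diff_left:
  "f \<in> L2 M \<Longrightarrow> g \<in> L2 M \<Longrightarrow> h \<in> L2 M \<Longrightarrow>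
   L2_inner M (\<lambda>x. f x - g x) h = L2_inner M f h - L2_inner M g h"
  unfolding L2_inner_def
  by (simp add: left_diff_distrib L2_integrable_mult)

lemma L2_inner_diff_right:
  "f \<in> L2 M \<Longrightarrow> g \<in> L2 M \<Longrightarrow> h \<in> L2 M \<Longrightarrow>
   L2_inner M h (\<lambda>x. f x - g x) = L2_inner M h f - L2_inner M h g"
  by (subst (1 2 3) L2_inner_cnj) (simp add: L2_inner_diff_left)

lemma L2_inner_scale_right: "L2_inner M h (\<lambda>x. c * f x) = cnj c * L2_inner M h f"
  by (subst (1 2) L2_inner_cnj) (simp add: L2_inner_scale_left)

lemma L2_inner_zero_left [simp]: "L2_inner M (\<lambda>_. 0) h = 0"
  by (simp add: L2_inner_def)

lemma L2_inner_sum_left: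
  "(\<And>i. i \<in> A \<Longrightarrow> f i \<in> L2 M) \<Longrightarrow> h \<in> L2 M \<Longrightarrow>
   L2_inner M (\<lambda>x. \<Sum>i\<in>A. f i x) h = (\<Sum>i\<in>A. L2_inner M (f i) h)"
  by (induction A rule: infinite_finite_induct) (auto simp: L2_inner_add_left L2_sum)

lemma L2_inner_self: "L2_inner M f f = complex_of_real ((L2_norm M f)\<^sup>2)"
  unfolding L2_inner_def L2_norm_sq
  by (subst integral_complex_of_real[symmetric])
     (simp add: complex_norm_square[symmetric] del: of_real_power)

lemma L2_norm_scale: "L2_norm M (\<lambda>x. c * f x) = cmod c * L2_norm M f"
  unfolding L2_norm_def by (simp add: norm_mult power_mult_distrib real_sqrt_mult)

lemma L2_norm_zero [simp]: "L2_norm M (\<lambda>x. 0) = 0"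
  by (simp add: L2_norm_def)

lemma L2_norm_minus_commute: "L2_norm M (\<lambda>x. f x - g x) = L2_norm M (\<lambda>x. g x - f x)"
  unfolding L2_norm_def by (simp add: norm_minus_commute)

lemma L2_norm_eq_0_iff:
  assumes "f \<in> L2 M"
  shows "L2_norm M f = 0 \<longleftrightarrow> (AE x in M. f x = 0)"
proof -
  have "L2_norm M f = 0 \<longleftrightarrow> (LINT x|M. (cmod (f x))\<^sup>2) = 0" by (simp add: L2_norm_def)
  also have "\<dots> \<longleftrightarrow> (AE x in M. (cmod (f x))\<^sup>2 = 0)"
    using assms by (intro integral_nonneg_eq_0_iff_AE) (auto simp: L2_def)
  finally show ?thesis by simp
qed

lemma L2_inner_cong_AE:
  assumes "AE x in M. f x = f' x" "AE x in M. g x = g' x"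
    "f \<in> borel_measurable M" "f' \<in> borel_measurable M" "g \<in> borel_measurable M" "g' \<in> borel_measurable M"
  shows "L2_inner M f g = L2_inner M f' g'"
  unfolding L2_inner_def using assms
  by (intro integral_cong_AE) (measurable, auto)

lemma L2_norm_cong_AE:
  assumes "AE x in M. f x = f' x" "f \<in> borel_measurable M" "f' \<in> borel_measurable M"
  shows "L2_norm M f = L2_norm M f'"
  unfolding L2_norm_def using assms
  by (intro arg_cong[where f=sqrt] integral_cong_AE) (measurable, auto)

lemma L2_cong_AE:
  assumes "AE x in M. f x = f' x" "f' \<in> borel_measurable M" "f \<in> L2 M"
  shows "f' \<in> L2 M"
proof -
  have "energy M f = energy M f'"
    using assms(1) by (intro nn_integral_cong_AE) auto
  with assms show ?thesis by (simp add: L2_iff_nn)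
qed

lemma L2_norm_diff_sq:
  assumes "f \<in> L2 M" "g \<in> L2 M"
  shows "(L2_norm M (\<lambda>x. f x - g x))\<^sup>2 = (L2_norm M f)\<^sup>2 - 2 * Re (L2_inner M f g) + (L2_norm M g)\<^sup>2"
proof -
  have "complex_of_real ((L2_norm M (\<lambda>x. f x - g x))\<^sup>2) =
      L2_inner M (\<lambda>x. f x - g x) (\<lambda>x. f x - g x)" by (simp only: L2_inner_self)
  also have "\<dots> = L2_inner M f f - L2_inner M f g - L2_inner M g f + L2_inner M g g"
    using assms by (simp add: L2_inner_diff_left L2_inner_diff_right L2_diff)
  also have "\<dots> = complex_of_real ((L2_norm M f)\<^sup>2) - (L2_inner M f g + cnj (L2_inner M f g))
      + complex_of_real ((L2_norm M g)\<^sup>2)"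
    by (simp only: L2_inner_self L2_inner_cnj[of M g f]) simp
  also have "\<dots> = complex_of_real ((L2_norm M f)\<^sup>2 - 2 * Re (L2_inner M f g) + (L2_norm M g)\<^sup>2)"
    by (simp add: complex_add_cnj)
  finally show ?thesis using of_real_eq_iff by blast
qed

lemma L2_Cauchy_Schwarz:
  assumes f: "f \<in> L2 M" and g: "g \<in> L2 M"
  shows "cmod (L2_inner M f g) \<le> L2_norm M f * L2_norm M g"
proof (cases "L2_norm M g = 0")
  case True
  then have "AE x in M. g x = 0" using g L2_norm_eq_0_iff by blast
  then have "L2_inner M f g = L2_inner M f (\<lambda>_. 0)"
    using f g by (intro L2_inner_cong_AE) (auto simp: L2_def)
  also have "\<dots> = 0" by (simp add: L2_inner_def)
  finally show ?thesis by simp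
next
  case False
  define c where "c = L2_inner M f g / complex_of_real ((L2_norm M g)\<^sup>2)"
  have c: "Re (L2_inner M f (\<lambda>x. c * g x)) = (cmod (L2_inner M f g))\<^sup>2 / (L2_norm M g)\<^sup>2"
  proof -
    have "L2_inner M f (\<lambda>x. c * g x) = (L2_inner M f g * cnj (L2_inner M f g)) / complex_of_real ((L2_norm M g)\<^sup>2)"
      unfolding L2_inner_scale_right by (simp add: c_def)
    also have "\<dots> = complex_of_real ((cmod (L2_inner M f g))\<^sup>2 / (L2_norm M g)\<^sup>2)"
      by (simp add: complex_norm_square[symmetric] del: of_real_power)
    finally show ?thesis by simp
  qed
  have c2: "(L2_norm M (\<lambda>x. c * g x))\<^sup>2 = (cmod (L2_inner M f g))\<^sup>2 / (L2_norm M g)\<^sup>2"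
    unfolding L2_norm_scale using False
    by (simp add: c_def norm_divide norm_power power_mult_distrib power_divide)
       (simp add: field_simps power2_eq_square power4_eq_xxxx)
  have "0 \<le> (L2_norm M (\<lambda>x. f x - c * g x))\<^sup>2" by simp
  also have "\<dots> = (L2_norm M f)\<^sup>2 - (cmod (L2_inner M f g))\<^sup>2 / (L2_norm M g)\<^sup>2"
    using L2_norm_diff_sq[OF f L2_scale[OF g, of c]] c c2 by simp
  finally have "(cmod (L2_inner M f g))\<^sup>2 / (L2_norm M g)\<^sup>2 \<le> (L2_norm M f)\<^sup>2" by simp
  then have "(cmod (L2_inner M f g))\<^sup>2 \<le> (L2_norm M f * L2_norm M g)\<^sup>2"
    using False by (simp add: divide_le_eq power_mult_distrib)
  then show ?thesis by (rule power2_le_imp_le) simp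
qed

lemma L2_norm_triangle_sub:
  assumes f: "f \<in> L2 M" and g: "g \<in> L2 M"
  shows "L2_norm M (\<lambda>x. f x - g x) \<le> L2_norm M f + L2_norm M g"
proof (rule power2_le_imp_le)
  have "- Re (L2_inner M f g) \<le> L2_norm M f * L2_norm M g"
    using L2_Cauchy_Schwarz[OF f g] abs_Re_le_cmod[of "L2_inner M f g"] by linarith
  then show "(L2_norm M (\<lambda>x. f x - g x))\<^sup>2 \<le> (L2_norm M f + L2_norm M g)\<^sup>2"
    using L2_norm_diff_sq[OF f g] by (simp add: power2_sum)
qed simp

lemma L2_norm_uminus: "L2_norm M (\<lambda>x. - f x) = L2_norm M f"
  by (simp add: L2_norm_def)

lemma L2_norm_triangle:
  assumes f: "f \<in> L2 M" and g: "g \<in> L2 M"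
  shows "L2_norm M (\<lambda>x. f x + g x) \<le> L2_norm M f + L2_norm M g"
  using L2_norm_triangle_sub[OF f L2_uminus[OF g]] by (simp add: L2_norm_uminus)

lemma L2_norm_triangle3:
  assumes "f \<in> L2 M" "g \<in> L2 M" "h \<in> L2 M"
  shows "L2_norm M (\<lambda>x. f x - h x) \<le> L2_norm M (\<lambda>x. f x - g x) + L2_norm M (\<lambda>x. g x - h x)"
  using L2_norm_triangle[OF L2_diff[OF assms(1,2)] L2_diff[OF assms(2,3)]] by simp

lemma L2_norm_reverse_triangle:
  assumes "f \<in> L2 M" "g \<in> L2 M"
  shows "\<bar>L2_norm M f - L2_norm M g\<bar> \<le> L2_norm M (\<lambda>x. f x - g x)"
  using L2_norm_triangle[OF L2_diff[OF assms] assms(2)]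
    L2_norm_triangle[OF L2_diff[OF assms(2,1)] assms(1)] L2_norm_minus_commute[of M f g]
  by simp

lemma L2_norm_tendsto:
  assumes "\<And>n. s n \<in> L2 M" "f \<in> L2 M" "L2_lim M s f"
  shows "(\<lambda>n. L2_norm M (s n)) \<longlonglongrightarrow> L2_norm M f"
proof (rule LIM_zero_cancel, rule Lim_null_comparison)
  show "\<forall>\<^sub>F n in sequentially. norm (L2_norm M (s n) - L2_norm M f) \<le> L2_norm M (\<lambda>x. s n x - f x)"
    using L2_norm_reverse_triangle[OF assms(1,2)] by simp
qed (rule assms(3))

lemma L2_inner_tendsto_left:
  assumes "\<And>n. s n \<in> L2 M" "f \<in> L2 M" "h \<in> L2 M" "L2_lim M s f"
  shows "(\<lambda>n. L2_inner M (s n) h) \<longlonglongrightarrow> L2_inner M f h"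
proof (rule LIM_zero_cancel, rule Lim_null_comparison)
  show "\<forall>\<^sub>F n in sequentially. norm (L2_inner M (s n) h - L2_inner M f h)
      \<le> L2_norm M (\<lambda>x. s n x - f x) * L2_norm M h"
    using L2_Cauchy_Schwarz[OF L2_diff[OF assms(1,2)] assms(3)] assms
    by (simp add: L2_inner_diff_left)
  show "(\<lambda>n. L2_norm M (\<lambda>x. s n x - f x) * L2_norm M h) \<longlonglongrightarrow> 0"
    using tendsto_mult_left_zero[OF assms(4)] by simp
qed

lemma L2_limit_unique:
  assumes "\<And>n. s n \<in> L2 M" "f \<in> L2 M" "g \<in> L2 M"
    "L2_lim M s f" "L2_lim M s g"
  shows "AE x in M. f x = g x"
proof -
  have "L2_norm M (\<lambda>x. f x - g x) \<le> L2_norm M (\<lambda>x. s n x - f x) + L2_norm M (\<lambda>x. s n x - g x)" for n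
    using L2_norm_triangle3[OF assms(2) assms(1)[of n] assms(3)] L2_norm_minus_commute[of M f "s n"] by simp
  then have "L2_norm M (\<lambda>x. f x - g x) \<le> 0 + 0"
    by (intro tendsto_lowerbound[OF tendsto_add[OF assms(4,5)]]) auto
  then have "L2_norm M (\<lambda>x. f x - g x) = 0" using L2_norm_nonneg[of M "\<lambda>x. f x - g x"] by linarith
  then show ?thesis using L2_norm_eq_0_iff[OF L2_diff[OF assms(2,3)]] by simp
qed

text \<open>A subsequence whose consecutive differences \<open>d\<^sub>k\<close> have norm below \<open>3\<^sup>-\<^sup>k\<close> makes \<open>\<Sum> 4\<^sup>k \<bar>d\<^sub>k\<bar>\<^sup>2\<close> integrable. Hence almost everywhere
\<open>\<bar>d\<^sub>k\<bar> \<le> 2\<^sup>-\<^sup>k\<close> eventually, so the subsequence converges pointwise; Fatou's lemma turns this into convergence in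
norm of the whole sequence.\<close>

lemma L2_complete:
  assumes s: "\<And>n. s n \<in> L2 M"
    and cauchy: "\<And>\<epsilon>. \<epsilon> > 0 \<Longrightarrow> \<exists>N. \<forall>m\<ge>N. \<forall>n\<ge>N. L2_norm M (\<lambda>x. s m x - s n x) < \<epsilon>"
  shows "\<exists>f\<in>L2 M. L2_lim M s f"
proof -
  have [measurable]: "s n \<in> borel_measurable M" for n using s by (rule L2_measurable)
  have "\<exists>N. \<forall>m\<ge>N. \<forall>n\<ge>N. L2_norm M (\<lambda>x. s m x - s n x) < (1/3)^k" for k :: nat
    by (rule cauchy) simp
  then obtain N where N: "\<And>k m n. m \<ge> N k \<Longrightarrow> n \<ge> N k \<Longrightarrow> L2_norm M (\<lambda>x. s m x - s n x) < (1/3)^k"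
    by metis
  \<comment> \<open>the partial sums dominate every \<open>N i\<close> with \<open>i \<le> k\<close> and tend to infinity\<close>
  define r where "r k = (\<Sum>i\<le>k. N i + 1)" for k :: nat
  have rN0: "r k \<ge> N k" for k
    using member_le_sum[of k "{..k}" "\<lambda>i. N i + 1"] by (simp add: r_def)
  have rN: "r k \<ge> N k" "r (Suc k) \<ge> N k" for k
    using rN0[of k] by (auto simp: r_def)
  have rk: "r k \<ge> k" for k by (induction k) (auto simp: r_def)
  define d where "d k x = s (r (Suc k)) x - s (r k) x" for k x
  have [measurable]: "d k \<in> borel_measurable M" for k by (simp add: d_def[abs_def])
  have dL: "d k \<in> L2 M" for k unfolding d_def[abs_def] by (intro L2_diff s)
  have dsmall: "(\<integral>\<^sup>+x. ennreal (4^k * (cmod (d k x))\<^sup>2) \<partial>M) \<le> ennreal ((4/9)^k)" for k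
  proof -
    have "(L2_norm M (d k))\<^sup>2 \<le> ((1/3)^k)\<^sup>2"
      using N[OF rN(2)[of k] rN(1)[of k]] by (intro power_mono) (auto simp: d_def[abs_def])
    also have "\<dots> = (1/9)^k" by (simp add: power_mult[symmetric] mult.commute[of k]) (simp add: power_mult power2_eq_square)
    finally have *: "(L2_norm M (d k))\<^sup>2 \<le> (1/9)^k" .
    have "(\<integral>\<^sup>+x. ennreal (4^k * (cmod (d k x))\<^sup>2) \<partial>M) = ennreal (4^k) * ennreal ((L2_norm M (d k))\<^sup>2)"
      by (simp add: L2_norm_nn[OF dL] ennreal_mult nn_integral_cmult)
    also have "\<dots> = ennreal (4^k * (L2_norm M (d k))\<^sup>2)" by (simp add: ennreal_mult)
    also have "\<dots> \<le> ennreal (4^k * (1/9)^k)" using * by (intro ennreal_leI mult_left_mono) auto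
    finally show ?thesis by (simp add: power_mult_distrib[symmetric])
  qed
  have "(\<integral>\<^sup>+x. (\<Sum>k. ennreal (4^k * (cmod (d k x))\<^sup>2)) \<partial>M) = (\<Sum>k. \<integral>\<^sup>+x. ennreal (4^k * (cmod (d k x))\<^sup>2) \<partial>M)"
    by (rule nn_integral_suminf) measurable
  also have "\<dots> \<le> (\<Sum>k. ennreal ((4/9)^k))" by (intro suminf_le dsmall) auto
  also have "\<dots> < \<infinity>" by (subst suminf_ennreal2) (auto simp: summable_geometric)
  finally have "AE x in M. (\<Sum>k. ennreal (4^k * (cmod (d k x))\<^sup>2)) \<noteq> \<infinity>"
    by (intro nn_integral_PInf_AE) auto
  then have conv: "AE x in M. convergent (\<lambda>k. s (r k) x)"
  proof eventually_elim
    case (elim x)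
    have "summable (\<lambda>k. 4^k * (cmod (d k x))\<^sup>2)" using elim by (intro summable_suminf_not_top) auto
    then have "(\<lambda>k. 4^k * (cmod (d k x))\<^sup>2) \<longlonglongrightarrow> 0" by (rule summable_LIMSEQ_zero)
    then have "\<forall>\<^sub>F k in sequentially. 4^k * (cmod (d k x))\<^sup>2 < 1" by (rule order_tendstoD) simp
    then have "\<forall>\<^sub>F k in sequentially. norm (d k x) \<le> (1/2)^k"
    proof eventually_elim
      case (elim k)
      have "(2^k * cmod (d k x))\<^sup>2 = 4^k * (cmod (d k x))\<^sup>2"
        by (simp add: power_mult_distrib power2_eq_square power_mult_distrib[symmetric])
      with elim have "(2^k * cmod (d k x))\<^sup>2 \<le> 1\<^sup>2" by simp
      then have "2^k * cmod (d k x) \<le> 1" by (rule power2_le_imp_le) simp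
      then show ?case by (simp add: power_divide field_simps)
    qed
    then have "summable (\<lambda>k. d k x)"
      by (rule summable_comparison_test_ev) (simp add: summable_geometric)
    then have "convergent (\<lambda>n. \<Sum>k<n. d k x)" by (simp add: summable_iff_convergent)
    moreover have "(\<Sum>k<n. d k x) = s (r n) x - s (r 0) x" for n
      unfolding d_def by (rule sum_lessThan_telescope)
    ultimately have "convergent (\<lambda>n. s (r n) x - s (r 0) x)" by simp
    then have "convergent (\<lambda>n. (s (r n) x - s (r 0) x) + s (r 0) x)" by (intro convergent_add convergent_const)
    then show ?case by simp
  qed
  define f where "f x = lim (\<lambda>k. s (r k) x)" for x
  have [measurable]: "f \<in> borel_measurable M" unfolding f_def[abs_def] by measurable
  have lim: "AE x in M. (\<lambda>k. s (r k) x) \<longlonglongrightarrow> f x"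
    using conv by eventually_elim (simp add: f_def convergent_LIMSEQ_iff)
  have bound: "energy M (\<lambda>x. s n x - f x) \<le> ennreal (\<epsilon>\<^sup>2)"
    if \<epsilon>: "\<epsilon> > 0" and Ne: "\<And>m n. m \<ge> K \<Longrightarrow> n \<ge> K \<Longrightarrow> L2_norm M (\<lambda>x. s m x - s n x) < \<epsilon>" and n: "n \<ge> K" for \<epsilon> K n
  proof -
    have "energy M (\<lambda>x. s n x - f x) =
        (\<integral>\<^sup>+x. liminf (\<lambda>k. ennreal ((cmod (s n x - s (r k) x))\<^sup>2)) \<partial>M)"
    proof (rule nn_integral_cong_AE, use lim in eventually_elim)
      case (elim x)
      have "(\<lambda>k. ennreal ((cmod (s n x - s (r k) x))\<^sup>2)) \<longlonglongrightarrow> ennreal ((cmod (s n x - f x))\<^sup>2)"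
        by (intro tendsto_intros elim)
      then show ?case by (intro lim_imp_Liminf[symmetric]) simp_all
    qed
    also have "\<dots> \<le> liminf (\<lambda>k. energy M (\<lambda>x. s n x - s (r k) x))"
      by (rule nn_integral_liminf) measurable
    also have "\<dots> \<le> limsup (\<lambda>k. energy M (\<lambda>x. s n x - s (r k) x))"
      by (rule Liminf_le_Limsup) simp
    also have "\<dots> \<le> ennreal (\<epsilon>\<^sup>2)"
    proof (rule Limsup_bounded, rule eventually_sequentiallyI)
      fix k assume "K \<le> k"
      then have "r k \<ge> K" using rk[of k] by simp
      then have "(L2_norm M (\<lambda>x. s n x - s (r k) x))\<^sup>2 \<le> \<epsilon>\<^sup>2"
        using Ne[OF n] by (intro power_mono) (auto simp: less_imp_le)
      then show "energy M (\<lambda>x. s n x - s (r k) x) \<le> ennreal (\<epsilon>\<^sup>2)"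
        by (subst L2_norm_nn[symmetric]) (auto intro!: L2_diff s ennreal_leI)
    qed
    finally show ?thesis .
  qed
  obtain K where K: "\<And>m n. m \<ge> K \<Longrightarrow> n \<ge> K \<Longrightarrow> L2_norm M (\<lambda>x. s m x - s n x) < 1"
    using cauchy[of 1] by auto
  have "(\<lambda>x. s K x - f x) \<in> L2 M"
    using bound[of 1 K K] K by (simp add: L2_iff_nn order_le_less_trans)
  from L2_diff[OF s[of K] this] have fL: "f \<in> L2 M" by simp
  have "L2_lim M s f"
  proof (rule LIMSEQ_I)
    fix \<epsilon> :: real assume "\<epsilon> > 0"
    then obtain K where K: "\<And>m n. m \<ge> K \<Longrightarrow> n \<ge> K \<Longrightarrow> L2_norm M (\<lambda>x. s m x - s n x) < \<epsilon>/2"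
      using cauchy[of "\<epsilon>/2"] by auto
    have "L2_norm M (\<lambda>x. s n x - f x) < \<epsilon>" if "n \<ge> K" for n
    proof -
      have "ennreal ((L2_norm M (\<lambda>x. s n x - f x))\<^sup>2) \<le> ennreal ((\<epsilon>/2)\<^sup>2)"
        using bound[of "\<epsilon>/2" K n] K that \<open>\<epsilon> > 0\<close> by (simp add: L2_norm_nn[OF L2_diff[OF s fL]])
      then have "(L2_norm M (\<lambda>x. s n x - f x))\<^sup>2 \<le> (\<epsilon>/2)\<^sup>2" by (simp add: ennreal_le_iff)
      then have "L2_norm M (\<lambda>x. s n x - f x) \<le> \<epsilon>/2" by (rule power2_le_imp_le) (use \<open>\<epsilon> > 0\<close> in simp)
      then show ?thesis using \<open>\<epsilon> > 0\<close> by simp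
    qed
    then show "\<exists>no. \<forall>n\<ge>no. norm (L2_norm M (\<lambda>x. s n x - f x) - 0) < \<epsilon>" by auto
  qed
  with fL show ?thesis by blast
qed

section \<open>Orthonormal systems\<close>

definition orthonormal :: "'a measure \<Rightarrow> 'i set \<Rightarrow> ('i \<Rightarrow> 'a \<Rightarrow> complex) \<Rightarrow> bool" where
  "orthonormal M A u \<longleftrightarrow> (\<forall>i\<in>A. u i \<in> L2 M) \<and>
     (\<forall>i\<in>A. \<forall>j\<in>A. L2_inner M (u i) (u j) = (if i = j then 1 else 0))"

lemma orthonormal_subset: "orthonormal M A u \<Longrightarrow> B \<subseteq> A \<Longrightarrow> orthonormal M B u"
  unfolding orthonormal_def by blast

lemma orthonormal_inner_sum:
  assumes "orthonormal M A u" "finite A" "k \<in> A"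
  shows "L2_inner M (\<lambda>x. \<Sum>i\<in>A. a i * u i x) (u k) = a k"
proof -
  have "L2_inner M (\<lambda>x. \<Sum>i\<in>A. a i * u i x) (u k) = (\<Sum>i\<in>A. L2_inner M (\<lambda>x. a i * u i x) (u k))"
    using assms by (intro L2_inner_sum_left L2_scale) (auto simp: orthonormal_def)
  also have "\<dots> = (\<Sum>i\<in>A. if i = k then a i else 0)"
    using assms by (intro sum.cong) (auto simp: L2_inner_scale_left orthonormal_def)
  finally show ?thesis using assms by simp
qed

lemma orthonormal_norm_sum:
  assumes "orthonormal M A u" "finite A"
  shows "(L2_norm M (\<lambda>x. \<Sum>i\<in>A. a i * u i x))\<^sup>2 = (\<Sum>i\<in>A. (cmod (a i))\<^sup>2)"
proof -
  let ?S = "\<lambda>x. \<Sum>i\<in>A. a i * u i x"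
  have S: "?S \<in> L2 M" using assms by (intro L2_sum L2_scale) (auto simp: orthonormal_def)
  have "complex_of_real ((L2_norm M ?S)\<^sup>2) = L2_inner M ?S ?S" by (simp only: L2_inner_self)
  also have "\<dots> = (\<Sum>i\<in>A. L2_inner M (\<lambda>x. a i * u i x) ?S)"
    using assms S by (intro L2_inner_sum_left L2_scale) (auto simp: orthonormal_def)
  also have "\<dots> = (\<Sum>i\<in>A. a i * cnj (a i))"
    by (intro sum.cong refl)
       (simp add: L2_inner_scale_left L2_inner_cnj[of M _ ?S] orthonormal_inner_sum[OF assms])
  also have "\<dots> = complex_of_real (\<Sum>i\<in>A. (cmod (a i))\<^sup>2)"
    by (simp add: complex_norm_square del: of_real_power)
  finally show ?thesis using of_real_eq_iff by blast
qed

lemma orthonormal_remainder: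
  assumes on: "orthonormal M A u" "finite A" and f: "f \<in> L2 M"
  shows "(L2_norm M (\<lambda>x. f x - (\<Sum>i\<in>A. L2_inner M f (u i) * u i x)))\<^sup>2 =
         (L2_norm M f)\<^sup>2 - (\<Sum>i\<in>A. (cmod (L2_inner M f (u i)))\<^sup>2)"
proof -
  let ?S = "\<lambda>x. \<Sum>i\<in>A. L2_inner M f (u i) * u i x"
  have S: "?S \<in> L2 M" using assms by (intro L2_sum L2_scale) (auto simp: orthonormal_def)
  have "L2_inner M ?S f = (\<Sum>i\<in>A. L2_inner M (\<lambda>x. L2_inner M f (u i) * u i x) f)"
    using assms by (intro L2_inner_sum_left L2_scale) (auto simp: orthonormal_def)
  also have "\<dots> = (\<Sum>i\<in>A. L2_inner M f (u i) * cnj (L2_inner M f (u i)))"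
    by (intro sum.cong refl) (simp add: L2_inner_scale_left L2_inner_cnj[of M _ f])
  also have "\<dots> = complex_of_real (\<Sum>i\<in>A. (cmod (L2_inner M f (u i)))\<^sup>2)"
    by (simp add: complex_norm_square del: of_real_power)
  finally have "Re (L2_inner M f ?S) = (\<Sum>i\<in>A. (cmod (L2_inner M f (u i)))\<^sup>2)"
    using L2_inner_cnj[of M f ?S] by simp
  then show ?thesis
    using L2_norm_diff_sq[OF f S] orthonormal_norm_sum[OF on, of "\<lambda>i. L2_inner M f (u i)"] by simp
qed

lemma Bessel_inequality:
  assumes "orthonormal M A u" "finite A" "f \<in> L2 M"
  shows "(\<Sum>i\<in>A. (cmod (L2_inner M f (u i)))\<^sup>2) \<le> (L2_norm M f)\<^sup>2"
  using orthonormal_remainder[OF assms]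
    zero_le_power2[of "L2_norm M (\<lambda>x. f x - (\<Sum>i\<in>A. L2_inner M f (u i) * u i x))"] by linarith

lemma Parseval_finite:
  assumes on: "orthonormal M A u" "finite A" and f: "f \<in> L2 M"
    and total: "\<And>h. h \<in> L2 M \<Longrightarrow> (\<And>i. i \<in> A \<Longrightarrow> L2_inner M h (u i) = 0) \<Longrightarrow> (AE x in M. h x = 0)"
  shows "(\<Sum>i\<in>A. (cmod (L2_inner M f (u i)))\<^sup>2) = (L2_norm M f)\<^sup>2"
proof -
  let ?S = "\<lambda>x. \<Sum>i\<in>A. L2_inner M f (u i) * u i x"
  have S: "?S \<in> L2 M" using assms by (intro L2_sum L2_scale) (auto simp: orthonormal_def)
  have "AE x in M. f x - ?S x = 0"
  proof (rule total[OF L2_diff[OF f S]])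
    fix i assume "i \<in> A"
    then show "L2_inner M (\<lambda>x. f x - ?S x) (u i) = 0"
      using on f S orthonormal_inner_sum[OF on]
      by (subst L2_inner_diff_left) (auto simp: orthonormal_def)
  qed
  then have "L2_norm M (\<lambda>x. f x - ?S x) = 0" using L2_norm_eq_0_iff[OF L2_diff[OF f S]] by simp
  then show ?thesis using orthonormal_remainder[OF on f] by simp
qed

text \<open>Bessel's inequality makes the partial sums Cauchy; completeness provides their limit, and
  totality identifies it with \<open>f\<close>.\<close>

lemma Parseval_expansion:
  fixes u :: "nat \<Rightarrow> 'a \<Rightarrow> complex"
  assumes on: "orthonormal M UNIV u" and f: "f \<in> L2 M"
    and total: "\<And>h. h \<in> L2 M \<Longrightarrow> (\<And>n. L2_inner M h (u n) = 0) \<Longrightarrow> (AE x in M. h x = 0)"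
  shows "L2_lim M (\<lambda>N x. \<Sum>i<N. L2_inner M f (u i) * u i x) f"
    and "(\<lambda>i. (cmod (L2_inner M f (u i)))\<^sup>2) sums (L2_norm M f)\<^sup>2"
proof -
  let ?c = "\<lambda>i. L2_inner M f (u i)"
  let ?S = "\<lambda>N x. \<Sum>i<N. ?c i * u i x"
  have onA: "orthonormal M A u" for A using on orthonormal_subset by blast
  have uL: "u n \<in> L2 M" for n using on by (simp add: orthonormal_def)
  have S: "?S N \<in> L2 M" for N by (intro L2_sum L2_scale uL)
  have summ: "summable (\<lambda>i. (cmod (?c i))\<^sup>2)"
    using Bessel_inequality[OF onA _ f] by (intro bounded_imp_summable) auto
  have diff: "(L2_norm M (\<lambda>x. ?S m x - ?S n x))\<^sup>2 = (\<Sum>i\<in>{n..<m}. (cmod (?c i))\<^sup>2)" if "n \<le> m" for m n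
  proof -
    have "?S m x - ?S n x = (\<Sum>i\<in>{n..<m}. ?c i * u i x)" for x
      using sum_diff_nat_ivl[of 0 n m "\<lambda>i. ?c i * u i x"] that by (simp add: atLeast0LessThan)
    then show ?thesis using orthonormal_norm_sum[OF onA, of "{n..<m}"] by simp
  qed
  have "\<exists>p\<in>L2 M. L2_lim M (\<lambda>N. ?S N) p"
  proof (rule L2_complete[OF S])
    fix \<epsilon> :: real assume \<epsilon>: "\<epsilon> > 0"
    then have "\<epsilon>\<^sup>2 > 0" by simp
    with summ obtain N where N: "\<And>m n. m \<ge> N \<Longrightarrow> norm (\<Sum>i=m..<n. (cmod (?c i))\<^sup>2) < \<epsilon>\<^sup>2"
      unfolding summable_Cauchy by blast
    have *: "L2_norm M (\<lambda>x. ?S m x - ?S n x) < \<epsilon>" if "n \<ge> N" "n \<le> m" for m n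
      using N[OF that(1), of m] diff[OF that(2)] \<epsilon> by (intro power2_less_imp_less[of _ \<epsilon>]) auto
    have "L2_norm M (\<lambda>x. ?S m x - ?S n x) < \<epsilon>" if "n \<ge> N" "m \<ge> N" for m n
      using *[of n m] *[of m n] that L2_norm_minus_commute[of M "?S m" "?S n"] by (cases "n \<le> m") auto
    then show "\<exists>N. \<forall>m\<ge>N. \<forall>n\<ge>N. L2_norm M (\<lambda>x. ?S m x - ?S n x) < \<epsilon>" by blast
  qed
  then obtain p where p: "p \<in> L2 M" "L2_lim M (\<lambda>N. ?S N) p" by blast
  have "L2_inner M p (u k) = ?c k" for k
  proof (rule LIMSEQ_unique)
    show "(\<lambda>N. L2_inner M (?S N) (u k)) \<longlonglongrightarrow> L2_inner M p (u k)"
      by (rule L2_inner_tendsto_left[OF S p(1) uL p(2)])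
    show "(\<lambda>N. L2_inner M (?S N) (u k)) \<longlonglongrightarrow> ?c k"
      by (rule tendsto_eventually, rule eventually_sequentiallyI[of "Suc k"])
         (simp add: orthonormal_inner_sum[OF onA])
  qed
  then have "AE x in M. f x - p x = 0"
    by (intro total L2_diff f p) (simp add: L2_inner_diff_left f p uL)
  then have "AE x in M. ?S N x - p x = ?S N x - f x" for N by eventually_elim simp
  then have "L2_norm M (\<lambda>x. ?S N x - p x) = L2_norm M (\<lambda>x. ?S N x - f x)" for N
    by (rule L2_norm_cong_AE) (intro L2_measurable L2_diff S p f)+
  with p(2) show lim: "L2_lim M (\<lambda>N. ?S N) f" by simp
  have "(\<lambda>N. (L2_norm M (?S N))\<^sup>2) \<longlonglongrightarrow> (L2_norm M f)\<^sup>2"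
    by (intro tendsto_power L2_norm_tendsto[OF S f lim])
  then show "(\<lambda>i. (cmod (?c i))\<^sup>2) sums (L2_norm M f)\<^sup>2"
    unfolding sums_def using orthonormal_norm_sum[OF onA, of "{..<_}" ?c] by simp
qed

section \<open>An orthonormal basis of the square-integrable functions on the line\<close>

lemma completion_ex_borel_measurable_complex:
  fixes f :: "'a \<Rightarrow> complex"
  assumes "f \<in> borel_measurable (completion M)"
  shows "\<exists>f'\<in>borel_measurable M. AE x in M. f x = f' x"
proof -
  have "(\<lambda>x. Re (f x)) \<in> borel_measurable (completion M)" "(\<lambda>x. Im (f x)) \<in> borel_measurable (completion M)"
    using assms by measurable
  then obtain a b where [measurable]: "a \<in> borel_measurable M" "b \<in> borel_measurable M"
    and ab: "AE x in M. Re (f x) = a x" "AE x in M. Im (f x) = b x"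
    using completion_ex_borel_measurable_real[of "\<lambda>x. Re (f x)" M]
      completion_ex_borel_measurable_real[of "\<lambda>x. Im (f x)" M] by blast
  show ?thesis
  proof (rule bexI[of _ "\<lambda>x. complex_of_real (a x) + \<i> * complex_of_real (b x)"])
    show "AE x in M. f x = complex_of_real (a x) + \<i> * complex_of_real (b x)"
      using ab by eventually_elim (simp add: complex_eq_iff)
  qed measurable
qed

text \<open>Fubini's theorem and substitutions are applied to Borel functions on \<open>lborel\<close>; this is the passage from
classes of Lebesgue measurable functions.\<close>

lemma L2_lebesgue_borel_representative:
  fixes f :: "'a::euclidean_space \<Rightarrow> complex"
  assumes "f \<in> L2 lebesgue"
  obtains f' where "f' \<in> borel_measurable borel" "f' \<in> L2 lborel" "f' \<in> L2 lebesgue"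
    "AE x in lebesgue. f x = f' x" "AE x in lborel. f x = f' x"
proof -
  obtain f' where f': "f' \<in> borel_measurable lborel" "AE x in lborel. f x = f' x"
    using completion_ex_borel_measurable_complex[of f lborel] assms L2_measurable by blast
  have ae: "AE x in lebesgue. f x = f' x" using f'(2) by (rule AE_completion)
  have m: "f' \<in> borel_measurable lebesgue" using f'(1) by (rule measurable_completion)
  have L: "f' \<in> L2 lebesgue" by (rule L2_cong_AE[OF ae m assms])
  have "f' \<in> L2 lborel" using L f'(1) by (simp add: L2_iff_nn nn_integral_completion)
  with f' ae L show ?thesis by (intro that[of f']) auto
qed

lemma L2_indicator:
  assumes "A \<in> sets M" "emeasure M A < \<infinity>"
  shows "(\<lambda>x. indicator A x :: complex) \<in> L2 M"
proof -
  have "(\<lambda>x. (cmod (indicator A x))\<^sup>2) = (\<lambda>x. indicator A x :: real)"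
    by (auto simp: indicator_def)
  then show ?thesis using assms by (auto simp: L2_def)
qed

text \<open>Gram--Schmidt orthogonalisation without normalisation. A vector that depends on its
  predecessors yields a vector of norm \<open>0\<close>; it contributes nothing to later steps because \<open>0 / 0 = 0\<close>.\<close>

fun gram_schmidt :: "'a measure \<Rightarrow> (nat \<Rightarrow> 'a \<Rightarrow> complex) \<Rightarrow> nat \<Rightarrow> 'a \<Rightarrow> complex" where
  "gram_schmidt M v n = (\<lambda>x. v n x - (\<Sum>i\<in>{..<n}.
     (L2_inner M (v n) (gram_schmidt M v i) / L2_inner M (gram_schmidt M v i) (gram_schmidt M v i))
       * gram_schmidt M v i x))"

declare gram_schmidt.simps [simp del]

lemma gram_schmidt_L2:
  assumes "\<And>n. v n \<in> L2 M"
  shows "gram_schmidt M v n \<in> L2 M"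
proof (induction n rule: less_induct)
  case (less n)
  show ?case
    by (subst gram_schmidt.simps) (intro L2_diff L2_sum L2_scale assms less, simp)
qed

lemma gram_schmidt_orthogonal_less:
  assumes v: "\<And>n. v n \<in> L2 M"
  shows "m < n \<Longrightarrow> L2_inner M (gram_schmidt M v n) (gram_schmidt M v m) = 0"
proof (induction n arbitrary: m rule: less_induct)
  case (less n)
  let ?w = "gram_schmidt M v"
  note wL = gram_schmidt_L2[where v=v, OF v]
  have orth: "L2_inner M (?w i) (?w m) = 0" if "i < n" "i \<noteq> m" for i
  proof (cases "m < i")
    case True then show ?thesis using less.IH[OF that(1)] by blast
  next
    case False
    with that have "L2_inner M (?w m) (?w i) = 0" using less.IH[OF less.prems, of i] by simp
    then show ?thesis using L2_inner_cnj[of M "?w i" "?w m"] by simp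
  qed
  let ?c = "\<lambda>i. L2_inner M (v n) (?w i) / L2_inner M (?w i) (?w i)"
  have "L2_inner M (?w n) (?w m) =
      L2_inner M (v n) (?w m) - L2_inner M (\<lambda>x. \<Sum>i\<in>{..<n}. ?c i * ?w i x) (?w m)"
    by (subst gram_schmidt.simps[of M v n]) (intro L2_inner_diff_left v L2_sum L2_scale wL)
  also have "L2_inner M (\<lambda>x. \<Sum>i\<in>{..<n}. ?c i * ?w i x) (?w m) = (\<Sum>i\<in>{..<n}. ?c i * L2_inner M (?w i) (?w m))"
    by (subst L2_inner_sum_left) (rule L2_scale, rule wL, rule wL, simp only: L2_inner_scale_left)
  also have "\<dots> = (\<Sum>i\<in>{..<n}. if i = m then ?c m * L2_inner M (?w m) (?w m) else 0)"
    using orth by (intro sum.cong) auto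
  also have "\<dots> = ?c m * L2_inner M (?w m) (?w m)" using less.prems by simp
  also have "L2_inner M (v n) (?w m) - \<dots> = 0"
  proof (cases "L2_inner M (?w m) (?w m) = 0")
    case True
    then have "L2_norm M (?w m) = 0" by (simp add: L2_inner_self)
    then have "cmod (L2_inner M (v n) (?w m)) \<le> 0" using L2_Cauchy_Schwarz[OF v wL, of n m] by simp
    then show ?thesis by simp
  qed simp
  finally show ?case .
qed

lemma gram_schmidt_orthogonal:
  assumes v: "\<And>n. v n \<in> L2 M" and "m \<noteq> n"
  shows "L2_inner M (gram_schmidt M v n) (gram_schmidt M v m) = 0"
proof (cases "m < n")
  case True then show ?thesis by (rule gram_schmidt_orthogonal_less[where v=v, OF v])
next
  case False
  then have "L2_inner M (gram_schmidt M v m) (gram_schmidt M v n) = 0"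
    using assms by (intro gram_schmidt_orthogonal_less) auto
  then show ?thesis using L2_inner_cnj[of M "gram_schmidt M v n" "gram_schmidt M v m"] by simp
qed

lemma gram_schmidt_span:
  assumes v: "\<And>n. v n \<in> L2 M" and h: "h \<in> L2 M" and orth: "\<And>n. L2_inner M h (gram_schmidt M v n) = 0"
  shows "L2_inner M h (v n) = 0"
proof -
  let ?w = "gram_schmidt M v"
  note wL = gram_schmidt_L2[where v=v, OF v]
  let ?c = "\<lambda>i. L2_inner M (v n) (?w i) / L2_inner M (?w i) (?w i)"
  have "v n = (\<lambda>x. ?w n x + (\<Sum>i\<in>{..<n}. ?c i * ?w i x))"
    by (subst gram_schmidt.simps[of M v n]) simp
  then have "L2_inner M (v n) h = L2_inner M (\<lambda>x. ?w n x + (\<Sum>i\<in>{..<n}. ?c i * ?w i x)) h" by simp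
  also have "\<dots> = L2_inner M (?w n) h + L2_inner M (\<lambda>x. \<Sum>i\<in>{..<n}. ?c i * ?w i x) h"
    by (intro L2_inner_add_left L2_sum L2_scale wL h)
  also have "L2_inner M (\<lambda>x. \<Sum>i\<in>{..<n}. ?c i * ?w i x) h = (\<Sum>i\<in>{..<n}. ?c i * L2_inner M (?w i) h)"
    by (subst L2_inner_sum_left) (rule L2_scale, rule wL, rule h, simp only: L2_inner_scale_left)
  finally show ?thesis
    using orth L2_inner_cnj[of M _ h] by simp
qed

definition rational_interval :: "nat \<Rightarrow> real set" where
  "rational_interval n = (case from_nat n of (a :: rat, b :: rat) \<Rightarrow> {of_rat a <..< of_rat b})"

lemma rational_interval_exists: "\<exists>n. rational_interval n = {of_rat a <..< of_rat b}"
  by (rule exI[of _ "to_nat (a, b)"]) (simp add: rational_interval_def)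

lemma rational_interval_Int: "\<exists>k. rational_interval k = rational_interval m \<inter> rational_interval n"
proof -
  obtain a b c d where "from_nat m = (a :: rat, b :: rat)" "from_nat n = (c :: rat, d :: rat)"
    by (metis surj_pair)
  then have "rational_interval m \<inter> rational_interval n = {of_rat (max a c) <..< of_rat (min b d)}"
    unfolding rational_interval_def by (auto simp: max_def min_def of_rat_less of_rat_less_eq)
  then show ?thesis using rational_interval_exists by metis
qed

lemma borel_eq_rational_interval: "(borel :: real measure) = sigma UNIV (range rational_interval)"
proof (rule borel_eq_countable_basis)
  show "topological_basis (range rational_interval)"
  proof (rule topological_basisI)
    fix S assume "S \<in> range rational_interval"
    then show "open S" by (auto simp: rational_interval_def split: prod.splits)
  next
    fix S :: "real set" and x assume "open S" "x \<in> S"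
    then obtain e where e: "e > 0" "\<And>y. dist y x < e \<Longrightarrow> y \<in> S" by (metis open_dist)
    obtain a b where ab: "x - e < of_rat a" "of_rat a < x" "x < of_rat b" "of_rat b < x + e"
      using of_rat_dense[of "x - e" x] of_rat_dense[of x "x + e"] e by auto
    obtain n where n: "rational_interval n = {of_rat a <..< of_rat b}" using rational_interval_exists by metis
    have "rational_interval n \<subseteq> S"
      unfolding n using ab by (auto intro!: e(2) simp: dist_real_def)
    then show "\<exists>B'\<in>range rational_interval. x \<in> B' \<and> B' \<subseteq> S" using n ab by (intro bexI[of _ "rational_interval n"]) auto
  qed
qed simp

lemma emeasure_open_interval_finite: "emeasure lborel {a<..<b :: real} < top"
  using emeasure_bounded_finite[of "{a<..<b}"] by simp

lemma rational_interval_sets: "rational_interval n \<in> sets borel"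
  and rational_interval_finite: "emeasure lborel (rational_interval n) < \<infinity>"
  by (auto simp: rational_interval_def emeasure_open_interval_finite split: prod.splits)

text \<open>The integral of such an \<open>h\<close> vanishes over all rational intervals, an intersection-stable generator of the Borel sets,
hence over all Borel subsets of a bounded interval, and so \<open>h\<close> vanishes there. Bounded intervals are needed because
\<open>h\<close> is integrable only over sets of finite measure.\<close>

lemma rational_intervals_total:
  assumes h: "h \<in> L2R" and orth: "\<And>n. L2_inner lebesgue h (\<lambda>x. indicator (rational_interval n) x) = 0"
  shows "AE x in lebesgue. h x = 0"
proof -
  from h obtain h' where h': "h' \<in> borel_measurable borel" "h' \<in> L2 lborel" "h' \<in> L2 lebesgue"
    "AE x in lebesgue. h x = h' x" "AE x in lborel. h x = h' x"
    by (rule L2_lebesgue_borel_representative)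
  note [measurable] = h'(1) rational_interval_sets
  have integ: "set_integrable lborel A h'" if A: "A \<in> sets borel" "emeasure lborel A < \<infinity>" for A
  proof -
    have "integrable lborel (\<lambda>x. h' x * cnj (indicator A x))"
      using A by (intro L2_integrable_mult h' L2_indicator) auto
    moreover have "(\<lambda>x. h' x * cnj (indicator A x)) = (\<lambda>x. indicator A x *\<^sub>R h' x)"
      by (auto simp: indicator_def)
    ultimately show ?thesis by (simp add: set_integrable_def)
  qed
  have zero: "(LINT x:rational_interval n|lborel. h' x) = 0" for n
  proof -
    let ?A = "rational_interval n"
    have "0 = L2_inner lebesgue h (\<lambda>x. indicator ?A x)" using orth by simp
    also have "\<dots> = L2_inner lebesgue h' (\<lambda>x. indicator ?A x)"
      using h' L2_measurable[OF h] by (intro L2_inner_cong_AE) (auto intro!: measurable_completion)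
    also have "\<dots> = (LINT x|lborel. h' x * cnj (indicator ?A x))"
      unfolding L2_inner_def by (intro integral_completion) measurable
    also have "\<dots> = (LINT x:?A|lborel. h' x)"
      unfolding set_lebesgue_integral_def by (intro Bochner_Integration.integral_cong) (auto simp: indicator_def)
    finally show ?thesis by simp
  qed
  have box: "AE x in lborel. x \<in> {-real N<..<real N} \<longrightarrow> h' x = 0" for N :: nat
  proof -
    define K where "K = {-real N<..<real N}"
    have K: "K \<in> sets borel" "emeasure lborel K < \<infinity>" by (auto simp: K_def emeasure_open_interval_finite)
    obtain kn where kn: "rational_interval kn = K"
      using rational_interval_exists[of "- of_nat N" "of_nat N"] by (auto simp: K_def of_rat_minus)
    have fin: "set_integrable lborel (A \<inter> K) h'" if "A \<in> sets borel" for A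
    proof (rule integ)
      show "A \<inter> K \<in> sets borel" using that K by auto
      have "emeasure lborel (A \<inter> K) \<le> emeasure lborel K" using K that by (intro emeasure_mono) auto
      then show "emeasure lborel (A \<inter> K) < \<infinity>" using K by (auto intro: order_le_less_trans)
    qed
    have all: "(LINT x:(A \<inter> K)|lborel. h' x) = 0" if "A \<in> sets borel" for A
    proof -
      have st: "Int_stable (range rational_interval)"
        unfolding Int_stable_def using rational_interval_Int by (metis (no_types, lifting) imageE rangeI)
      have A: "A \<in> sigma_sets UNIV (range rational_interval)"
        using that by (subst (asm) borel_eq_rational_interval) simp
      have eqs: "sigma_sets UNIV (range rational_interval) = sets borel"
        by (subst borel_eq_rational_interval) simp
      have "range rational_interval \<subseteq> Pow UNIV" by simp
      from st this A show ?thesis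
      proof (induction rule: sigma_sets_induct_disjoint)
        case (basic A)
        then obtain m where "A = rational_interval m" by auto
        then obtain k where "A \<inter> K = rational_interval k" using rational_interval_Int kn by metis
        then show ?case using zero by simp
      next
        case empty then show ?case by (simp add: set_lebesgue_integral_def)
      next
        case (compl A)
        then have A: "A \<in> sets borel" by (simp add: eqs)
        have "(LINT x:(A \<inter> K) \<union> ((UNIV - A) \<inter> K)|lborel. h' x) =
            (LINT x:(A \<inter> K)|lborel. h' x) + (LINT x:((UNIV - A) \<inter> K)|lborel. h' x)"
          using A by (intro set_integral_Un fin) auto
        moreover have "(A \<inter> K) \<union> ((UNIV - A) \<inter> K) = K" by auto
        ultimately show ?case using compl zero[of kn] kn by simp
      next
        case (union A)
        then have A: "A i \<in> sets borel" for i by (auto simp: eqs)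
        have "(LINT x:(\<Union>i. A i \<inter> K)|lborel. h' x) = (\<Sum>i. (LINT x:(A i \<inter> K)|lborel. h' x))"
        proof (rule lebesgue_integral_countable_add)
          show "A i \<inter> K \<in> sets lborel" for i using A K by auto
          show "\<And>i j. i \<noteq> j \<Longrightarrow> A i \<inter> K \<inter> (A j \<inter> K) = {}"
            using union by (auto simp: disjoint_family_on_def)
          have "(\<Union>i. A i \<inter> K) = (\<Union>i. A i) \<inter> K" by auto
          then show "set_integrable lborel (\<Union>i. A i \<inter> K) h'" using fin[of "\<Union>i. A i"] A by auto
        qed
        then show ?case using union by simp
      qed
    qed
    have "AE x in lborel. indicator K x *\<^sub>R h' x = 0"
    proof (rule sigma_finite_measure.density_zero[OF sigma_finite_lborel])
      show "integrable lborel (\<lambda>x. indicator K x *\<^sub>R h' x)" using integ[OF K] by (simp add: set_integrable_def)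
      fix A :: "real set" assume "A \<in> sets lborel"
      then have "(LINT x:(A \<inter> K)|lborel. h' x) = 0" using all by simp
      then show "(LINT x:A|lborel. indicator K x *\<^sub>R h' x) = 0"
        by (simp add: set_lebesgue_integral_def indicator_inter_arith mult.commute)
    qed
    then show ?thesis by eventually_elim (auto simp: K_def indicator_def)
  qed
  have "AE x in lborel. \<forall>N::nat. x \<in> {-real N<..<real N} \<longrightarrow> h' x = 0"
    unfolding AE_all_countable using box by blast
  then have "AE x in lborel. h' x = 0"
  proof eventually_elim
    case (elim x)
    obtain N :: nat where "\<bar>x\<bar> < real N" using reals_Archimedean2 by blast
    then have "x \<in> {-real N<..<real N}" by auto
    then show ?case using elim by blast
  qed
  then have "AE x in lebesgue. h' x = 0" by (rule AE_completion)
  with h'(4) show ?thesis by eventually_elim simp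
qed

text \<open>The Gram--Schmidt vectors of the rational intervals that do not vanish form the basis. If only
  finitely many, say \<open>d\<close>, were left, then the \<open>d + 1\<close> orthonormal indicators of unit intervals would have
  total energy \<open>d + 1\<close> along them by Parseval's identity, but at most \<open>d\<close> by Bessel's inequality.\<close>

lemma orthonormal_basis_exists: "\<exists>u. orthonormal_basis u"
proof -
  define v where "v n = (\<lambda>x. indicator (rational_interval n) x :: complex)" for n
  have v: "v n \<in> L2R" for n
    unfolding v_def using rational_interval_sets rational_interval_finite
    by (intro L2_indicator) auto
  define w where "w = gram_schmidt lebesgue v"
  have wL: "w n \<in> L2R" for n unfolding w_def by (rule gram_schmidt_L2[where v=v, OF v])
  define S where "S = {n. L2_norm lebesgue (w n) \<noteq> 0}"
  define U where "U n = (\<lambda>x. (1 / complex_of_real (L2_norm lebesgue (w n))) * w n x)" for n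
  have U: "U n \<in> L2R" for n unfolding U_def by (intro L2_scale wL)
  have inner: "L2_inner lebesgue (U m) (U n) = (if m = n then 1 else 0)" if "m \<in> S" "n \<in> S" for m n
  proof (cases "m = n")
    case True
    then show ?thesis using that unfolding U_def
      by (simp only: L2_inner_scale_left L2_inner_scale_right L2_inner_self)
         (simp add: S_def power2_eq_square)
  next
    case False
    then have "L2_inner lebesgue (w m) (w n) = 0" unfolding w_def using v by (intro gram_schmidt_orthogonal) auto
    then show ?thesis using False unfolding U_def
      by (simp only: L2_inner_scale_left L2_inner_scale_right) simp
  qed
  have on: "orthonormal lebesgue S U" using U inner by (simp add: orthonormal_def)
  have total: "AE x in lebesgue. h x = 0" if h: "h \<in> L2R" and orth: "\<And>n. n \<in> S \<Longrightarrow> L2_inner lebesgue h (U n) = 0" for h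
  proof (rule rational_intervals_total[OF h])
    have "L2_inner lebesgue h (w n) = 0" for n
    proof (cases "n \<in> S")
      case True
      with orth[OF True] show ?thesis
        unfolding U_def by (simp only: L2_inner_scale_right) (simp add: S_def)
    next
      case False
      then show ?thesis using L2_Cauchy_Schwarz[OF h wL, of n] by (simp add: S_def)
    qed
    then show "L2_inner lebesgue h (\<lambda>x. indicator (rational_interval n) x) = 0" for n
      using gram_schmidt_span[where v=v, OF v h, of n] by (simp add: w_def v_def)
  qed
  have "infinite S"
  proof
    assume fin: "finite S"
    define b where "b k = (\<lambda>x. indicator {real k..<real k + 1} x :: complex)" for k :: nat
    have b: "b k \<in> L2R" for k unfolding b_def by (intro L2_indicator) auto
    have "L2_inner lebesgue (b k) (b l) = (if k = l then 1 else 0)" for k l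
    proof -
      have "L2_inner lebesgue (b k) (b l) = (LINT x|lebesgue. complex_of_real (indicator ({real k..<real k + 1} \<inter> {real l..<real l + 1}) x))"
        unfolding L2_inner_def b_def by (intro Bochner_Integration.integral_cong) (auto simp: indicator_def)
      also have "{real k..<real k + 1} \<inter> {real l..<real l + 1} = (if k = l then {real k..<real k + 1} else {})"
        by (auto simp: not_le)
      finally show ?thesis by (simp only: integral_complex_of_real) simp
    qed
    then have onb: "orthonormal lebesgue A b" for A using b by (auto simp: orthonormal_def)
    define d where "d = Suc (card S)"
    have norm1: "(L2_norm lebesgue (b k))\<^sup>2 = 1" for k
    proof -
      have "complex_of_real ((L2_norm lebesgue (b k))\<^sup>2) = 1"
        using onb[of UNIV] by (simp only: L2_inner_self[symmetric]) (simp add: orthonormal_def)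
      then show ?thesis using of_real_eq_1_iff by blast
    qed
    have normU: "(L2_norm lebesgue (U n))\<^sup>2 = 1" if "n \<in> S" for n
    proof -
      have "complex_of_real ((L2_norm lebesgue (U n))\<^sup>2) = 1"
        using inner[OF that that] by (simp only: L2_inner_self[symmetric]) simp
      then show ?thesis using of_real_eq_1_iff by blast
    qed
    have "real d = (\<Sum>k<d. \<Sum>n\<in>S. (cmod (L2_inner lebesgue (b k) (U n)))\<^sup>2)"
      using Parseval_finite[OF on fin b total] norm1 by simp
    also have "\<dots> = (\<Sum>n\<in>S. \<Sum>k<d. (cmod (L2_inner lebesgue (U n) (b k)))\<^sup>2)"
      by (subst sum.swap) (simp add: L2_inner_cnj[of lebesgue "U _" "b _"])
    also have "\<dots> \<le> (\<Sum>n\<in>S. 1)"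
      using Bessel_inequality[OF onb _ U] normU by (intro sum_mono) (metis finite_lessThan)
    also have "\<dots> = real (card S)" by simp
    finally show False by (simp add: d_def)
  qed
  then have bij: "bij_betw (enumerate S) UNIV S" by (rule bij_enumerate)
  have "orthonormal_basis (\<lambda>n. U (enumerate S n))"
    unfolding orthonormal_basis_def
  proof (intro conjI allI ballI impI)
    show "U (enumerate S n) \<in> L2R" for n by (rule U)
    show "L2_inner lebesgue (U (enumerate S m)) (U (enumerate S n)) = (if m = n then 1 else 0)" for m n
      using bij by (subst inner) (auto simp: bij_betw_def inj_eq)
    fix f assume f: "f \<in> L2R" "\<forall>n. L2_inner lebesgue f (U (enumerate S n)) = 0"
    show "AE t in lebesgue. f t = 0"
    proof (rule total[OF f(1)])
      fix n assume "n \<in> S"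
      then obtain k where "n = enumerate S k" using bij by (auto simp: bij_betw_def)
      then show "L2_inner lebesgue f (U n) = 0" using f by simp
    qed
  qed
  then show ?thesis by blast
qed

section \<open>The Hilbert--Schmidt norm\<close>

lemma orthonormal_basis_expansion:
  assumes "orthonormal_basis u" "f \<in> L2R"
  shows "L2_lim lebesgue (\<lambda>N x. \<Sum>i<N. L2_inner lebesgue f (u i) * u i x) f"
    and "(\<lambda>i. (cmod (L2_inner lebesgue f (u i)))\<^sup>2) sums (L2_norm lebesgue f)\<^sup>2"
  using assms by (auto intro!: Parseval_expansion[of lebesgue u f] simp: orthonormal_basis_def orthonormal_def)

lemma orthonormal_basis_Parseval:
  assumes "orthonormal_basis u" "f \<in> L2R"
  shows "(\<Sum>i. ennreal ((cmod (L2_inner lebesgue f (u i)))\<^sup>2)) = ennreal ((L2_norm lebesgue f)\<^sup>2)"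
  using orthonormal_basis_expansion(2)[OF assms] by (intro suminf_ennreal_eq) auto

text \<open>The basis that the definition of \<open>hs_norm_sq\<close> selects.\<close>

definition std_basis :: "nat \<Rightarrow> real \<Rightarrow> complex" where
  "std_basis = (SOME u. orthonormal_basis u)"

lemma std_basis: "orthonormal_basis std_basis"
  unfolding std_basis_def using orthonormal_basis_exists by (rule someI_ex)

lemma std_basis_L2: "std_basis n \<in> L2R"
  using std_basis by (simp add: orthonormal_basis_def)

lemma hs_norm_sq_eq: "hs_norm_sq A = (\<Sum>n. ennreal ((L2_norm lebesgue (A (std_basis n)))\<^sup>2))"
  by (simp add: hs_norm_sq_def std_basis_def)

lemma bounded_operator_L2: "bounded_operator B \<Longrightarrow> f \<in> L2R \<Longrightarrow> B f \<in> L2R"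
  by (simp add: bounded_operator_def)

lemma bounded_operator_linear:
  "bounded_operator B \<Longrightarrow> f \<in> L2R \<Longrightarrow> g \<in> L2R \<Longrightarrow>
   AE t in lebesgue. B (\<lambda>s. a * f s + b * g s) t = a * B f t + b * B g t"
  by (simp add: bounded_operator_def)

lemma bounded_operator_bound:
  assumes "bounded_operator B"
  obtains C where "C \<ge> 0" "\<And>f. f \<in> L2R \<Longrightarrow> L2_norm lebesgue (B f) \<le> C * L2_norm lebesgue f"
proof -
  obtain C where C: "\<And>f. f \<in> L2R \<Longrightarrow> L2_norm lebesgue (B f) \<le> C * L2_norm lebesgue f"
    using assms unfolding bounded_operator_def by blast
  have "L2_norm lebesgue (B f) \<le> max C 0 * L2_norm lebesgue f" if "f \<in> L2R" for f
    using C[OF that] mult_right_mono[of C "max C 0" "L2_norm lebesgue f"] by simp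
  then show ?thesis by (intro that[of "max C 0"]) auto
qed

lemma bounded_operator_diff:
  assumes B: "bounded_operator B" and f: "f \<in> L2R" and g: "g \<in> L2R"
  shows "AE t in lebesgue. B (\<lambda>s. f s - g s) t = B f t - B g t"
  using bounded_operator_linear[OF B f g, of 1 "-1"] by simp

lemma bounded_operator_cong_AE:
  assumes B: "bounded_operator B" and f: "f \<in> L2R" and g: "g \<in> L2R" and fg: "AE t in lebesgue. f t = g t"
  shows "AE t in lebesgue. B f t = B g t"
proof -
  obtain C where C: "C \<ge> 0" "\<And>f. f \<in> L2R \<Longrightarrow> L2_norm lebesgue (B f) \<le> C * L2_norm lebesgue f"
    using bounded_operator_bound[OF B] by blast
  have d: "(\<lambda>s. f s - g s) \<in> L2R" using f g by (rule L2_diff)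
  have "L2_norm lebesgue (\<lambda>s. f s - g s) = 0" using L2_norm_eq_0_iff[OF d] fg by simp
  then have "L2_norm lebesgue (B (\<lambda>s. f s - g s)) \<le> 0" using C(2)[OF d] by simp
  then have "AE t in lebesgue. B (\<lambda>s. f s - g s) t = 0"
    using L2_norm_eq_0_iff[OF bounded_operator_L2[OF B d]] L2_norm_nonneg by (metis order_antisym)
  with bounded_operator_diff[OF B f g] show ?thesis by eventually_elim simp
qed

lemma bounded_operator_norm_sum:
  fixes u :: "nat \<Rightarrow> real \<Rightarrow> complex"
  assumes B: "bounded_operator B" and u: "\<And>n. u n \<in> L2R"
  shows "L2_norm lebesgue (B (\<lambda>s. \<Sum>i<N. c i * u i s)) \<le> (\<Sum>i<N. cmod (c i) * L2_norm lebesgue (B (u i)))"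
proof (induction N)
  case 0
  obtain C where "\<And>f. f \<in> L2R \<Longrightarrow> L2_norm lebesgue (B f) \<le> C * L2_norm lebesgue f"
    using bounded_operator_bound[OF B] by blast
  from this[of "\<lambda>_. 0"] show ?case by simp
next
  case (Suc N)
  let ?S = "\<lambda>s. \<Sum>i<N. c i * u i s"
  have S: "?S \<in> L2R" by (intro L2_sum L2_scale u)
  have "AE t in lebesgue. B (\<lambda>s. ?S s + c N * u N s) t = B ?S t + c N * B (u N) t"
    using bounded_operator_linear[OF B S u[of N], of 1 "c N"] by simp
  then have "L2_norm lebesgue (B (\<lambda>s. ?S s + c N * u N s)) = L2_norm lebesgue (\<lambda>t. B ?S t + c N * B (u N) t)"
    by (rule L2_norm_cong_AE)
       (intro L2_measurable bounded_operator_L2[OF B] L2_add L2_scale S u)+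
  also have "\<dots> \<le> L2_norm lebesgue (B ?S) + L2_norm lebesgue (\<lambda>t. c N * B (u N) t)"
    by (intro L2_norm_triangle bounded_operator_L2[OF B] L2_scale S u)
  finally show ?case using Suc by (simp add: L2_norm_scale)
qed

text \<open>On the partial sums of the expansion of \<open>f\<close> the bound is the Cauchy--Schwarz inequality; boundedness of \<open>B\<close> carries it
to the limit.\<close>

lemma operator_norm_le_hs_norm:
  assumes B: "bounded_operator B" and f: "f \<in> L2R"
  shows "ennreal ((L2_norm lebesgue (B f))\<^sup>2) \<le> hs_norm_sq B * ennreal ((L2_norm lebesgue f)\<^sup>2)"
proof (cases "hs_norm_sq B = \<infinity> \<and> L2_norm lebesgue f \<noteq> 0")
  case True
  then show ?thesis by (simp add: ennreal_top_mult)
next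
  case False
  obtain C where C: "C \<ge> 0" "\<And>f. f \<in> L2R \<Longrightarrow> L2_norm lebesgue (B f) \<le> C * L2_norm lebesgue f"
    using bounded_operator_bound[OF B] by blast
  show ?thesis
  proof (cases "L2_norm lebesgue f = 0")
    case True
    then have "L2_norm lebesgue (B f) = 0" using C(2)[OF f] L2_norm_nonneg[of lebesgue "B f"] by simp
    then show ?thesis by simp
  next
    case nz: False
    let ?u = std_basis
    let ?c = "\<lambda>i. L2_inner lebesgue f (?u i)"
    let ?b = "\<lambda>i. L2_norm lebesgue (B (?u i))"
    let ?S = "\<lambda>N s. \<Sum>i<N. ?c i * ?u i s"
    have S: "?S N \<in> L2R" for N by (intro L2_sum L2_scale std_basis_L2)
    from False nz have fin: "hs_norm_sq B \<noteq> \<infinity>" by simp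
    then have summ: "summable (\<lambda>i. (?b i)\<^sup>2)"
      by (intro summable_suminf_not_top) (auto simp: hs_norm_sq_eq)
    define h where "h = (\<Sum>i. (?b i)\<^sup>2)"
    have h: "hs_norm_sq B = ennreal h" unfolding hs_norm_sq_eq h_def by (rule suminf_ennreal2) (auto simp: summ)
    have h0: "h \<ge> 0" unfolding h_def by (rule suminf_nonneg[OF summ]) simp
    have SB: "L2_norm lebesgue (B (?S N)) \<le> L2_norm lebesgue f * sqrt h" for N
    proof -
      have "L2_norm lebesgue (B (?S N)) \<le> (\<Sum>i<N. \<bar>cmod (?c i)\<bar> * \<bar>?b i\<bar>)"
        using bounded_operator_norm_sum[OF B std_basis_L2, where c = ?c and N = N] by simp
      also have "\<dots> \<le> L2_set (\<lambda>i. cmod (?c i)) {..<N} * L2_set ?b {..<N}"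
        by (rule L2_set_mult_ineq)
      also have "\<dots> \<le> L2_norm lebesgue f * sqrt h"
      proof (rule mult_mono)
        have "(\<Sum>i<N. (cmod (?c i))\<^sup>2) \<le> (L2_norm lebesgue f)\<^sup>2"
          using std_basis by (intro Bessel_inequality) (auto simp: orthonormal_def orthonormal_basis_def f)
        then show "L2_set (\<lambda>i. cmod (?c i)) {..<N} \<le> L2_norm lebesgue f"
          unfolding L2_set_def by (intro real_le_lsqrt) auto
        have "(\<Sum>i<N. (?b i)\<^sup>2) \<le> h" unfolding h_def by (rule sum_le_suminf[OF summ]) auto
        then show "L2_set ?b {..<N} \<le> sqrt h" unfolding L2_set_def by simp
      qed (auto simp: L2_set_nonneg h0)
      finally show ?thesis .
    qed
    have "L2_norm lebesgue (B f) \<le> L2_norm lebesgue f * sqrt h + C * L2_norm lebesgue (\<lambda>x. ?S N x - f x)" for N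
    proof -
      have d: "(\<lambda>x. f x - ?S N x) \<in> L2R" by (intro L2_diff S f)
      have "L2_norm lebesgue (B f) = L2_norm lebesgue (\<lambda>t. B (?S N) t + B (\<lambda>s. f s - ?S N s) t)"
        using bounded_operator_linear[OF B S[of N] d, of 1 1] 
        by (intro L2_norm_cong_AE L2_measurable bounded_operator_L2[OF B] L2_add S d f) simp
      also have "\<dots> \<le> L2_norm lebesgue (B (?S N)) + L2_norm lebesgue (B (\<lambda>s. f s - ?S N s))"
        by (intro L2_norm_triangle bounded_operator_L2[OF B] S d)
      also have "\<dots> \<le> L2_norm lebesgue f * sqrt h + C * L2_norm lebesgue (\<lambda>s. f s - ?S N s)"
        by (intro add_mono SB C d)
      finally show ?thesis by (simp add: L2_norm_minus_commute)
    qed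
    then have "L2_norm lebesgue (B f) \<le> L2_norm lebesgue f * sqrt h + C * 0"
      using orthonormal_basis_expansion(1)[OF std_basis f]
      by (intro tendsto_lowerbound[OF tendsto_add[OF tendsto_const tendsto_mult[OF tendsto_const]]]) auto
    then have "(L2_norm lebesgue (B f))\<^sup>2 \<le> (L2_norm lebesgue f * sqrt h)\<^sup>2"
      by (intro power_mono) auto
    then have "(L2_norm lebesgue (B f))\<^sup>2 \<le> h * (L2_norm lebesgue f)\<^sup>2"
      using h0 by (simp add: power_mult_distrib mult.commute)
    then have "ennreal ((L2_norm lebesgue (B f))\<^sup>2) \<le> ennreal (h * (L2_norm lebesgue f)\<^sup>2)"
      by (rule ennreal_leI)
    then show ?thesis using h0 by (simp add: h ennreal_mult)
  qed
qed

section \<open>Plancherel's theorem on the line\<close>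

lemma cis_measurable [measurable]: "cis \<in> borel_measurable borel"
  by (intro borel_measurable_continuous_onI continuous_intros)

lemma integrable_translate:
  fixes f :: "real \<Rightarrow> complex"
  shows "integrable lborel f \<Longrightarrow> integrable lborel (\<lambda>x. f (x + u))"
  using lborel_integrable_real_affine[of f 1 u] by (simp add: add.commute)

lemma integral_translate:
  fixes f :: "real \<Rightarrow> 'b :: {banach, second_countable_topology}"
  shows "(LINT x|lborel. f (x + u)) = (LINT x|lborel. f x)"
  using lborel_integral_real_affine[of 1 f u] by (simp add: add.commute)

lemma integral_translate_diff_le:
  fixes f g :: "real \<Rightarrow> complex"
  assumes f: "integrable lborel f" and g: "integrable lborel g"
  shows "(LINT x|lborel. norm (f (x + u) - f x)) \<le>
    (LINT x|lborel. norm (g (x + u) - g x)) + 2 * (LINT x|lborel. norm (f x - g x))"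
proof -
  have fg: "integrable lborel (\<lambda>x. norm (f x - g x))"
    using f g by (intro integrable_norm Bochner_Integration.integrable_diff)
  have fgu: "integrable lborel (\<lambda>x. norm (f (x + u) - g (x + u)))"
    using f g by (intro integrable_norm Bochner_Integration.integrable_diff integrable_translate)
  have gu: "integrable lborel (\<lambda>x. norm (g (x + u) - g x))"
    using g by (intro integrable_norm Bochner_Integration.integrable_diff integrable_translate)
  have fu: "integrable lborel (\<lambda>x. norm (f (x + u) - f x))"
    using f by (intro integrable_norm Bochner_Integration.integrable_diff integrable_translate)
  have "(LINT x|lborel. norm (f (x + u) - f x)) \<le>
      (LINT x|lborel. norm (f (x + u) - g (x + u)) + norm (g (x + u) - g x) + norm (f x - g x))"
  proof (rule integral_mono)
    fix x
    have "f (x + u) - f x = (f (x + u) - g (x + u)) + (g (x + u) - g x) - (f x - g x)" by simp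
    then show "norm (f (x + u) - f x) \<le> norm (f (x + u) - g (x + u)) + norm (g (x + u) - g x) + norm (f x - g x)"
      using norm_triangle_ineq4[of "(f (x + u) - g (x + u)) + (g (x + u) - g x)" "f x - g x"]
        norm_triangle_ineq[of "f (x + u) - g (x + u)" "g (x + u) - g x"] by simp
  qed (use fu fgu gu fg in auto)
  also have "\<dots> = (LINT x|lborel. norm (f (x + u) - g (x + u))) + (LINT x|lborel. norm (g (x + u) - g x))
      + (LINT x|lborel. norm (f x - g x))"
    using fgu gu fg by simp
  also have "(LINT x|lborel. norm (f (x + u) - g (x + u))) = (LINT x|lborel. norm (f x - g x))"
    by (rule integral_translate[of "\<lambda>x. norm (f x - g x)"])
  finally show ?thesis by simp
qed

lemma integral_translate_diff_tendsto_open: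
  fixes U :: "real set" and c :: complex
  assumes U: "open U" "emeasure lborel U < \<infinity>" and u: "u \<longlonglongrightarrow> 0"
  shows "(\<lambda>n. LINT x|lborel. norm (indicator U (x + u n) *\<^sub>R c - indicator U x *\<^sub>R c)) \<longlonglongrightarrow> 0"
proof -
  have [measurable]: "U \<in> sets borel" using U by auto
  have i: "integrable lborel (indicator U :: real \<Rightarrow> real)" using U by (simp add: less_top[symmetric])
  have iu: "integrable lborel (\<lambda>x. indicator U (x + v) :: real)" for v
    using lborel_integrable_real_affine[OF i, of 1 v] by (simp add: add.commute)
  have iuu: "integrable lborel (\<lambda>x. indicator U (x + v) * indicator U x :: real)" for v
    by (rule Bochner_Integration.integrable_bound[OF i]) (auto simp: indicator_def)
  have eq: "(LINT x|lborel. norm (indicator U (x + v) *\<^sub>R c - indicator U x *\<^sub>R c)) =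
      norm c * (2 * (LINT x|lborel. indicator U x) - 2 * (LINT x|lborel. indicator U (x + v) * indicator U x))" for v
  proof -
    have "(LINT x|lborel. norm (indicator U (x + v) *\<^sub>R c - indicator U x *\<^sub>R c)) =
      (LINT x|lborel. norm c * (indicator U (x + v) + indicator U x - 2 * (indicator U (x + v) * indicator U x)))"
      by (intro Bochner_Integration.integral_cong) (auto simp: indicator_def)
    also have "\<dots> = norm c * ((LINT x|lborel. indicator U (x + v)) + (LINT x|lborel. indicator U x)
        - 2 * (LINT x|lborel. indicator U (x + v) * indicator U x))"
      using i iu iuu by simp
    also have "(LINT x|lborel. indicator U (x + v) :: real) = (LINT x|lborel. indicator U x)"
      by (rule integral_translate)
    finally show ?thesis by simp
  qed
  have "(\<lambda>n. LINT x|lborel. indicator U (x + u n) * indicator U x :: real) \<longlonglongrightarrow> (LINT x|lborel. indicator U x)"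
  proof (rule integral_dominated_convergence[OF _ _ i])
    show "AE x in lborel. (\<lambda>n. indicator U (x + u n) * indicator U x :: real) \<longlonglongrightarrow> indicator U x"
    proof (rule AE_I2)
      fix x :: real
      show "(\<lambda>n. indicator U (x + u n) * indicator U x :: real) \<longlonglongrightarrow> indicator U x"
      proof (cases "x \<in> U")
        case True
        have "(\<lambda>n. x + u n) \<longlonglongrightarrow> x + 0" by (intro tendsto_intros u)
        then have "\<forall>\<^sub>F n in sequentially. x + u n \<in> U" using topological_tendstoD U(1) True by fastforce
        then show ?thesis by (intro tendsto_eventually) (auto elim!: eventually_mono simp: True)
      qed simp
    qed
    show "AE x in lborel. norm (indicator U (x + u n) * indicator U x :: real) \<le> indicator U x" for n
      by (auto simp: indicator_def)
  qed measurable
  then have "(\<lambda>n. norm c * (2 * (LINT x|lborel. indicator U x) - 2 * (LINT x|lborel. indicator U (x + u n) * indicator U x)))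
     \<longlonglongrightarrow> norm c * (2 * (LINT x|lborel. indicator U x) - 2 * (LINT x|lborel. indicator U x))"
    by (intro tendsto_intros)
  then show ?thesis unfolding eq by simp
qed

text \<open>For an open set the shifted indicators converge pointwise; outer regularity passes to
  measurable sets and linearity to integrable functions.\<close>

lemma integral_translate_diff_tendsto:
  fixes f :: "real \<Rightarrow> complex"
  assumes "integrable lborel f" and u: "u \<longlonglongrightarrow> 0"
  shows "(\<lambda>n. LINT x|lborel. norm (f (x + u n) - f x)) \<longlonglongrightarrow> 0"
  using assms(1)
proof (induction rule: integrable_induct)
  case (base A c)
  have [measurable]: "A \<in> sets borel" using base by simp
  show ?case
  proof (rule LIMSEQ_I)
    fix e :: real assume e: "e > 0"
    \<comment> \<open>the factor \<open>4\<close> pays for two errors of size \<open>e / 4\<close>, the \<open>1\<close> covers \<open>c = 0\<close>\<close>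
    define e' where "e' = e / (4 * (norm c + 1))"
    have e': "e' > 0" using e by (simp add: e'_def add_nonneg_pos)
    obtain U where U: "open U" "A \<subseteq> U" "emeasure lborel (U - A) < ennreal e'"
      using outer_regular_lborel[of A e'] base e' by auto
    have [measurable]: "U \<in> sets borel" using U by auto
    have "emeasure lborel U = emeasure lborel A + emeasure lborel (U - A)"
      using U(2) by (subst plus_emeasure) (auto intro!: arg_cong[where f="emeasure lborel"])
    then have Ufin: "emeasure lborel U < \<infinity>"
      using base U(3) by (simp add: ennreal_add_less_top order_less_trans[OF _ ennreal_less_top])
    have int: "integrable lborel (\<lambda>x. indicator V x *\<^sub>R c)" if "V \<in> sets borel" "emeasure lborel V < \<infinity>" for V :: "real set"
      using that by simp
    have small: "(LINT x|lborel. norm (indicator A x *\<^sub>R c - indicator U x *\<^sub>R c)) \<le> e / 4"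
    proof -
      have "(LINT x|lborel. norm (indicator A x *\<^sub>R c - indicator U x *\<^sub>R c)) = (LINT x|lborel. norm c * indicator (U - A) x)"
        using U(2) by (intro Bochner_Integration.integral_cong) (auto simp: indicator_def)
      also have "\<dots> = norm c * measure lborel (U - A)" by simp
      also have "\<dots> \<le> (norm c + 1) * e'"
      proof (rule mult_mono)
        have "ennreal (measure lborel (U - A)) < ennreal e'"
          using U(3) by (subst emeasure_eq_ennreal_measure[symmetric]) auto
        then show "measure lborel (U - A) \<le> e'" using ennreal_less_iff by auto
      qed (use e' in auto)
      also have "\<dots> = e / 4" unfolding e'_def by (simp add: field_simps add_nonneg_eq_0_iff)
      finally show ?thesis .
    qed
    have "\<forall>\<^sub>F n in sequentially. (LINT x|lborel. norm (indicator U (x + u n) *\<^sub>R c - indicator U x *\<^sub>R c)) < e / 2"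
      using integral_translate_diff_tendsto_open[OF U(1) Ufin u, of c] e by (intro order_tendstoD) auto
    then have "\<forall>\<^sub>F n in sequentially. norm ((LINT x|lborel. norm (indicator A (x + u n) *\<^sub>R c - indicator A x *\<^sub>R c)) - 0) < e"
    proof eventually_elim
      case (elim n)
      have "(LINT x|lborel. norm (indicator A (x + u n) *\<^sub>R c - indicator A x *\<^sub>R c)) < e"
        using integral_translate_diff_le[OF int int, of A U "u n"] base Ufin elim small by simp
      then show ?case by (simp add: Bochner_Integration.integral_nonneg)
    qed
    then show "\<exists>no. \<forall>n\<ge>no. norm ((LINT x|lborel. norm (indicator A (x + u n) *\<^sub>R c - indicator A x *\<^sub>R c)) - 0) < e"
      by (simp add: eventually_sequentially)
  qed
next
  case (add f g)
  show ?case
  proof (rule tendsto_sandwich[OF _ _ tendsto_const])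
    show "(\<lambda>n. (LINT x|lborel. norm (f (x + u n) - f x)) + (LINT x|lborel. norm (g (x + u n) - g x))) \<longlonglongrightarrow> 0"
      using tendsto_add[OF add.IH] by simp
    have "(LINT x|lborel. norm (f (x + v) + g (x + v) - (f x + g x))) \<le>
        (LINT x|lborel. norm (f (x + v) - f x)) + (LINT x|lborel. norm (g (x + v) - g x))" for v
    proof -
      have i: "integrable lborel (\<lambda>x. norm (f (x + v) - f x))" "integrable lborel (\<lambda>x. norm (g (x + v) - g x))"
        using add by (auto intro!: integrable_translate)
      have "(LINT x|lborel. norm (f (x + v) + g (x + v) - (f x + g x))) \<le>
          (LINT x|lborel. norm (f (x + v) - f x) + norm (g (x + v) - g x))"
      proof (rule integral_mono)
        show "norm (f (x + v) + g (x + v) - (f x + g x)) \<le> norm (f (x + v) - f x) + norm (g (x + v) - g x)" for x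
          by (rule norm_diff_triangle_ineq)
        show "integrable lborel (\<lambda>x. norm (f (x + v) + g (x + v) - (f x + g x)))"
        proof -
          have fg: "integrable lborel (\<lambda>x. f x + g x)" using add.hyps by simp
          show ?thesis
            by (rule integrable_norm, rule Bochner_Integration.integrable_diff,
                rule integrable_translate[OF fg], rule fg)
        qed
      qed (use i in auto)
      also have "\<dots> = (LINT x|lborel. norm (f (x + v) - f x)) + (LINT x|lborel. norm (g (x + v) - g x))"
        using i by simp
      finally show ?thesis .
    qed
    then show "\<forall>\<^sub>F n in sequentially. (LINT x|lborel. norm (f (x + u n) + g (x + u n) - (f x + g x))) \<le>
        (LINT x|lborel. norm (f (x + u n) - f x)) + (LINT x|lborel. norm (g (x + u n) - g x))" by simp
    show "\<forall>\<^sub>F n in sequentially. 0 \<le> (LINT x|lborel. norm (f (x + u n) + g (x + u n) - (f x + g x)))" by simp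
  qed
next
  case (lim f s)
  have "(\<lambda>i. LINT x|lborel. norm (f x - s i x)) \<longlonglongrightarrow> (LINT x|(lborel::real measure). 0)"
  proof (rule integral_dominated_convergence)
    show "integrable lborel (\<lambda>x. 3 * norm (f x))" using lim by simp
    show "AE x in lborel. (\<lambda>i. norm (f x - s i x)) \<longlonglongrightarrow> 0"
      using lim by (intro AE_I2) (auto intro!: tendsto_eq_intros)
    show "AE x in lborel. norm (norm (f x - s i x)) \<le> 3 * norm (f x)" for i
    proof (rule AE_I2)
      fix x show "norm (norm (f x - s i x)) \<le> 3 * norm (f x)"
        using lim.hyps(3)[of x i] norm_triangle_ineq4[of "f x" "s i x"] by simp
    qed
  qed (use lim in auto)
  then have app: "(\<lambda>i. LINT x|lborel. norm (f x - s i x)) \<longlonglongrightarrow> 0" by simp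
  show ?case
  proof (rule LIMSEQ_I)
    fix e :: real assume e: "e > 0"
    have "\<forall>\<^sub>F i in sequentially. (LINT x|lborel. norm (f x - s i x)) < e / 4"
      using app e by (intro order_tendstoD) auto
    then obtain i where i: "(LINT x|lborel. norm (f x - s i x)) < e / 4" by (auto simp: eventually_sequentially)
    have "\<forall>\<^sub>F n in sequentially. (LINT x|lborel. norm (s i (x + u n) - s i x)) < e / 2"
      using lim.IH[of i] e by (intro order_tendstoD) auto
    then have "\<forall>\<^sub>F n in sequentially. norm ((LINT x|lborel. norm (f (x + u n) - f x)) - 0) < e"
    proof eventually_elim
      case (elim n)
      have "(LINT x|lborel. norm (f (x + u n) - f x)) < e"
        using integral_translate_diff_le[OF lim.hyps(4) lim.hyps(1)[of i], of "u n"] elim i by simp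
      then show ?case by simp
    qed
    then show "\<exists>no. \<forall>n\<ge>no. norm ((LINT x|lborel. norm (f (x + u n) - f x)) - 0) < e"
      by (simp add: eventually_sequentially)
  qed
qed

definition ft :: "(real \<Rightarrow> complex) \<Rightarrow> real \<Rightarrow> complex" where
  "ft s \<xi> = (LINT x|lborel. cis (2 * pi * \<xi> * x) * s x)"

lemma ft_integrand_integrable:
  assumes s: "integrable lborel s"
  shows "integrable lborel (\<lambda>x. cis (a * x) * s x)"
proof (rule Bochner_Integration.integrable_bound[OF s])
  have [measurable]: "s \<in> borel_measurable borel" using s by auto
  show "(\<lambda>x. cis (a * x) * s x) \<in> borel_measurable lborel" by measurable
qed (auto simp: norm_mult)

lemma ft_measurable [measurable]:
  assumes [measurable]: "s \<in> borel_measurable borel"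
  shows "ft s \<in> borel_measurable borel"
  unfolding ft_def[abs_def] by measurable

lemma ft_diff:
  assumes "integrable lborel s" "integrable lborel s'"
  shows "ft (\<lambda>x. s x - s' x) \<xi> = ft s \<xi> - ft s' \<xi>"
  unfolding ft_def using assms by (simp add: right_diff_distrib ft_integrand_integrable)

lemma norm_ft_le:
  assumes "integrable lborel s"
  shows "norm (ft s \<xi>) \<le> (LINT x|lborel. norm (s x))"
  unfolding ft_def using integral_norm_bound[of lborel "\<lambda>x. cis (2 * pi * \<xi> * x) * s x"]
  by (simp add: norm_mult)

text \<open>Its Fourier transform is \<open>\<bar>ft s\<bar>\<^sup>2\<close> and its value at \<open>0\<close> is the energy of \<open>s\<close>. Plancherel's theorem is therefore Fourier
inversion at the single point \<open>0\<close>, where the autocorrelation is continuous.\<close>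

definition autocorrelation :: "(real \<Rightarrow> complex) \<Rightarrow> real \<Rightarrow> complex" where
  "autocorrelation s u = (LINT x|lborel. s (x + u) * cnj (s x))"

lemma autocorrelation_measurable [measurable]:
  assumes [measurable]: "s \<in> borel_measurable borel"
  shows "autocorrelation s \<in> borel_measurable borel"
  unfolding autocorrelation_def[abs_def] by measurable

lemma autocorrelation_integrable_pair:
  fixes s :: "real \<Rightarrow> complex"
  assumes s: "integrable lborel s"
  shows "integrable (lborel \<Otimes>\<^sub>M lborel) (\<lambda>(u, x). s (x + u) * cnj (s x))"
proof (rule integrableI_bounded)
  have [measurable]: "s \<in> borel_measurable borel" using s by auto
  show "(\<lambda>(u, x). s (x + u) * cnj (s x)) \<in> borel_measurable (lborel \<Otimes>\<^sub>M lborel)" by measurable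
  have "(\<integral>\<^sup>+ p. ennreal (norm (case p of (u, x) \<Rightarrow> s (x + u) * cnj (s x))) \<partial>(lborel \<Otimes>\<^sub>M lborel)) =
      (\<integral>\<^sup>+ x. \<integral>\<^sup>+ u. ennreal (norm (s x)) * ennreal (norm (s (x + u))) \<partial>lborel \<partial>lborel)"
    by (subst lborel_pair.nn_integral_snd[symmetric]) (auto simp: norm_mult ennreal_mult mult.commute)
  also have "\<dots> = (\<integral>\<^sup>+ x. ennreal (norm (s x)) * (\<integral>\<^sup>+ u. ennreal (norm (s u)) \<partial>lborel) \<partial>lborel)"
    using nn_integral_real_affine[of "\<lambda>u. ennreal (norm (s u))" 1]
    by (intro nn_integral_cong) (simp add: nn_integral_cmult)
  also have "\<dots> = (\<integral>\<^sup>+ u. ennreal (norm (s u)) \<partial>lborel) * (\<integral>\<^sup>+ u. ennreal (norm (s u)) \<partial>lborel)"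
    by (simp add: nn_integral_multc)
  also have "\<dots> < \<infinity>" using s by (auto simp: integrable_iff_bounded ennreal_mult_less_top)
  finally show "(\<integral>\<^sup>+ p. ennreal (norm (case p of (u, x) \<Rightarrow> s (x + u) * cnj (s x))) \<partial>(lborel \<Otimes>\<^sub>M lborel)) < \<infinity>" .
qed

lemma autocorrelation_integrable:
  assumes s: "integrable lborel s"
  shows "integrable lborel (autocorrelation s)"
  using lborel_pair.integrable_fst[OF autocorrelation_integrable_pair[OF s]]
  by (simp add: autocorrelation_def[abs_def])

lemma ft_autocorrelation:
  assumes s: "integrable lborel s"
  shows "ft (autocorrelation s) \<xi> = complex_of_real ((norm (ft s \<xi>))\<^sup>2)"
proof -
  have [measurable]: "s \<in> borel_measurable borel" using s by auto
  let ?F = "\<lambda>u x. cis (2 * pi * \<xi> * u) * (s (x + u) * cnj (s x))"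
  have int: "integrable (lborel \<Otimes>\<^sub>M lborel) (\<lambda>(u, x). ?F u x)"
    by (rule Bochner_Integration.integrable_bound[OF autocorrelation_integrable_pair[OF s]])
       (auto simp: norm_mult)
  have "ft (autocorrelation s) \<xi> = (LINT u|lborel. LINT x|lborel. ?F u x)"
    unfolding ft_def autocorrelation_def by simp
  also have "\<dots> = (LINT x|lborel. LINT u|lborel. ?F u x)"
    by (rule lborel_pair.Fubini_integral[OF int, symmetric])
  also have "\<dots> = (LINT x|lborel. cnj (cis (2 * pi * \<xi> * x) * s x) * ft s \<xi>)"
  proof (rule Bochner_Integration.integral_cong[OF refl])
    fix x
    have "(LINT u|lborel. ?F u x) = (LINT u|lborel. cnj (cis (2 * pi * \<xi> * x) * s x) * (cis (2 * pi * \<xi> * (u + x)) * s (u + x)))"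
    proof (intro Bochner_Integration.integral_cong refl)
      fix u
      have "cis (2 * pi * \<xi> * u) = cnj (cis (2 * pi * \<xi> * x)) * cis (2 * pi * \<xi> * (u + x))"
        by (simp add: cis_cnj cis_mult algebra_simps)
      then show "?F u x = cnj (cis (2 * pi * \<xi> * x) * s x) * (cis (2 * pi * \<xi> * (u + x)) * s (u + x))"
        by (simp add: add.commute)
    qed
    also have "\<dots> = cnj (cis (2 * pi * \<xi> * x) * s x) * (LINT u|lborel. cis (2 * pi * \<xi> * (u + x)) * s (u + x))"
      by simp
    also have "(LINT u|lborel. cis (2 * pi * \<xi> * (u + x)) * s (u + x)) = ft s \<xi>"
      unfolding ft_def by (rule integral_translate[of "\<lambda>u. cis (2 * pi * \<xi> * u) * s u"])
    finally show "(LINT u|lborel. ?F u x) = cnj (cis (2 * pi * \<xi> * x) * s x) * ft s \<xi>" .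
  qed
  also have "\<dots> = (LINT x|lborel. cnj (cis (2 * pi * \<xi> * x) * s x)) * ft s \<xi>" by simp
  also have "(LINT x|lborel. cnj (cis (2 * pi * \<xi> * x) * s x)) = cnj (ft s \<xi>)"
    unfolding ft_def by (rule Bochner_Integration.integral_cnj)
  finally show ?thesis by (simp add: complex_norm_square mult.commute del: of_real_power)
qed

lemma norm_autocorrelation_le:
  assumes s: "integrable lborel s" and M: "\<And>x. norm (s x) \<le> M"
  shows "norm (autocorrelation s u) \<le> M * (LINT x|lborel. norm (s x))"
proof -
  have [measurable]: "s \<in> borel_measurable borel" using s by auto
  have M0: "0 \<le> M" using M[of 0] norm_ge_zero order_trans by blast
  have "norm (autocorrelation s u) \<le> (LINT x|lborel. norm (s (x + u) * cnj (s x)))"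
    unfolding autocorrelation_def by (rule integral_norm_bound)
  also have "\<dots> \<le> (LINT x|lborel. M * norm (s x))"
  proof (rule integral_mono)
    show b: "norm (s (x + u) * cnj (s x)) \<le> M * norm (s x)" for x
      by (simp add: norm_mult mult_right_mono M)
    show "integrable lborel (\<lambda>x. M * norm (s x))" using s by simp
    then show "integrable lborel (\<lambda>x. norm (s (x + u) * cnj (s x)))"
      by (rule Bochner_Integration.integrable_bound) (use b M0 in \<open>auto simp: abs_mult\<close>)
  qed
  finally show ?thesis by simp
qed

lemma autocorrelation_tendsto:
  assumes s: "integrable lborel s" and M: "\<And>x. norm (s x) \<le> M" and u: "u \<longlonglongrightarrow> 0"
  shows "(\<lambda>n. autocorrelation s (u n)) \<longlonglongrightarrow> autocorrelation s 0"
proof (rule LIM_zero_cancel, rule Lim_null_comparison)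
  have [measurable]: "s \<in> borel_measurable borel" using s by auto
  have M0: "0 \<le> M" using M[of 0] norm_ge_zero order_trans by blast
  have i: "integrable lborel (\<lambda>x. s (x + v) * cnj (s x))" for v
  proof (rule Bochner_Integration.integrable_bound)
    show "integrable lborel (\<lambda>x. M * norm (s x))" using s by simp
    show "AE x in lborel. norm (s (x + v) * cnj (s x)) \<le> norm (M * norm (s x))"
      using M M0 by (intro AE_I2) (simp add: norm_mult mult_right_mono)
  qed measurable
  show "(\<lambda>n. M * (LINT x|lborel. norm (s (x + u n) - s x))) \<longlonglongrightarrow> 0"
    using tendsto_mult_right_zero[OF integral_translate_diff_tendsto[OF s u]] by simp
  have "norm (autocorrelation s v - autocorrelation s 0) \<le> M * (LINT x|lborel. norm (s (x + v) - s x))" for v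
  proof -
    have "autocorrelation s v - autocorrelation s 0 = (LINT x|lborel. (s (x + v) - s x) * cnj (s x))"
      unfolding autocorrelation_def using i[of v] i[of 0] by (simp add: left_diff_distrib)
    then have "norm (autocorrelation s v - autocorrelation s 0) \<le> (LINT x|lborel. norm ((s (x + v) - s x) * cnj (s x)))"
      by (simp only: integral_norm_bound)
    also have "\<dots> \<le> (LINT x|lborel. M * norm (s (x + v) - s x))"
    proof (rule integral_mono)
      show b: "norm ((s (x + v) - s x) * cnj (s x)) \<le> M * norm (s (x + v) - s x)" for x
        using mult_right_mono[OF M, of "norm (s (x + v) - s x)" x] by (simp add: norm_mult mult.commute)
      show "integrable lborel (\<lambda>x. M * norm (s (x + v) - s x))"
        using s by (auto intro!: integrable_translate)
      then show "integrable lborel (\<lambda>x. norm ((s (x + v) - s x) * cnj (s x)))"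
        by (rule Bochner_Integration.integrable_bound) (use b M0 in \<open>auto simp: abs_mult\<close>)
    qed
    finally show ?thesis by simp
  qed
  then show "\<forall>\<^sub>F n in sequentially. norm (autocorrelation s (u n) - autocorrelation s 0)
      \<le> M * (LINT x|lborel. norm (s (x + u n) - s x))" by simp
qed

text \<open>By Fubini's theorem the integral of \<open>ft (autocorrelation s)\<close> against a Gaussian is the integral of the autocorrelation
against the Fourier transform of that Gaussian, which is again a Gaussian: this is the characteristic function of the
standard normal distribution. The right-hand side averages the autocorrelation over a neighbourhood of \<open>0\<close> that
shrinks with \<open>e\<close>.\<close>

lemma gaussian_regularisation:
  assumes s: "integrable lborel s" and M: "\<And>x. norm (s x) \<le> M" and e: "e > 0"
  shows "(LINT \<xi>|lborel. (norm (ft s \<xi>))\<^sup>2 * exp (- (e * \<xi>)\<^sup>2 / 2)) =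
    Re (LINT v|lborel. std_normal_density v *\<^sub>R autocorrelation s (e / (2 * pi) * v))"
proof -
  have [measurable]: "s \<in> borel_measurable borel" using s by auto
  let ?h = "autocorrelation s"
  let ?\<phi> = std_normal_density
  have phi: "integrable lborel ?\<phi>" by simp
  have hint: "integrable lborel ?h" by (rule autocorrelation_integrable[OF s])
  have int: "integrable (lborel \<Otimes>\<^sub>M lborel) (\<lambda>(z, u). ?\<phi> z *\<^sub>R (cis (2 * pi * (z / e) * u) * ?h u))"
  proof (rule integrableI_bounded)
    have "(\<integral>\<^sup>+ p. ennreal (norm (case p of (z, u) \<Rightarrow> ?\<phi> z *\<^sub>R (cis (2 * pi * (z / e) * u) * ?h u))) \<partial>(lborel \<Otimes>\<^sub>M lborel)) =
      (\<integral>\<^sup>+ z. \<integral>\<^sup>+ u. ennreal (?\<phi> z) * ennreal (norm (?h u)) \<partial>lborel \<partial>lborel)"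
      by (subst lborel.nn_integral_fst[symmetric]) (auto simp: norm_mult ennreal_mult)
    also have "\<dots> = (\<integral>\<^sup>+ z. ennreal (?\<phi> z) \<partial>lborel) * (\<integral>\<^sup>+ u. ennreal (norm (?h u)) \<partial>lborel)"
      by (simp add: nn_integral_cmult nn_integral_multc)
    also have "\<dots> < \<infinity>" using hint phi by (auto simp: integrable_iff_bounded ennreal_mult_less_top)
    finally show "(\<integral>\<^sup>+ p. ennreal (norm (case p of (z, u) \<Rightarrow> ?\<phi> z *\<^sub>R (cis (2 * pi * (z / e) * u) * ?h u))) \<partial>(lborel \<Otimes>\<^sub>M lborel)) < \<infinity>" .
  qed measurable
  have char: "(LINT z|lborel. ?\<phi> z *\<^sub>R cis (2 * pi * (z / e) * u)) = complex_of_real (exp (- (2 * pi * u / e)\<^sup>2 / 2))" for u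
  proof -
    have "(LINT z|lborel. ?\<phi> z *\<^sub>R cis (2 * pi * (z / e) * u)) = (LINT z|lborel. ?\<phi> z *\<^sub>R iexp ((2 * pi * u / e) * z))"
      by (intro Bochner_Integration.integral_cong) (auto simp: cis_conv_exp field_simps)
    also have "\<dots> = char std_normal_distribution (2 * pi * u / e)"
      unfolding char_def by (subst integral_density) auto
    finally show ?thesis by (simp add: char_std_normal_distribution)
  qed
  have s2: "sqrt (2 * pi) * ?\<phi> v = exp (- v\<^sup>2 / 2)" for v by (simp add: std_normal_density_def)
  define I where "I = (LINT \<xi>|lborel. (norm (ft s \<xi>))\<^sup>2 * exp (- (e * \<xi>)\<^sup>2 / 2))"
  have "complex_of_real (e * I) = complex_of_real (sqrt (2 * pi)) *
     (LINT z|lborel. ?\<phi> z *\<^sub>R complex_of_real ((norm (ft s (z / e)))\<^sup>2))"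
  proof -
    have "I = \<bar>1/e\<bar> *\<^sub>R (LINT z|lborel. (norm (ft s (0 + (1/e) * z)))\<^sup>2 * exp (- (e * (0 + (1/e) * z))\<^sup>2 / 2))"
      unfolding I_def using e by (intro lborel_integral_real_affine) auto
    also have "\<dots> = (1/e) * (LINT z|lborel. sqrt (2 * pi) * (?\<phi> z * (norm (ft s (z / e)))\<^sup>2))"
      using e by (simp add: std_normal_density_def mult.commute)
    finally have "e * I = sqrt (2 * pi) * (LINT z|lborel. ?\<phi> z * (norm (ft s (z / e)))\<^sup>2)"
      using e by simp
    then have "complex_of_real (e * I) = complex_of_real (sqrt (2 * pi)) * complex_of_real (LINT z|lborel. ?\<phi> z * (norm (ft s (z / e)))\<^sup>2)"
      by (simp only: of_real_mult)
    also have "complex_of_real (LINT z|lborel. ?\<phi> z * (norm (ft s (z / e)))\<^sup>2) =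
        (LINT z|lborel. complex_of_real (?\<phi> z * (norm (ft s (z / e)))\<^sup>2))"
      by (rule integral_complex_of_real[symmetric])
    finally show ?thesis by (simp add: scaleR_conv_of_real)
  qed
  also have "(LINT z|lborel. ?\<phi> z *\<^sub>R complex_of_real ((norm (ft s (z / e)))\<^sup>2)) =
      (LINT z|lborel. LINT u|lborel. ?\<phi> z *\<^sub>R (cis (2 * pi * (z / e) * u) * ?h u))"
  proof (intro Bochner_Integration.integral_cong refl)
    fix z
    show "?\<phi> z *\<^sub>R complex_of_real ((norm (ft s (z / e)))\<^sup>2) =
        (LINT u|lborel. ?\<phi> z *\<^sub>R (cis (2 * pi * (z / e) * u) * ?h u))"
      unfolding ft_autocorrelation[OF s, symmetric] by (simp add: ft_def)
  qed
  also have "\<dots> = (LINT u|lborel. LINT z|lborel. ?\<phi> z *\<^sub>R (cis (2 * pi * (z / e) * u) * ?h u))"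
    by (rule lborel_pair.Fubini_integral[OF int, symmetric])
  also have "\<dots> = (LINT u|lborel. exp (- (2 * pi * u / e)\<^sup>2 / 2) *\<^sub>R ?h u)"
  proof (intro Bochner_Integration.integral_cong refl)
    fix u
    have "(LINT z|lborel. ?\<phi> z *\<^sub>R (cis (2 * pi * (z / e) * u) * ?h u)) = (LINT z|lborel. ?\<phi> z *\<^sub>R cis (2 * pi * (z / e) * u)) * ?h u"
      by (subst Bochner_Integration.integral_mult_left_zero[symmetric]) (simp add: mult.assoc)
    with char[of u] show "(LINT z|lborel. ?\<phi> z *\<^sub>R (cis (2 * pi * (z / e) * u) * ?h u)) = exp (- (2 * pi * u / e)\<^sup>2 / 2) *\<^sub>R ?h u"
      by (simp only: scaleR_conv_of_real)
  qed
  also have "\<dots> = (e / (2 * pi)) *\<^sub>R (LINT v|lborel. exp (- v\<^sup>2 / 2) *\<^sub>R ?h (e / (2 * pi) * v))"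
    using e by (subst lborel_integral_real_affine[of "e / (2 * pi)" _ 0]) auto
  also have "\<dots> = (e / (2 * pi)) *\<^sub>R (LINT v|lborel. sqrt (2 * pi) *\<^sub>R (?\<phi> v *\<^sub>R ?h (e / (2 * pi) * v)))"
    by (simp add: std_normal_density_def)
  also have "\<dots> = complex_of_real e / complex_of_real (2 * pi) * (complex_of_real (sqrt (2 * pi)) * (LINT v|lborel. ?\<phi> v *\<^sub>R ?h (e / (2 * pi) * v)))"
    by (simp add: scaleR_conv_of_real)
  also have "complex_of_real (sqrt (2 * pi)) * \<dots> = complex_of_real e * (LINT v|lborel. ?\<phi> v *\<^sub>R ?h (e / (2 * pi) * v))"
  proof -
    have K: "complex_of_real (sqrt (2 * pi)) * complex_of_real (sqrt (2 * pi)) = complex_of_real (2 * pi)"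
      by (simp only: of_real_mult[symmetric]) simp
    have cancel: "k * (d / p * (k * X)) = d * X" if "k * k = p" "p \<noteq> 0" for k d p X :: complex
    proof -
      have "k * (d / p * (k * X)) = (k * k) / p * d * X" by (simp add: field_simps)
      with that show ?thesis by simp
    qed
    show ?thesis by (rule cancel[OF K]) simp
  qed
  finally have "complex_of_real I = (LINT v|lborel. ?\<phi> v *\<^sub>R ?h (e / (2 * pi) * v))" using e by simp
  then have "Re (complex_of_real I) = Re (LINT v|lborel. ?\<phi> v *\<^sub>R ?h (e / (2 * pi) * v))" by (rule arg_cong)
  then show ?thesis by (simp only: Re_complex_of_real I_def)
qed

text \<open>As \<open>e\<close> tends to \<open>0\<close>, the left-hand side of the regularised identity increases to the energy of \<open>ft s\<close>, and the right-hand
side tends to the autocorrelation at \<open>0\<close>. Boundedness of \<open>s\<close> makes the \<open>L\<^sup>1\<close> continuity of translations suffice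
here.\<close>

lemma Plancherel_bounded:
  assumes s: "integrable lborel s" and M: "\<And>x. norm (s x) \<le> M"
  shows "energy lborel (ft s) = energy lborel s"
proof -
  have [measurable]: "s \<in> borel_measurable borel" using s by auto
  let ?h = "autocorrelation s"
  let ?\<phi> = std_normal_density
  define e where "e n = inverse (real (Suc n))" for n
  have e: "e n > 0" for n by (simp add: e_def)
  have e0: "e \<longlonglongrightarrow> 0" unfolding e_def[abs_def] by (rule LIMSEQ_inverse_real_of_nat)
  have "(\<lambda>n. LINT v|lborel. ?\<phi> v *\<^sub>R ?h (e n / (2 * pi) * v)) \<longlonglongrightarrow> (LINT v|lborel. ?\<phi> v *\<^sub>R ?h 0)"
  proof (rule integral_dominated_convergence)
    show "integrable lborel (\<lambda>v. ?\<phi> v * (M * (LINT x|lborel. norm (s x))))" by simp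
    show "AE v in lborel. (\<lambda>n. ?\<phi> v *\<^sub>R ?h (e n / (2 * pi) * v)) \<longlonglongrightarrow> ?\<phi> v *\<^sub>R ?h 0"
    proof (rule AE_I2)
      fix v
      have "(\<lambda>n. e n / (2 * pi) * v) \<longlonglongrightarrow> 0 / (2 * pi) * v" by (intro tendsto_intros e0) simp
      then show "(\<lambda>n. ?\<phi> v *\<^sub>R ?h (e n / (2 * pi) * v)) \<longlonglongrightarrow> ?\<phi> v *\<^sub>R ?h 0"
        by (intro tendsto_intros autocorrelation_tendsto[OF s M]) simp
    qed
    show "AE v in lborel. norm (?\<phi> v *\<^sub>R ?h (e n / (2 * pi) * v)) \<le> ?\<phi> v * (M * (LINT x|lborel. norm (s x)))" for n
      by (intro AE_I2) (simp add: mult_left_mono norm_autocorrelation_le[OF s M])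
  qed measurable
  also have "(LINT v|lborel. ?\<phi> v *\<^sub>R ?h 0) = ?h 0"
    by (subst integral_scaleR_left) (simp_all add: integral_normal_density)
  finally have lim: "(\<lambda>n. Re (LINT v|lborel. ?\<phi> v *\<^sub>R ?h (e n / (2 * pi) * v))) \<longlonglongrightarrow> Re (?h 0)"
    by (rule tendsto_Re)
  have hz: "ennreal (Re (?h 0)) = energy lborel s"
  proof -
    have i: "integrable lborel (\<lambda>x. (norm (s x))\<^sup>2)"
    proof (rule Bochner_Integration.integrable_bound)
      show "integrable lborel (\<lambda>x. M * norm (s x))" using s by simp
      have M0: "0 \<le> M" using M[of 0] norm_ge_zero order_trans by blast
      show "AE x in lborel. norm ((norm (s x))\<^sup>2) \<le> norm (M * norm (s x))"
        using M M0 by (intro AE_I2) (simp add: power2_eq_square mult_right_mono)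
    qed measurable
    have "?h 0 = (LINT x|lborel. complex_of_real ((norm (s x))\<^sup>2))"
      unfolding autocorrelation_def by (simp add: complex_norm_square del: of_real_power)
    also have "\<dots> = complex_of_real (LINT x|lborel. (norm (s x))\<^sup>2)" by (rule integral_complex_of_real)
    finally have "Re (?h 0) = (LINT x|lborel. (norm (s x))\<^sup>2)" by simp
    then show ?thesis using i by (simp add: nn_integral_eq_integral)
  qed
  have "(\<lambda>n. \<integral>\<^sup>+\<xi>. ennreal ((norm (ft s \<xi>))\<^sup>2 * exp (- (e n * \<xi>)\<^sup>2 / 2)) \<partial>lborel)
      \<longlonglongrightarrow> energy lborel (ft s)"
  proof (rule nn_integral_LIMSEQ)
    show "incseq (\<lambda>n \<xi>. ennreal ((norm (ft s \<xi>))\<^sup>2 * exp (- (e n * \<xi>)\<^sup>2 / 2)))"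
    proof (rule incseq_SucI, rule le_funI, rule ennreal_leI, rule mult_left_mono)
      fix n \<xi>
      have "e (Suc n) \<le> e n" by (simp add: e_def field_simps)
      then have "(e (Suc n) * \<xi>)\<^sup>2 \<le> (e n * \<xi>)\<^sup>2"
        using e[of "Suc n"] by (simp add: power_mult_distrib mult_right_mono power_mono)
      then show "exp (- (e n * \<xi>)\<^sup>2 / 2) \<le> exp (- (e (Suc n) * \<xi>)\<^sup>2 / 2)" by simp
    qed simp
    fix \<xi>
    have "(\<lambda>n. (norm (ft s \<xi>))\<^sup>2 * exp (- (e n * \<xi>)\<^sup>2 / 2)) \<longlonglongrightarrow> (norm (ft s \<xi>))\<^sup>2 * exp (- (0 * \<xi>)\<^sup>2 / 2)"
      by (intro tendsto_intros e0) simp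
    then show "(\<lambda>n. ennreal ((norm (ft s \<xi>))\<^sup>2 * exp (- (e n * \<xi>)\<^sup>2 / 2))) \<longlonglongrightarrow> ennreal ((norm (ft s \<xi>))\<^sup>2)"
      by (intro tendsto_ennrealI) simp
  qed measurable
  moreover have "(\<integral>\<^sup>+\<xi>. ennreal ((norm (ft s \<xi>))\<^sup>2 * exp (- (e n * \<xi>)\<^sup>2 / 2)) \<partial>lborel) =
      ennreal (Re (LINT v|lborel. ?\<phi> v *\<^sub>R ?h (e n / (2 * pi) * v)))" for n
  proof -
    have g: "integrable lborel (\<lambda>\<xi>. exp (- (e n * \<xi>)\<^sup>2 / 2))"
    proof -
      have "integrable lborel (\<lambda>\<xi>. sqrt (2 * pi) * ?\<phi> (0 + e n * \<xi>))"
        using e[of n] by (intro integrable_mult_right lborel_integrable_real_affine) auto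
      then show ?thesis by (simp add: std_normal_density_def)
    qed
    have "integrable lborel (\<lambda>\<xi>. (norm (ft s \<xi>))\<^sup>2 * exp (- (e n * \<xi>)\<^sup>2 / 2))"
    proof (rule Bochner_Integration.integrable_bound)
      show "integrable lborel (\<lambda>\<xi>. (LINT x|lborel. norm (s x))\<^sup>2 * exp (- (e n * \<xi>)\<^sup>2 / 2))" using g by simp
      show "AE \<xi> in lborel. norm ((norm (ft s \<xi>))\<^sup>2 * exp (- (e n * \<xi>)\<^sup>2 / 2)) \<le>
          norm ((LINT x|lborel. norm (s x))\<^sup>2 * exp (- (e n * \<xi>)\<^sup>2 / 2))"
        using norm_ft_le[OF s] by (intro AE_I2) (simp add: abs_mult mult_right_mono power_mono)
    qed measurable
    then have "(\<integral>\<^sup>+\<xi>. ennreal ((norm (ft s \<xi>))\<^sup>2 * exp (- (e n * \<xi>)\<^sup>2 / 2)) \<partial>lborel) =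
        ennreal (LINT \<xi>|lborel. (norm (ft s \<xi>))\<^sup>2 * exp (- (e n * \<xi>)\<^sup>2 / 2))"
      by (rule nn_integral_eq_integral) simp
    also have "(LINT \<xi>|lborel. (norm (ft s \<xi>))\<^sup>2 * exp (- (e n * \<xi>)\<^sup>2 / 2)) =
        Re (LINT v|lborel. ?\<phi> v *\<^sub>R ?h (e n / (2 * pi) * v))"
      by (rule gaussian_regularisation[OF s M e])
    finally show ?thesis .
  qed
  ultimately have "(\<lambda>n. ennreal (Re (LINT v|lborel. ?\<phi> v *\<^sub>R ?h (e n / (2 * pi) * v))))
      \<longlonglongrightarrow> energy lborel (ft s)" by simp
  moreover have "(\<lambda>n. ennreal (Re (LINT v|lborel. ?\<phi> v *\<^sub>R ?h (e n / (2 * pi) * v)))) \<longlonglongrightarrow> ennreal (Re (?h 0))"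
    by (rule tendsto_ennrealI[OF lim])
  ultimately have "energy lborel (ft s) = ennreal (Re (?h 0))"
    by (rule LIMSEQ_unique)
  then show ?thesis using hz by simp
qed

text \<open>Truncations \<open>t n\<close> of \<open>s\<close> are bounded, and \<open>ft (t n)\<close> tends to \<open>ft s\<close> pointwise by convergence in \<open>L\<^sup>1\<close>. Fatou's lemma
bounds the energy of \<open>ft (t n) - ft s\<close> by that of \<open>t n - s\<close>, so both norms converge to their limits.\<close>

theorem Plancherel_real:
  assumes s: "integrable lborel s" and sL: "s \<in> L2 lborel"
  shows "energy lborel (ft s) = energy lborel s"
proof -
  have [measurable]: "s \<in> borel_measurable borel" using s by auto
  define t where "t n x = (if norm (s x) \<le> real n then s x else 0)" for n :: nat and x
  have [measurable]: "t n \<in> borel_measurable borel" for n unfolding t_def[abs_def] by measurable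
  have tle: "norm (t n x) \<le> norm (s x)" for n x by (simp add: t_def)
  have tint: "integrable lborel (t n)" for n
    by (rule Bochner_Integration.integrable_bound[OF s]) (auto simp: tle)
  have teq: "\<forall>\<^sub>F n in sequentially. t n x = s x" for x
  proof -
    obtain N :: nat where "norm (s x) \<le> real N" using real_arch_simple by blast
    then show ?thesis unfolding t_def by (intro eventually_sequentiallyI[of N]) auto
  qed
  have planch: "energy lborel (ft (t n)) = energy lborel (t n)" for n
    by (rule Plancherel_bounded[OF tint, of _ "real n"]) (simp add: t_def)
  have tL: "t n \<in> L2 lborel" for n
  proof -
    have "energy lborel (t n) \<le> energy lborel s"
      by (intro nn_integral_mono ennreal_leI power_mono tle) simp
    also have "\<dots> < \<infinity>" using sL by (simp add: L2_iff_nn)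
    finally show ?thesis by (simp add: L2_iff_nn)
  qed
  have ftL: "ft (t n) \<in> L2 lborel" for n using tL planch by (simp add: L2_iff_nn)
  have ft_lim: "(\<lambda>m. ft (t m) \<xi>) \<longlonglongrightarrow> ft s \<xi>" for \<xi>
    unfolding ft_def
  proof (rule integral_dominated_convergence[where w="\<lambda>x. norm (s x)"])
    show "AE x in lborel. (\<lambda>i. cis (2 * pi * \<xi> * x) * t i x) \<longlonglongrightarrow> cis (2 * pi * \<xi> * x) * s x"
    proof (intro AE_I2 tendsto_intros)
      show "(\<lambda>i. t i x) \<longlonglongrightarrow> s x" for x using teq by (rule tendsto_eventually)
    qed
  qed (use s tle in \<open>auto simp: norm_mult\<close>)
  have bound: "energy lborel (\<lambda>\<xi>. ft (t n) \<xi> - ft s \<xi>) \<le> energy lborel (\<lambda>x. t n x - s x)" for n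
  proof -
    have "energy lborel (\<lambda>\<xi>. ft (t n) \<xi> - ft s \<xi>) =
        (\<integral>\<^sup>+\<xi>. liminf (\<lambda>m. ennreal ((norm (ft (t n) \<xi> - ft (t m) \<xi>))\<^sup>2)) \<partial>lborel)"
    proof (rule nn_integral_cong)
      fix \<xi>
      have "(\<lambda>m. ennreal ((norm (ft (t n) \<xi> - ft (t m) \<xi>))\<^sup>2)) \<longlonglongrightarrow> ennreal ((norm (ft (t n) \<xi> - ft s \<xi>))\<^sup>2)"
        by (intro tendsto_intros ft_lim)
      then show "ennreal ((norm (ft (t n) \<xi> - ft s \<xi>))\<^sup>2) = liminf (\<lambda>m. ennreal ((norm (ft (t n) \<xi> - ft (t m) \<xi>))\<^sup>2))"
        by (intro lim_imp_Liminf[symmetric]) simp_all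
    qed
    also have "\<dots> \<le> liminf (\<lambda>m. energy lborel (\<lambda>\<xi>. ft (t n) \<xi> - ft (t m) \<xi>))"
      by (rule nn_integral_liminf) measurable
    also have "\<dots> \<le> limsup (\<lambda>m. energy lborel (\<lambda>\<xi>. ft (t n) \<xi> - ft (t m) \<xi>))"
      by (rule Liminf_le_Limsup) simp
    also have "\<dots> \<le> energy lborel (\<lambda>x. t n x - s x)"
    proof (rule Limsup_bounded, rule eventually_sequentiallyI[of n])
      fix m assume "n \<le> m"
      have "energy lborel (\<lambda>\<xi>. ft (t n) \<xi> - ft (t m) \<xi>) =
          energy lborel (ft (\<lambda>x. t n x - t m x))"
        by (simp add: ft_diff[OF tint tint])
      also have "\<dots> = energy lborel (\<lambda>x. t n x - t m x)"
      proof (rule Plancherel_bounded)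
        show "norm (t n x - t m x) \<le> real n + real m" for x
          by (rule order_trans[OF norm_triangle_ineq4]) (auto simp: t_def)
      qed (use tint in simp)
      finally have eq: "energy lborel (\<lambda>\<xi>. ft (t n) \<xi> - ft (t m) \<xi>) = energy lborel (\<lambda>x. t n x - t m x)" .
      show "energy lborel (\<lambda>\<xi>. ft (t n) \<xi> - ft (t m) \<xi>) \<le> energy lborel (\<lambda>x. t n x - s x)"
        unfolding eq
      proof (intro nn_integral_mono ennreal_leI power_mono)
        have "real n \<le> real m" using \<open>n \<le> m\<close> by simp
        then show "norm (t n x - t m x) \<le> norm (t n x - s x)" for x by (auto simp: t_def)
      qed simp
    qed
    finally show ?thesis .
  qed
  have tsL: "(\<lambda>x. t n x - s x) \<in> L2 lborel" for n by (intro L2_diff tL sL)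
  have ftsL: "(\<lambda>\<xi>. ft (t n) \<xi> - ft s \<xi>) \<in> L2 lborel" for n
    using bound[of n] tsL[of n] by (simp add: L2_iff_nn order_le_less_trans)
  have "(\<lambda>\<xi>. ft (t 0) \<xi> - (ft (t 0) \<xi> - ft s \<xi>)) \<in> L2 lborel" by (intro L2_diff ftL ftsL)
  then have fsL: "ft s \<in> L2 lborel" by simp
  have "(\<lambda>n. LINT x|lborel. (norm (t n x - s x))\<^sup>2) \<longlonglongrightarrow> (LINT x|(lborel::real measure). 0)"
  proof (rule integral_dominated_convergence[where w="\<lambda>x. (norm (s x))\<^sup>2"])
    show "integrable lborel (\<lambda>x. (norm (s x))\<^sup>2)" using sL by (rule L2_integrable_sq)
    show "AE x in lborel. (\<lambda>n. (norm (t n x - s x))\<^sup>2) \<longlonglongrightarrow> 0"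
      using teq by (intro AE_I2 tendsto_eventually) (auto elim!: eventually_mono)
    show "AE x in lborel. norm ((norm (t n x - s x))\<^sup>2) \<le> (norm (s x))\<^sup>2" for n
      by (auto simp: t_def)
  qed auto
  then have "(\<lambda>n. sqrt (LINT x|lborel. (norm (t n x - s x))\<^sup>2)) \<longlonglongrightarrow> sqrt 0"
    by (intro tendsto_real_sqrt) simp
  then have lim_t: "L2_lim lborel t s"
    by (simp add: L2_norm_def)
  have le: "L2_norm lborel (\<lambda>\<xi>. ft (t n) \<xi> - ft s \<xi>) \<le> L2_norm lborel (\<lambda>x. t n x - s x)" for n
  proof -
    have "ennreal ((L2_norm lborel (\<lambda>\<xi>. ft (t n) \<xi> - ft s \<xi>))\<^sup>2) \<le> ennreal ((L2_norm lborel (\<lambda>x. t n x - s x))\<^sup>2)"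
      using bound[of n] by (simp add: L2_norm_nn[OF tsL] L2_norm_nn[OF ftsL])
    then have "(L2_norm lborel (\<lambda>\<xi>. ft (t n) \<xi> - ft s \<xi>))\<^sup>2 \<le> (L2_norm lborel (\<lambda>x. t n x - s x))\<^sup>2" by simp
    then show ?thesis by (rule power2_le_imp_le) simp
  qed
  have lim_ft: "L2_lim lborel (\<lambda>n. ft (t n)) (ft s)"
    by (rule tendsto_sandwich[OF _ _ tendsto_const lim_t]) (auto simp: le)
  have "L2_norm lborel (ft (t n)) = L2_norm lborel (t n)" for n
  proof -
    have "ennreal ((L2_norm lborel (ft (t n)))\<^sup>2) = ennreal ((L2_norm lborel (t n))\<^sup>2)"
      using planch[of n] by (simp add: L2_norm_nn[OF tL] L2_norm_nn[OF ftL])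
    then have "(L2_norm lborel (ft (t n)))\<^sup>2 = (L2_norm lborel (t n))\<^sup>2" by simp
    then show ?thesis by (simp add: power2_eq_iff_nonneg)
  qed
  then have "L2_norm lborel (ft s) = L2_norm lborel s"
    using L2_norm_tendsto[OF ftL fsL lim_ft] L2_norm_tendsto[OF tL sL lim_t] LIMSEQ_unique by simp
  then show ?thesis by (simp add: L2_norm_nn[OF sL, symmetric] L2_norm_nn[OF fsL, symmetric])
qed

section \<open>Lebesgue measure on products\<close>

text \<open>Product types carry their Borel \<open>\<sigma>\<close>-algebra here; these rules let the measurability prover use the projections without
first rewriting it as a product \<open>\<sigma>\<close>-algebra.\<close>

lemma borel_measurable_fst_comp [measurable (raw)]:
  fixes f :: "'c \<Rightarrow> 'a::second_countable_topology \<times> 'b::second_countable_topology"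
  assumes "f \<in> M \<rightarrow>\<^sub>M borel"
  shows "(\<lambda>x. fst (f x)) \<in> M \<rightarrow>\<^sub>M borel"
  using measurable_compose[OF assms, of fst borel] by (simp add: borel_prod[symmetric])

lemma borel_measurable_snd_comp [measurable (raw)]:
  fixes f :: "'c \<Rightarrow> 'a::second_countable_topology \<times> 'b::second_countable_topology"
  assumes "f \<in> M \<rightarrow>\<^sub>M borel"
  shows "(\<lambda>x. snd (f x)) \<in> M \<rightarrow>\<^sub>M borel"
  using measurable_compose[OF assms, of snd borel] by (simp add: borel_prod[symmetric])

lemma nn_integral_lborel_pair:
  fixes f :: "'a::euclidean_space \<times> 'b::euclidean_space \<Rightarrow> ennreal"
  assumes "f \<in> borel_measurable borel"
  shows "(\<integral>\<^sup>+p. f p \<partial>lborel) = (\<integral>\<^sup>+x. \<integral>\<^sup>+y. f (x, y) \<partial>lborel \<partial>lborel)"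
  using lborel.nn_integral_fst[of f lborel] assms by (simp add: lborel_prod)

lemma nn_integral_lborel_swap:
  fixes f :: "'a::euclidean_space \<Rightarrow> 'b::euclidean_space \<Rightarrow> ennreal"
  assumes "(\<lambda>(x, y). f x y) \<in> borel_measurable borel"
  shows "(\<integral>\<^sup>+x. \<integral>\<^sup>+y. f x y \<partial>lborel \<partial>lborel) = (\<integral>\<^sup>+y. \<integral>\<^sup>+x. f x y \<partial>lborel \<partial>lborel)"
proof (rule lborel_pair.Fubini'[symmetric])
  show "(\<lambda>(x, y). f x y) \<in> borel_measurable (lborel \<Otimes>\<^sub>M lborel)"
    using assms by (simp add: lborel_prod)
qed

lemma integrable_lborel_pair:
  fixes f :: "'a::euclidean_space \<times> 'b::euclidean_space \<Rightarrow> complex"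
  assumes f: "integrable lborel f"
  shows "AE x in lborel. integrable lborel (\<lambda>y. f (x, y))"
    and "integrable lborel (\<lambda>x. LINT y|lborel. f (x, y))"
    and "(LINT p|lborel. f p) = (LINT x|lborel. LINT y|lborel. f (x, y))"
proof -
  have f': "integrable (lborel \<Otimes>\<^sub>M lborel) f" using f by (simp add: lborel_prod)
  show "AE x in lborel. integrable lborel (\<lambda>y. f (x, y))" by (rule lborel_pair.AE_integrable_fst'[OF f'])
  show "integrable lborel (\<lambda>x. LINT y|lborel. f (x, y))" by (rule lborel_pair.integrable_fst'[OF f'])
  show "(LINT p|lborel. f p) = (LINT x|lborel. LINT y|lborel. f (x, y))"
    using lborel_pair.integral_fst'[OF f'] by (simp add: lborel_prod)
qed

lemma AE_lborel_pair_L2: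
  fixes f :: "'a::euclidean_space \<times> 'b::euclidean_space \<Rightarrow> complex"
  assumes f: "f \<in> L2 lborel"
  shows "AE x in lborel. (\<lambda>y. f (x, y)) \<in> L2 lborel"
proof -
  have [measurable]: "f \<in> borel_measurable borel" using L2_measurable[OF f] by simp
  have "(\<integral>\<^sup>+x. energy lborel (\<lambda>y. f (x, y)) \<partial>lborel) < \<infinity>"
    using f by (subst nn_integral_lborel_pair[symmetric]) (auto simp: L2_iff_nn)
  then have "AE x in lborel. energy lborel (\<lambda>y. f (x, y)) \<noteq> \<infinity>"
    by (intro nn_integral_PInf_AE) auto
  then show ?thesis by eventually_elim (simp add: L2_iff_nn less_top)
qed

lemma AE_lborel_fst:
  fixes P :: "'a::euclidean_space \<Rightarrow> bool"
  assumes "AE y in lborel. P y"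
  shows "AE p in (lborel :: ('a \<times> 'b::euclidean_space) measure). P (fst p)"
proof -
  from assms obtain N where N: "{y. \<not> P y} \<subseteq> N" "emeasure lborel N = 0" "N \<in> sets borel"
    by (auto elim!: AE_E)
  have [measurable]: "N \<in> sets borel" by (rule N)
  have "(\<integral>\<^sup>+p. indicator N (fst p) \<partial>(lborel :: ('a \<times> 'b) measure)) =
      (\<integral>\<^sup>+x. indicator N x * emeasure lborel (UNIV :: 'b set) \<partial>lborel)"
    by (subst nn_integral_lborel_pair) simp_all
  also have "\<dots> = 0" using N by (subst nn_integral_multc) auto
  finally have "AE p in (lborel :: ('a \<times> 'b) measure). indicator N (fst p) = (0 :: ennreal)"
    by (subst (asm) nn_integral_0_iff_AE) auto
  then show ?thesis by eventually_elim (use N in \<open>auto simp: indicator_def split: if_splits\<close>)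
qed

lemma lebesgue_measurable_cong_AE:
  fixes f g :: "'a::euclidean_space \<Rightarrow> complex"
  assumes f: "f \<in> borel_measurable lebesgue" and fg: "AE x in lebesgue. f x = g x"
  shows "g \<in> borel_measurable lebesgue"
proof (rule measurableI)
  fix A :: "complex set" assume "A \<in> sets borel"
  then have "f -` A \<inter> space lebesgue \<in> sets lebesgue" using f by (rule measurable_sets[rotated])
  moreover have "AE x in lebesgue. x \<in> f -` A \<longleftrightarrow> x \<in> g -` A"
    using fg by eventually_elim simp
  ultimately have "g -` A \<in> sets lebesgue" using completion.in_sets_AE[of "f -` A" "g -` A"] by simp
  then show "g -` A \<inter> space lebesgue \<in> sets lebesgue" by simp
qed simp

lemma L2_lborel_lebesgue:
  fixes f :: "'a::euclidean_space \<Rightarrow> complex"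
  assumes "f \<in> borel_measurable borel"
  shows "f \<in> L2 lebesgue \<longleftrightarrow> f \<in> L2 lborel"
  using assms by (auto simp: L2_iff_nn nn_integral_completion measurable_completion)

lemma L1_L2_borel_representative:
  fixes s :: "'a::euclidean_space \<Rightarrow> complex"
  assumes s: "s \<in> L2 lebesgue" "integrable lebesgue s"
  obtains s' where "s' \<in> borel_measurable borel" "s' \<in> L2 lborel" "integrable lborel s'"
    "AE x in lebesgue. s x = s' x"
proof -
  obtain s' where s': "s' \<in> borel_measurable borel" "s' \<in> L2 lborel" "s' \<in> L2 lebesgue"
    "AE x in lebesgue. s x = s' x"
    using L2_lebesgue_borel_representative[OF s(1)] by metis
  have "integrable lebesgue s'"
    using s s' by (intro Bochner_Integration.integrable_cong_AE_imp[OF s(2)]) (auto intro: L2_measurable elim!: eventually_mono)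
  then have "integrable lborel s'" using s'(1) by (simp add: integrable_completion)
  with s' show ?thesis by (intro that)
qed

section \<open>Changes of variables with constant Jacobian\<close>

text \<open>All translations and dilations below, on the line, on the group and on the dual side, are of this kind.\<close>

locale lborel_scaling =
  fixes T :: "'a::euclidean_space \<Rightarrow> 'a" and J :: real
  assumes T_measurable [measurable]: "T \<in> borel_measurable borel" and J: "J > 0"
    and nn_integral: "f \<in> borel_measurable borel \<Longrightarrow> (\<integral>\<^sup>+y. f y \<partial>lborel) = ennreal J * (\<integral>\<^sup>+y. f (T y) \<partial>lborel)"
begin

lemma lborel_eq: "lborel = density (distr lborel borel T) (\<lambda>_. ennreal J)"
proof (rule measure_eqI)
  fix A :: "'a set" assume "A \<in> sets lborel"
  then have [measurable]: "A \<in> sets borel" by simp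
  have "emeasure lborel A = (\<integral>\<^sup>+y. indicator A y \<partial>lborel)" by simp
  also have "\<dots> = ennreal J * (\<integral>\<^sup>+y. indicator A (T y) \<partial>lborel)" by (rule nn_integral) measurable
  also have "(\<integral>\<^sup>+y. indicator A (T y) \<partial>lborel) = (\<integral>\<^sup>+y. indicator A y \<partial>distr lborel borel T)"
    by (rule nn_integral_distr[symmetric]) measurable
  also have "ennreal J * \<dots> = emeasure (density (distr lborel borel T) (\<lambda>_. ennreal J)) A"
    by (simp add: emeasure_density nn_integral_cmult)
  finally show "emeasure lborel A = emeasure (density (distr lborel borel T) (\<lambda>_. ennreal J)) A" .
qed simp

lemma AE_lborel:
  assumes "AE y in lborel. P y"
  shows "AE y in lborel. P (T y)"
proof -
  have "AE y in density (distr lborel borel T) (\<lambda>_. ennreal J). P y"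
    using assms unfolding lborel_eq[symmetric] .
  then have "AE y in distr lborel borel T. P y" using J by (simp add: AE_density)
  then show ?thesis by (rule AE_distrD[rotated]) simp
qed

lemma AE_lebesgue: "AE y in lebesgue. P y \<Longrightarrow> AE y in lebesgue. P (T y)"
  unfolding AE_completion_iff by (rule AE_lborel)

lemma integral_borel:
  fixes f :: "'a \<Rightarrow> complex"
  assumes [measurable]: "f \<in> borel_measurable borel"
  shows "(LINT y|lborel. f y) = J *\<^sub>R (LINT y|lborel. f (T y))"
  using J by (subst lborel_eq) (simp add: integral_density integral_distr)

lemma L2_compose:
  assumes f: "f \<in> L2 lebesgue"
  shows "(\<lambda>y. f (T y)) \<in> L2 lebesgue"
    and "(L2_norm lebesgue f)\<^sup>2 = J * (L2_norm lebesgue (\<lambda>y. f (T y)))\<^sup>2"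
proof -
  obtain f' where f': "f' \<in> borel_measurable borel" "f' \<in> L2 lborel" "f' \<in> L2 lebesgue" "AE x in lebesgue. f x = f' x"
    by (rule L2_lebesgue_borel_representative[OF f])
  note [measurable] = f'(1)
  have ae: "AE y in lebesgue. f' (T y) = f (T y)"
    using AE_lebesgue[OF f'(4)] by eventually_elim simp
  have nn: "energy lborel f' = ennreal J * energy lborel (\<lambda>y. f' (T y))"
    by (intro nn_integral) measurable
  have fT': "(\<lambda>y. f' (T y)) \<in> L2 lebesgue"
  proof (subst L2_lborel_lebesgue)
    have "ennreal J * energy lborel (\<lambda>y. f' (T y)) < \<infinity>"
      using f'(2) unfolding nn[symmetric] by (simp add: L2_iff_nn)
    then show "(\<lambda>y. f' (T y)) \<in> L2 lborel"
      using J by (auto simp: L2_iff_nn ennreal_mult_less_top)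
  qed measurable
  have fTm: "(\<lambda>y. f (T y)) \<in> borel_measurable lebesgue"
    by (rule lebesgue_measurable_cong_AE[OF L2_measurable[OF fT'] ae])
  show fT: "(\<lambda>y. f (T y)) \<in> L2 lebesgue" by (rule L2_cong_AE[OF ae fTm fT'])
  have "ennreal ((L2_norm lebesgue f)\<^sup>2) = ennreal ((L2_norm lebesgue f')\<^sup>2)"
    using L2_norm_cong_AE[OF f'(4)] f f' by (auto dest: L2_measurable)
  also have "\<dots> = ennreal J * ennreal ((L2_norm lebesgue (\<lambda>y. f' (T y)))\<^sup>2)"
    using nn by (simp add: L2_norm_nn[OF f'(3)] L2_norm_nn[OF fT'] nn_integral_completion)
  also have "L2_norm lebesgue (\<lambda>y. f' (T y)) = L2_norm lebesgue (\<lambda>y. f (T y))"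
    by (rule L2_norm_cong_AE[OF ae]) (intro L2_measurable fT' fT)+
  finally have "ennreal ((L2_norm lebesgue f)\<^sup>2) = ennreal (J * (L2_norm lebesgue (\<lambda>y. f (T y)))\<^sup>2)"
    using J by (simp add: ennreal_mult)
  then show "(L2_norm lebesgue f)\<^sup>2 = J * (L2_norm lebesgue (\<lambda>y. f (T y)))\<^sup>2"
    using J by (subst (asm) ennreal_inj) auto
qed

lemma integrable_compose:
  assumes f: "f \<in> L2 lebesgue" "integrable lebesgue f"
  shows "integrable lebesgue (\<lambda>y. f (T y))"
proof -
  obtain f' where f': "f' \<in> borel_measurable borel" "integrable lborel f'" "AE x in lebesgue. f x = f' x"
    by (rule L1_L2_borel_representative[OF f])
  note [measurable] = f'(1)
  have "integrable lborel (\<lambda>y. f' (T y))"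
  proof (rule integrableI_bounded)
    have "ennreal J * (\<integral>\<^sup>+y. ennreal (norm (f' (T y))) \<partial>lborel) < \<infinity>"
      using f'(2) nn_integral[of "\<lambda>y. ennreal (norm (f' y))"] by (auto simp: integrable_iff_bounded)
    then show "(\<integral>\<^sup>+y. ennreal (norm (f' (T y))) \<partial>lborel) < \<infinity>"
      using J by (auto simp: ennreal_mult_less_top)
  qed measurable
  then have int: "integrable lebesgue (\<lambda>y. f' (T y))" by (simp add: integrable_completion)
  have ae: "AE y in lebesgue. f' (T y) = f (T y)"
    using AE_lebesgue[OF f'(3)] by eventually_elim simp
  show ?thesis
    by (rule Bochner_Integration.integrable_cong_AE_imp[OF int L2_measurable[OF L2_compose(1)[OF f(1)]] ae])
qed

end

lemma real_affine_scaling: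
  fixes a c :: real
  assumes "c \<noteq> 0"
  shows "lborel_scaling (\<lambda>x. a + c * x) \<bar>c\<bar>"
  using assms by unfold_locales (auto intro: nn_integral_real_affine)

lemma AE_lborel_affine:
  fixes P :: "real \<Rightarrow> bool"
  assumes "AE y in lborel. P y" and "c \<noteq> 0"
  shows "AE x in lborel. P (a + c * x)"
  by (rule lborel_scaling.AE_lborel[OF real_affine_scaling[OF assms(2)] assms(1)])

section \<open>Plancherel's theorem for the Heisenberg group\<close>

lemma Lam_lebesgue [simp]: "Lam \<in> sets lebesgue"
  by (simp add: Lam_def)

lemma AE_lebesgue_on_Lam: "(AE \<omega> in lebesgue_on Lam. P \<omega>) \<longleftrightarrow> (AE \<omega> in lborel. P \<omega>)"
proof -
  have "(AE \<omega> in lebesgue_on Lam. P \<omega>) \<longleftrightarrow> (AE \<omega> in lborel. \<omega> \<in> Lam \<longrightarrow> P \<omega>)"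
    by (subst AE_restrict_space_iff) (auto simp: AE_completion_iff)
  also have "\<dots> \<longleftrightarrow> (AE \<omega> in lborel. P \<omega>)"
  proof
    assume "AE \<omega> in lborel. \<omega> \<in> Lam \<longrightarrow> P \<omega>"
    with AE_lborel_singleton[of "0::real"] show "AE \<omega> in lborel. P \<omega>"
      by eventually_elim (auto simp: Lam_def)
  qed auto
  finally show ?thesis .
qed

lemma nn_integral_lebesgue_on_Lam: "(\<integral>\<^sup>+\<omega>. f \<omega> \<partial>lebesgue_on Lam) = (\<integral>\<^sup>+\<omega>. f \<omega> \<partial>lborel)"
proof -
  have "(\<integral>\<^sup>+\<omega>. f \<omega> \<partial>lebesgue_on Lam) = (\<integral>\<^sup>+\<omega>. f \<omega> * indicator Lam \<omega> \<partial>lborel)"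
    by (simp add: nn_integral_restrict_space nn_integral_completion)
  also have "\<dots> = (\<integral>\<^sup>+\<omega>. f \<omega> \<partial>lborel)"
    using AE_lborel_singleton[of "0::real"]
    by (intro nn_integral_cong_AE) (auto simp: Lam_def elim!: eventually_mono)
  finally show ?thesis .
qed

text \<open>The signs are those of the Schroedinger representation, whose frequency in the second variable is \<open>v = \<omega> t\<close>.\<close>

definition ft2 :: "(real \<times> real \<Rightarrow> complex) \<Rightarrow> real \<Rightarrow> real \<Rightarrow> complex" where
  "ft2 q v \<omega> = (LINT z|lborel. q z * (cis (2 * pi * \<omega> * snd z) * cis (- (2 * pi * v * fst z))))"

text \<open>The inner integral \<open>r \<omega>\<close> is a Fourier transform on the line for almost every \<open>x\<close>, and the outer one is the Fourier
transform of \<open>r \<omega>\<close>, which is integrable for every \<open>\<omega>\<close> and square-integrable for almost every \<open>\<omega>\<close>.\<close>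

lemma Plancherel_plane:
  assumes q: "integrable lborel q" and qL: "q \<in> L2 lborel"
  shows "(\<integral>\<^sup>+\<omega>. energy lborel (\<lambda>v. ft2 q v \<omega>) \<partial>lborel) = energy lborel q"
proof -
  have [measurable]: "q \<in> borel_measurable borel" using q by auto
  define r where "r \<omega> x = ft (\<lambda>y. q (x, y)) \<omega>" for \<omega> x
  have [measurable]: "(\<lambda>p. r (fst p) (snd p)) \<in> borel_measurable borel"
    unfolding r_def ft_def by measurable
  have [measurable]: "r \<omega> \<in> borel_measurable borel" for \<omega>
    unfolding r_def[abs_def] ft_def by measurable
  have rint: "integrable lborel (r \<omega>)" for \<omega>
  proof -
    have "integrable lborel (\<lambda>z. cis (2 * pi * \<omega> * snd z) * q z)"
      by (rule Bochner_Integration.integrable_bound[OF q]) (auto simp: norm_mult)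
    from integrable_lborel_pair(2)[OF this] show ?thesis by (simp add: r_def[abs_def] ft_def)
  qed
  have slice: "ft2 q v \<omega> = ft (r \<omega>) (- v)" for v \<omega>
  proof -
    have "integrable lborel (\<lambda>z. q z * (cis (2 * pi * \<omega> * snd z) * cis (- (2 * pi * v * fst z))))"
      by (rule Bochner_Integration.integrable_bound[OF q]) (auto simp: norm_mult)
    from integrable_lborel_pair(3)[OF this]
    have "ft2 q v \<omega> = (LINT x|lborel. LINT y|lborel. cis (- (2 * pi * v * x)) * (cis (2 * pi * \<omega> * y) * q (x, y)))"
      by (simp add: ft2_def mult_ac)
    then show ?thesis by (simp add: ft_def r_def)
  qed
  have r2: "(\<integral>\<^sup>+\<omega>. energy lborel (r \<omega>) \<partial>lborel) = energy lborel q"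
  proof -
    have "(\<integral>\<^sup>+\<omega>. energy lborel (r \<omega>) \<partial>lborel) =
        (\<integral>\<^sup>+x. energy lborel (\<lambda>\<omega>. r \<omega> x) \<partial>lborel)"
      by (rule nn_integral_lborel_swap) (simp add: split_beta')
    also have "\<dots> = (\<integral>\<^sup>+x. energy lborel (\<lambda>y. q (x, y)) \<partial>lborel)"
    proof (rule nn_integral_cong_AE, use integrable_lborel_pair(1)[OF q] AE_lborel_pair_L2[OF qL] in eventually_elim)
      case (elim x)
      then show ?case unfolding r_def by (rule Plancherel_real)
    qed
    also have "\<dots> = energy lborel q"
      by (rule nn_integral_lborel_pair[symmetric]) simp
    finally show ?thesis .
  qed
  have "(\<integral>\<^sup>+\<omega>. energy lborel (r \<omega>) \<partial>lborel) < \<infinity>"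
    unfolding r2 using qL by (simp add: L2_iff_nn)
  moreover have "(\<lambda>\<omega>. energy lborel (r \<omega>)) \<in> borel_measurable borel"
    unfolding r_def ft_def by measurable
  ultimately have "AE \<omega> in lborel. energy lborel (r \<omega>) \<noteq> \<infinity>"
    by (intro nn_integral_PInf_AE) auto
  then have "AE \<omega> in lborel. energy lborel (\<lambda>v. ft2 q v \<omega>) = energy lborel (r \<omega>)"
  proof eventually_elim
    case (elim \<omega>)
    then have L: "r \<omega> \<in> L2 lborel" by (simp add: L2_iff_nn less_top)
    have "energy lborel (\<lambda>v. ft2 q v \<omega>) = energy lborel (\<lambda>v. ft (r \<omega>) (0 + (-1) * v))"
      by (simp add: slice)
    also have "\<dots> = energy lborel (ft (r \<omega>))"
      by (subst nn_integral_real_affine[of _ "-1" 0]) auto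
    finally show ?case using Plancherel_real[OF rint L] by simp
  qed
  then show ?thesis unfolding r2[symmetric] by (rule nn_integral_cong_AE)
qed

text \<open>Young's inequality for the convolution in the first variable, from the Cauchy--Schwarz
  inequality for the weight \<open>\<bar>s\<bar>\<close>.\<close>

lemma Young_heis:
  fixes s :: "heis \<Rightarrow> complex" and f :: "real \<Rightarrow> complex"
  assumes [measurable]: "s \<in> borel_measurable borel" "f \<in> borel_measurable borel"
  shows "(\<integral>\<^sup>+t. (\<integral>\<^sup>+x. ennreal (norm (s x) * norm (f (t - fst x))) \<partial>lborel)\<^sup>2 \<partial>lborel) \<le>
    (\<integral>\<^sup>+x. ennreal (norm (s x)) \<partial>lborel)\<^sup>2 * energy lborel f"
proof -
  let ?N = "\<integral>\<^sup>+x. ennreal (norm (s x)) \<partial>lborel"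
  let ?f2 = "energy lborel f"
  have CS: "(\<integral>\<^sup>+x. ennreal (norm (s x) * norm (f (t - fst x))) \<partial>lborel)\<^sup>2 \<le>
      ?N * (\<integral>\<^sup>+x. ennreal (norm (s x)) * ennreal ((norm (f (t - fst x)))\<^sup>2) \<partial>lborel)" for t
  proof -
    have "(\<integral>\<^sup>+x. ennreal (norm (s x) * norm (f (t - fst x))) \<partial>lborel)\<^sup>2 =
        (\<integral>\<^sup>+x. ennreal (sqrt (norm (s x))) * ennreal (sqrt (norm (s x)) * norm (f (t - fst x))) \<partial>lborel)\<^sup>2"
      by (intro arg_cong[where f="\<lambda>x. x\<^sup>2"] nn_integral_cong)
         (simp add: ennreal_mult[symmetric] mult.assoc[symmetric])
    also have "\<dots> \<le> (\<integral>\<^sup>+x. (ennreal (sqrt (norm (s x))))\<^sup>2 \<partial>lborel) *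
        (\<integral>\<^sup>+x. (ennreal (sqrt (norm (s x)) * norm (f (t - fst x))))\<^sup>2 \<partial>lborel)"
      by (rule Cauchy_Schwarz_nn_integral) measurable
    also have "\<dots> = ?N * (\<integral>\<^sup>+x. ennreal (norm (s x)) * ennreal ((norm (f (t - fst x)))\<^sup>2) \<partial>lborel)"
      by (simp add: ennreal_power power_mult_distrib ennreal_mult)
    finally show ?thesis .
  qed
  have "(\<integral>\<^sup>+t. (\<integral>\<^sup>+x. ennreal (norm (s x) * norm (f (t - fst x))) \<partial>lborel)\<^sup>2 \<partial>lborel) \<le>
      (\<integral>\<^sup>+t. ?N * (\<integral>\<^sup>+x. ennreal (norm (s x)) * ennreal ((norm (f (t - fst x)))\<^sup>2) \<partial>lborel) \<partial>lborel)"
    by (intro nn_integral_mono CS)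
  also have "\<dots> = ?N * (\<integral>\<^sup>+t. \<integral>\<^sup>+x. ennreal (norm (s x)) * ennreal ((norm (f (t - fst x)))\<^sup>2) \<partial>lborel \<partial>lborel)"
    by (rule nn_integral_cmult) measurable
  also have "(\<integral>\<^sup>+t. \<integral>\<^sup>+x. ennreal (norm (s x)) * ennreal ((norm (f (t - fst x)))\<^sup>2) \<partial>lborel \<partial>lborel) =
      (\<integral>\<^sup>+x. \<integral>\<^sup>+t. ennreal (norm (s x)) * ennreal ((norm (f (t - fst x)))\<^sup>2) \<partial>lborel \<partial>lborel)"
    by (rule nn_integral_lborel_swap) (simp add: split_beta')
  also have "\<dots> = (\<integral>\<^sup>+x. ennreal (norm (s x)) * ?f2 \<partial>lborel)"
  proof (rule nn_integral_cong)
    fix x :: heis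
    have "energy lborel (\<lambda>t. f (t - fst x)) = ?f2"
      using nn_integral_real_affine[of "\<lambda>t. ennreal ((norm (f t))\<^sup>2)" 1 "- fst x"] by simp
    then show "(\<integral>\<^sup>+t. ennreal (norm (s x)) * ennreal ((norm (f (t - fst x)))\<^sup>2) \<partial>lborel) = ennreal (norm (s x)) * ?f2"
      by (simp add: nn_integral_cmult)
  qed
  also have "\<dots> = ?N * ?f2" by (rule nn_integral_multc) measurable
  finally show ?thesis by (simp add: power2_eq_square mult.assoc)
qed

lemma schrodinger_rep_apply:
  "schrodinger_rep \<omega> x f t = cis (2 * pi * \<omega> * snd (snd x)) * cis (- (2 * pi * \<omega> * fst (snd x) * t)) * f (t - fst x)"
  by (cases x) simp

lemma AE_translate_reflect:
  assumes "AE y in lebesgue. P y"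
  shows "AE x in lebesgue. P (t - fst (x :: real \<times> 'b :: euclidean_space))"
proof -
  have "AE y in lborel. P (t + (-1) * y)"
    using assms by (intro AE_lborel_affine) (auto simp: AE_completion_iff)
  then have "AE x in lborel. P (t + (-1) * fst (x :: real \<times> 'b))" by (rule AE_lborel_fst)
  then show ?thesis by (simp add: AE_completion_iff)
qed

lemma fourier_L1_cong_AE:
  assumes s: "AE x in lebesgue. s x = s' x" and s': "s' \<in> borel_measurable borel"
    and f: "AE y in lebesgue. f y = f' y" and f': "f' \<in> borel_measurable borel"
  shows "fourier_L1 s \<omega> f t = (LINT x|lborel. s' x * schrodinger_rep \<omega> x f' t)"
proof -
  note [measurable] = s' f'
  have m: "(\<lambda>x. s' x * schrodinger_rep \<omega> x f' t) \<in> borel_measurable borel"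
    unfolding schrodinger_rep_apply by measurable
  have ae: "AE x in lebesgue. s' x * schrodinger_rep \<omega> x f' t = s x * schrodinger_rep \<omega> x f t"
    using s AE_translate_reflect[OF f, of t] by eventually_elim (simp add: schrodinger_rep_apply)
  have m': "(\<lambda>x. s' x * schrodinger_rep \<omega> x f' t) \<in> borel_measurable lebesgue"
    using m by (intro measurable_completion) simp
  have "fourier_L1 s \<omega> f t = (LINT x|lebesgue. s' x * schrodinger_rep \<omega> x f' t)"
    unfolding fourier_L1_def using ae
    by (intro integral_cong_AE lebesgue_measurable_cong_AE[OF m' ae] m') (auto elim!: eventually_mono)
  also have "\<dots> = (LINT x|lborel. s' x * schrodinger_rep \<omega> x f' t)"
    using m by (intro integral_completion) simp
  finally show ?thesis .
qed

lemma Young_heis_finite: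
  fixes s :: "heis \<Rightarrow> complex"
  assumes [measurable]: "s \<in> borel_measurable borel" "f \<in> borel_measurable borel"
    and s: "integrable lborel s" and f: "f \<in> L2 lborel"
  shows "(\<integral>\<^sup>+t. (\<integral>\<^sup>+x. ennreal (norm (s x) * norm (f (t - fst x))) \<partial>lborel)\<^sup>2 \<partial>lborel) < \<infinity>"
proof -
  have "(\<integral>\<^sup>+x. ennreal (norm (s x)) \<partial>lborel) < \<infinity>" using s by (auto simp: integrable_iff_bounded)
  moreover have "energy lborel f < \<infinity>" using f by (simp add: L2_iff_nn)
  ultimately have "(\<integral>\<^sup>+x. ennreal (norm (s x)) \<partial>lborel)\<^sup>2 * energy lborel f < \<infinity>"
    by (simp add: power2_eq_square ennreal_mult_less_top)
  then show ?thesis using order_le_less_trans[OF Young_heis[OF assms(1,2)]] by blast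
qed

lemma AE_schrodinger_integrable:
  fixes s :: "heis \<Rightarrow> complex"
  assumes [measurable]: "s \<in> borel_measurable borel" "f \<in> borel_measurable borel"
    and s: "integrable lborel s" and f: "f \<in> L2 lborel"
  shows "AE t in lborel. \<forall>\<omega>. integrable lborel (\<lambda>x. s x * schrodinger_rep \<omega> x f t)"
proof -
  have "AE t in lborel. (\<integral>\<^sup>+x. ennreal (norm (s x) * norm (f (t - fst x))) \<partial>lborel)\<^sup>2 \<noteq> \<infinity>"
    using Young_heis_finite[OF assms] by (intro nn_integral_PInf_AE) auto
  then show ?thesis
  proof eventually_elim
    case (elim t)
    then have *: "(\<integral>\<^sup>+x. ennreal (norm (s x) * norm (f (t - fst x))) \<partial>lborel) < \<infinity>"
      by (auto simp: power2_eq_square less_top[symmetric] top_unique ennreal_top_mult)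
    show ?case
    proof (rule allI, rule integrableI_bounded)
      fix \<omega>
      show "(\<lambda>x. s x * schrodinger_rep \<omega> x f t) \<in> borel_measurable lborel"
        unfolding schrodinger_rep_apply by measurable
      show "(\<integral>\<^sup>+x. ennreal (norm (s x * schrodinger_rep \<omega> x f t)) \<partial>lborel) < \<infinity>"
        using * by (simp add: schrodinger_rep_apply norm_mult)
    qed
  qed
qed

lemma schrodinger_integral_measurable [measurable]:
  fixes s :: "heis \<Rightarrow> complex"
  assumes [measurable]: "s \<in> borel_measurable borel" "f \<in> borel_measurable borel"
  shows "(\<lambda>t. LINT x|lborel. s x * schrodinger_rep \<omega> x f t) \<in> borel_measurable borel"
  unfolding schrodinger_rep_apply by measurable

lemma nn_integral_schrodinger_integral_le:
  fixes s :: "heis \<Rightarrow> complex"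
  assumes [measurable]: "s \<in> borel_measurable borel" "f \<in> borel_measurable borel"
  shows "energy lborel (\<lambda>t. LINT x|lborel. s x * schrodinger_rep \<omega> x f t) \<le>
    (\<integral>\<^sup>+x. ennreal (norm (s x)) \<partial>lborel)\<^sup>2 * energy lborel f"
proof -
  have "ennreal ((norm (LINT x|lborel. s x * schrodinger_rep \<omega> x f t))\<^sup>2) \<le>
      (\<integral>\<^sup>+x. ennreal (norm (s x) * norm (f (t - fst x))) \<partial>lborel)\<^sup>2" for t
  proof -
    have "ennreal (norm (LINT x|lborel. s x * schrodinger_rep \<omega> x f t)) \<le>
        (\<integral>\<^sup>+x. ennreal (norm (s x * schrodinger_rep \<omega> x f t)) \<partial>lborel)"
    proof (cases "integrable lborel (\<lambda>x. s x * schrodinger_rep \<omega> x f t)")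
      case True then show ?thesis by (rule integral_norm_bound_ennreal)
    qed (simp add: not_integrable_integral_eq)
    then have "(ennreal (norm (LINT x|lborel. s x * schrodinger_rep \<omega> x f t)))\<^sup>2 \<le>
        (\<integral>\<^sup>+x. ennreal (norm (s x * schrodinger_rep \<omega> x f t)) \<partial>lborel)\<^sup>2"
      by (rule power_mono) simp
    then show ?thesis by (simp add: ennreal_power schrodinger_rep_apply norm_mult)
  qed
  then have "energy lborel (\<lambda>t. LINT x|lborel. s x * schrodinger_rep \<omega> x f t) \<le>
    (\<integral>\<^sup>+t. (\<integral>\<^sup>+x. ennreal (norm (s x) * norm (f (t - fst x))) \<partial>lborel)\<^sup>2 \<partial>lborel)"
    by (rule nn_integral_mono)
  also note Young_heis[OF assms]
  finally show ?thesis .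
qed

lemma fourier_L1_bounded_operator:
  assumes s: "s \<in> L2N" "integrable lebesgue s"
  shows "bounded_operator (fourier_L1 s \<omega>)"
proof -
  obtain s' where s': "s' \<in> borel_measurable borel" "s' \<in> L2 lborel" "integrable lborel s'"
    "AE x in lebesgue. s x = s' x" using L1_L2_borel_representative[OF s] .
  note [measurable] = s'(1)
  define N where "N = (LINT x|lborel. norm (s' x))"
  have N0: "N \<ge> 0" by (simp add: N_def)
  have N: "(\<integral>\<^sup>+x. ennreal (norm (s' x)) \<partial>lborel) = ennreal N"
    unfolding N_def using s'(3) by (intro nn_integral_eq_integral) auto
  have L: "fourier_L1 s \<omega> f \<in> L2R \<and> L2_norm lebesgue (fourier_L1 s \<omega> f) \<le> N * L2_norm lebesgue f" if f: "f \<in> L2R" for f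
  proof -
    obtain f' where f': "f' \<in> borel_measurable borel" "f' \<in> L2 lborel" "f' \<in> L2R"
      "AE x in lebesgue. f x = f' x" using L2_lebesgue_borel_representative[OF f] by metis
    note [measurable] = f'(1)
    let ?F = "\<lambda>t. LINT x|lborel. s' x * schrodinger_rep \<omega> x f' t"
    have eq: "fourier_L1 s \<omega> f = ?F"
      by (rule ext, rule fourier_L1_cong_AE[OF s'(4,1) f'(4,1)])
    have le: "energy lborel ?F \<le> (ennreal N)\<^sup>2 * ennreal ((L2_norm lebesgue f)\<^sup>2)"
    proof -
      have "ennreal ((L2_norm lebesgue f)\<^sup>2) = energy lborel f"
        using L2_norm_nn[OF f] by (simp add: nn_integral_completion)
      also have "\<dots> = energy lborel f'"
        using f'(4) by (intro nn_integral_cong_AE) (auto simp: AE_completion_iff elim!: eventually_mono)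
      finally show ?thesis using nn_integral_schrodinger_integral_le[of s' f' \<omega>] by (simp add: N)
    qed
    also have "\<dots> = ennreal ((N * L2_norm lebesgue f)\<^sup>2)"
      using N0 by (simp add: ennreal_power ennreal_mult power_mult_distrib)
    finally have le: "energy lborel ?F \<le> ennreal ((N * L2_norm lebesgue f)\<^sup>2)" .
    have FL: "?F \<in> L2R"
      by (subst L2_lborel_lebesgue) (use le in \<open>auto simp: L2_iff_nn intro: order_le_less_trans\<close>)
    have "ennreal ((L2_norm lebesgue ?F)\<^sup>2) \<le> ennreal ((N * L2_norm lebesgue f)\<^sup>2)"
      using le by (simp add: L2_norm_nn[OF FL] nn_integral_completion)
    then have "(L2_norm lebesgue ?F)\<^sup>2 \<le> (N * L2_norm lebesgue f)\<^sup>2" by (subst (asm) ennreal_le_iff) auto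
    then have "L2_norm lebesgue ?F \<le> N * L2_norm lebesgue f" by (rule power2_le_imp_le) (simp add: N0)
    with FL show ?thesis by (simp add: eq)
  qed
  have lin: "AE t in lebesgue. fourier_L1 s \<omega> (\<lambda>s. a * f s + b * g s) t = a * fourier_L1 s \<omega> f t + b * fourier_L1 s \<omega> g t"
    if f: "f \<in> L2R" and g: "g \<in> L2R" for a b f g
  proof -
    obtain f' where f': "f' \<in> borel_measurable borel" "f' \<in> L2 lborel"
      "AE x in lebesgue. f x = f' x" using L2_lebesgue_borel_representative[OF f] by metis
    obtain g' where g': "g' \<in> borel_measurable borel" "g' \<in> L2 lborel"
      "AE x in lebesgue. g x = g' x" using L2_lebesgue_borel_representative[OF g] by metis
    have ae: "AE x in lebesgue. a * f x + b * g x = a * f' x + b * g' x"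
      using f'(3) g'(3) by eventually_elim simp
    have m: "(\<lambda>x. a * f' x + b * g' x) \<in> borel_measurable borel" using f'(1) g'(1) by measurable
    have "AE t in lborel. fourier_L1 s \<omega> (\<lambda>s. a * f s + b * g s) t = a * fourier_L1 s \<omega> f t + b * fourier_L1 s \<omega> g t"
      using AE_schrodinger_integrable[OF s'(1) f'(1) s'(3) f'(2)] AE_schrodinger_integrable[OF s'(1) g'(1) s'(3) g'(2)]
    proof eventually_elim
      case (elim t)
      have "(LINT x|lborel. s' x * schrodinger_rep \<omega> x (\<lambda>x. a * f' x + b * g' x) t) =
          (LINT x|lborel. a * (s' x * schrodinger_rep \<omega> x f' t) + b * (s' x * schrodinger_rep \<omega> x g' t))"
        by (intro Bochner_Integration.integral_cong) (auto simp: schrodinger_rep_apply algebra_simps)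
      also have "\<dots> = a * (LINT x|lborel. s' x * schrodinger_rep \<omega> x f' t) + b * (LINT x|lborel. s' x * schrodinger_rep \<omega> x g' t)"
        using elim by (subst Bochner_Integration.integral_add) auto
      finally show ?case
        by (simp only: fourier_L1_cong_AE[OF s'(4,1) f'(3,1)] fourier_L1_cong_AE[OF s'(4,1) g'(3,1)]
            fourier_L1_cong_AE[OF s'(4,1) ae m])
    qed
    then show ?thesis by (simp add: AE_completion_iff)
  qed
  show ?thesis unfolding bounded_operator_def using L lin by blast
qed

lemma fourier_L1_linear:
  assumes s: "s \<in> L2N" "integrable lebesgue s" and r: "r \<in> L2N" "integrable lebesgue r" and f: "f \<in> L2R"
  shows "AE t in lebesgue. fourier_L1 (\<lambda>x. a * s x + b * r x) \<omega> f t = a * fourier_L1 s \<omega> f t + b * fourier_L1 r \<omega> f t"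
proof -
  obtain s' where s': "s' \<in> borel_measurable borel" "s' \<in> L2 lborel" "integrable lborel s'"
    "AE x in lebesgue. s x = s' x" using L1_L2_borel_representative[OF s] .
  obtain r' where r': "r' \<in> borel_measurable borel" "r' \<in> L2 lborel" "integrable lborel r'"
    "AE x in lebesgue. r x = r' x" using L1_L2_borel_representative[OF r] .
  obtain f' where f': "f' \<in> borel_measurable borel" "f' \<in> L2 lborel"
    "AE x in lebesgue. f x = f' x" using L2_lebesgue_borel_representative[OF f] by metis
  have ae: "AE x in lebesgue. a * s x + b * r x = a * s' x + b * r' x"
    using s'(4) r'(4) by eventually_elim simp
  have m: "(\<lambda>x. a * s' x + b * r' x) \<in> borel_measurable borel" using s'(1) r'(1) by measurable
  have "AE t in lborel. fourier_L1 (\<lambda>x. a * s x + b * r x) \<omega> f t = a * fourier_L1 s \<omega> f t + b * fourier_L1 r \<omega> f t"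
    using AE_schrodinger_integrable[OF s'(1) f'(1) s'(3) f'(2)] AE_schrodinger_integrable[OF r'(1) f'(1) r'(3) f'(2)]
  proof eventually_elim
    case (elim t)
    have "(LINT x|lborel. (a * s' x + b * r' x) * schrodinger_rep \<omega> x f' t) =
        (LINT x|lborel. a * (s' x * schrodinger_rep \<omega> x f' t) + b * (r' x * schrodinger_rep \<omega> x f' t))"
      by (intro Bochner_Integration.integral_cong) (auto simp: algebra_simps)
    also have "\<dots> = a * (LINT x|lborel. s' x * schrodinger_rep \<omega> x f' t) + b * (LINT x|lborel. r' x * schrodinger_rep \<omega> x f' t)"
      using elim by (subst Bochner_Integration.integral_add) auto
    finally show ?case
      by (simp only: fourier_L1_cong_AE[OF s'(4,1) f'(3,1)] fourier_L1_cong_AE[OF r'(4,1) f'(3,1)]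
          fourier_L1_cong_AE[OF ae m f'(3,1)])
  qed
  then show ?thesis by (simp add: AE_completion_iff)
qed

text \<open>The operator \<open>fourier_L1 s \<omega>\<close> is an integral operator with kernel \<open>heis_kernel s \<omega> (t - y) (\<omega> * t)\<close> at \<open>(t, y)\<close>.\<close>

definition heis_kernel :: "(heis \<Rightarrow> complex) \<Rightarrow> real \<Rightarrow> real \<Rightarrow> real \<Rightarrow> complex" where
  "heis_kernel s \<omega> x v = ft2 (\<lambda>z. s (x, z)) v \<omega>"

lemma heis_kernel_measurable [measurable (raw)]:
  assumes [measurable]: "s \<in> borel_measurable borel"
    "a \<in> borel_measurable M" "b \<in> borel_measurable M" "c \<in> borel_measurable M"
  shows "(\<lambda>p. heis_kernel s (a p) (b p) (c p)) \<in> borel_measurable M"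
  unfolding heis_kernel_def ft2_def by measurable

lemma schrodinger_integral_kernel:
  fixes s :: "heis \<Rightarrow> complex"
  assumes "integrable lborel (\<lambda>x. s x * schrodinger_rep \<omega> x f t)"
  shows "(LINT x|lborel. s x * schrodinger_rep \<omega> x f t) = (LINT y|lborel. heis_kernel s \<omega> (t - y) (\<omega> * t) * f y)"
proof -
  have "(LINT x|lborel. s x * schrodinger_rep \<omega> x f t) =
      (LINT x|lborel. LINT z|lborel. s (x, z) * (cis (2 * pi * \<omega> * snd z) * cis (- (2 * pi * (\<omega> * t) * fst z))) * f (t - x))"
    using integrable_lborel_pair(3)[OF assms] by (simp add: schrodinger_rep_apply mult_ac)
  also have "\<dots> = (LINT x|lborel. heis_kernel s \<omega> x (\<omega> * t) * f (t - x))"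
    by (simp add: heis_kernel_def ft2_def)
  also have "\<dots> = (LINT y|lborel. heis_kernel s \<omega> (t - y) (\<omega> * t) * f y)"
    by (subst lborel_integral_real_affine[of "-1" _ t]) auto
  finally show ?thesis .
qed

lemma heis_kernel_norm:
  fixes s :: "heis \<Rightarrow> complex"
  assumes s: "integrable lborel s" and sL: "s \<in> L2 lborel"
  shows "(\<integral>\<^sup>+\<omega>. \<integral>\<^sup>+v. energy lborel (\<lambda>x. heis_kernel s \<omega> x v) \<partial>lborel \<partial>lborel) =
    energy lborel s"
proof -
  have [measurable]: "s \<in> borel_measurable borel" using s by auto
  have "(\<integral>\<^sup>+\<omega>. \<integral>\<^sup>+v. energy lborel (\<lambda>x. heis_kernel s \<omega> x v) \<partial>lborel \<partial>lborel) =
      (\<integral>\<^sup>+\<omega>. \<integral>\<^sup>+x. energy lborel (heis_kernel s \<omega> x) \<partial>lborel \<partial>lborel)"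
    by (intro nn_integral_cong nn_integral_lborel_swap) (simp add: split_beta')
  also have "\<dots> = (\<integral>\<^sup>+x. \<integral>\<^sup>+\<omega>. energy lborel (heis_kernel s \<omega> x) \<partial>lborel \<partial>lborel)"
    by (intro nn_integral_lborel_swap) (simp add: split_beta')
  also have "\<dots> = (\<integral>\<^sup>+x. energy lborel (\<lambda>z. s (x, z)) \<partial>lborel)"
  proof (rule nn_integral_cong_AE, use integrable_lborel_pair(1)[OF s] AE_lborel_pair_L2[OF sL] in eventually_elim)
    case (elim x)
    then show ?case unfolding heis_kernel_def by (rule Plancherel_plane)
  qed
  also have "\<dots> = energy lborel s"
    by (rule nn_integral_lborel_pair[symmetric]) simp
  finally show ?thesis .
qed

text \<open>By Parseval's identity in the variable \<open>y\<close>, the Hilbert--Schmidt norm of an integral operator is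
  the norm of its kernel.\<close>

lemma hs_norm_sq_fourier_L1:
  assumes s: "s \<in> L2N" "integrable lebesgue s"
    and s': "s' \<in> borel_measurable borel" "integrable lborel s'" "AE x in lebesgue. s x = s' x"
    and \<omega>: "\<omega> \<noteq> 0"
    and fin: "(\<integral>\<^sup>+v. energy lborel (\<lambda>x. heis_kernel s' \<omega> x v) \<partial>lborel) < \<infinity>"
  shows "ennreal \<bar>\<omega>\<bar> * hs_norm_sq (fourier_L1 s \<omega>) = (\<integral>\<^sup>+v. energy lborel (\<lambda>x. heis_kernel s' \<omega> x v) \<partial>lborel)"
proof -
  note [measurable] = s'(1)
  have "\<exists>f'. f' \<in> borel_measurable borel \<and> f' \<in> L2 lborel \<and> f' \<in> L2R \<and> (AE x in lebesgue. std_basis n x = f' x)" for n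
    using L2_lebesgue_borel_representative[OF std_basis_L2[of n]] by metis
  then obtain u where u: "\<And>n. u n \<in> borel_measurable borel" "\<And>n. u n \<in> L2 lborel" "\<And>n. u n \<in> L2R"
    "\<And>n. AE x in lebesgue. std_basis n x = u n x" by metis
  note [measurable] = u(1)
  let ?F = "\<lambda>n t. LINT x|lborel. s' x * schrodinger_rep \<omega> x (u n) t"
  let ?K = "\<lambda>t y. heis_kernel s' \<omega> (t - y) (\<omega> * t)"
  have eq: "fourier_L1 s \<omega> (std_basis n) = ?F n" for n
    by (rule ext, rule fourier_L1_cong_AE[OF s'(3,1) u(4,1)])
  have FL: "?F n \<in> L2R" for n
    using bounded_operator_L2[OF fourier_L1_bounded_operator[OF s] std_basis_L2] eq by metis
  have scale: "ennreal \<bar>\<omega>\<bar> * (\<integral>\<^sup>+t. energy lborel (?K t) \<partial>lborel) =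
      (\<integral>\<^sup>+v. energy lborel (\<lambda>x. heis_kernel s' \<omega> x v) \<partial>lborel)"
  proof -
    have "energy lborel (?K t) = energy lborel (\<lambda>x. heis_kernel s' \<omega> x (\<omega> * t))" for t
      by (subst (2) nn_integral_real_affine[of _ "-1" t]) auto
    then show ?thesis
      by (subst (2) nn_integral_real_affine[of _ \<omega> 0]) (use \<omega> in auto)
  qed
  have KL: "AE t in lborel. (\<lambda>y. cnj (?K t y)) \<in> L2R"
  proof -
    have "(\<integral>\<^sup>+t. energy lborel (?K t) \<partial>lborel) \<noteq> \<infinity>"
      using fin \<omega> unfolding scale[symmetric] by (auto simp: ennreal_mult_less_top)
    then have "AE t in lborel. energy lborel (?K t) \<noteq> \<infinity>"
      by (intro nn_integral_PInf_AE) auto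
    then show ?thesis
    proof eventually_elim
      case (elim t)
      then show ?case by (subst L2_lborel_lebesgue) (auto simp: L2_iff_nn less_top)
    qed
  qed
  have int: "AE t in lborel. \<forall>n. integrable lborel (\<lambda>x. s' x * schrodinger_rep \<omega> x (u n) t)"
    unfolding AE_all_countable
  proof
    fix n show "AE t in lborel. integrable lborel (\<lambda>x. s' x * schrodinger_rep \<omega> x (u n) t)"
      using AE_schrodinger_integrable[OF s'(1) u(1) s'(2) u(2), of n] by eventually_elim simp
  qed
  have "hs_norm_sq (fourier_L1 s \<omega>) = (\<Sum>n. energy lborel (?F n))"
    unfolding hs_norm_sq_eq eq by (simp add: L2_norm_nn[OF FL] nn_integral_completion)
  also have "\<dots> = (\<integral>\<^sup>+t. (\<Sum>n. ennreal ((norm (?F n t))\<^sup>2)) \<partial>lborel)"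
    by (rule nn_integral_suminf[symmetric]) measurable
  also have "\<dots> = (\<integral>\<^sup>+t. energy lborel (?K t) \<partial>lborel)"
  proof (rule nn_integral_cong_AE, use KL int in eventually_elim)
    case (elim t)
    let ?k = "\<lambda>y. cnj (?K t y)"
    have km: "(\<lambda>y. cnj (?K t y)) \<in> borel_measurable borel" by measurable
    have "norm (?F n t) = cmod (L2_inner lebesgue ?k (std_basis n))" for n
    proof -
      have "L2_inner lebesgue (std_basis n) ?k = L2_inner lebesgue (u n) ?k"
        using u elim by (intro L2_inner_cong_AE L2_measurable[OF std_basis_L2] L2_measurable) auto
      also have "\<dots> = (LINT y|lborel. u n y * cnj (?k y))"
        unfolding L2_inner_def by (intro integral_completion) measurable
      also have "\<dots> = ?F n t"
        using schrodinger_integral_kernel[of s' \<omega> "u n" t] elim by (simp add: mult.commute)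
      finally show ?thesis by (simp add: L2_inner_cnj[of lebesgue ?k "std_basis n"])
    qed
    then have "(\<Sum>n. ennreal ((norm (?F n t))\<^sup>2)) = ennreal ((L2_norm lebesgue ?k)\<^sup>2)"
      using orthonormal_basis_Parseval[OF std_basis elim(1)] by simp
    also have "\<dots> = energy lborel (?K t)"
      by (simp add: L2_norm_nn[OF elim(1)] nn_integral_completion)
    finally show ?case .
  qed
  finally show ?thesis using scale by simp
qed

text \<open>The Hilbert--Schmidt identity requires a square-integrable kernel. Finiteness of the total energy of the kernels provides
this for almost every frequency.\<close>

theorem Plancherel_heis:
  assumes s: "s \<in> L2N" "integrable lebesgue s"
  shows "field_norm_sq (fourier_L1 s) = ennreal ((L2_norm lebesgue s)\<^sup>2)"
proof -
  obtain s' where s': "s' \<in> borel_measurable borel" "s' \<in> L2 lborel" "integrable lborel s'"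
    "AE x in lebesgue. s x = s' x" using L1_L2_borel_representative[OF s] .
  note [measurable] = s'(1)
  let ?G = "\<lambda>\<omega>. \<integral>\<^sup>+v. energy lborel (\<lambda>x. heis_kernel s' \<omega> x v) \<partial>lborel"
  have "(\<integral>\<^sup>+\<omega>. ?G \<omega> \<partial>lborel) < \<infinity>"
    using heis_kernel_norm[OF s'(3,2)] s'(2) by (simp add: L2_iff_nn)
  then have "AE \<omega> in lborel. ?G \<omega> \<noteq> \<infinity>" by (intro nn_integral_PInf_AE) auto
  with AE_lborel_singleton[of "0::real"]
  have ae: "AE \<omega> in lborel. ennreal \<bar>\<omega>\<bar> * hs_norm_sq (fourier_L1 s \<omega>) = ?G \<omega>"
  proof eventually_elim
    case (elim \<omega>)
    then show ?case by (intro hs_norm_sq_fourier_L1[OF s s'(1,3,4)]) (auto simp: less_top)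
  qed
  have "field_norm_sq (fourier_L1 s) = (\<integral>\<^sup>+\<omega>. ?G \<omega> \<partial>lborel)"
    unfolding field_norm_sq_def nn_integral_lebesgue_on_Lam by (rule nn_integral_cong_AE[OF ae])
  also have "\<dots> = energy lborel s'" by (rule heis_kernel_norm[OF s'(3,2)])
  also have "\<dots> = energy lborel s"
    using s'(4) by (intro nn_integral_cong_AE) (auto simp: AE_completion_iff elim!: eventually_mono)
  also have "\<dots> = ennreal ((L2_norm lebesgue s)\<^sup>2)"
    using L2_norm_nn[OF s(1)] by (simp add: nn_integral_completion)
  finally show ?thesis .
qed

section \<open>Operator fields and the Fourier transform of square-integrable functions\<close>

lemma nn_integral_tendsto_0_AE_subseq:
  fixes f :: "nat \<Rightarrow> 'a \<Rightarrow> ennreal"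
  assumes [measurable]: "\<And>n. f n \<in> borel_measurable M"
    and lim: "(\<lambda>n. \<integral>\<^sup>+x. f n x \<partial>M) \<longlonglongrightarrow> 0"
  obtains \<sigma> :: "nat \<Rightarrow> nat" where "strict_mono \<sigma>" "AE x in M. (\<lambda>n. f (\<sigma> n) x) \<longlonglongrightarrow> 0"
proof -
  have "\<exists>N. \<forall>n\<ge>N. (\<integral>\<^sup>+x. f n x \<partial>M) < ennreal ((1/2)^k)" for k
    using order_tendstoD(2)[OF lim, of "ennreal ((1/2)^k)"] by (simp add: eventually_sequentially)
  then obtain N where N: "\<And>k n. n \<ge> N k \<Longrightarrow> (\<integral>\<^sup>+x. f n x \<partial>M) < ennreal ((1/2)^k)" by metis
  define \<sigma> where "\<sigma> k = (\<Sum>i\<le>k. N i + 1)" for k :: nat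
  have ge: "\<sigma> k \<ge> N k" for k
    using member_le_sum[of k "{..k}" "\<lambda>i. N i + 1"] by (simp add: \<sigma>_def)
  have mono: "strict_mono \<sigma>" by (rule strict_monoI_Suc) (simp add: \<sigma>_def)
  have "(\<integral>\<^sup>+x. (\<Sum>k. f (\<sigma> k) x) \<partial>M) = (\<Sum>k. \<integral>\<^sup>+x. f (\<sigma> k) x \<partial>M)"
    by (rule nn_integral_suminf) measurable
  also have "\<dots> \<le> (\<Sum>k. ennreal ((1/2)^k))" using N[OF ge] by (intro suminf_le less_imp_le) auto
  also have "\<dots> < \<infinity>" by (subst suminf_ennreal2) (auto simp: summable_geometric)
  finally have "AE x in M. (\<Sum>k. f (\<sigma> k) x) \<noteq> \<infinity>"
    by (intro nn_integral_PInf_AE) auto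
  then have "AE x in M. (\<lambda>n. f (\<sigma> n) x) \<longlonglongrightarrow> 0"
  proof eventually_elim
    case (elim x)
    have fin: "f (\<sigma> k) x \<noteq> top" for k
    proof
      assume "f (\<sigma> k) x = top"
      moreover have "f (\<sigma> k) x \<le> (\<Sum>k. f (\<sigma> k) x)"
        using sum_le_suminf[of "\<lambda>k. f (\<sigma> k) x" "{k}"] by simp
      ultimately show False using elim by (simp add: top_unique)
    qed
    have "summable (\<lambda>k. enn2real (f (\<sigma> k) x))"
      using elim fin by (intro summable_suminf_not_top) (auto simp: less_top)
    then have "(\<lambda>k. enn2real (f (\<sigma> k) x)) \<longlonglongrightarrow> 0" by (rule summable_LIMSEQ_zero)
    then have "(\<lambda>k. ennreal (enn2real (f (\<sigma> k) x))) \<longlonglongrightarrow> ennreal 0" by (rule tendsto_ennrealI)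
    then show ?case using fin by (simp add: less_top)
  qed
  with mono show ?thesis by (rule that)
qed

lemma borel_imp_lebesgue_on_Lam: "c \<in> borel_measurable borel \<Longrightarrow> c \<in> borel_measurable (lebesgue_on Lam)"
  by (intro measurable_restrict_space1 measurable_completion) simp

text \<open>Measurability up to null sets is stable under forming differences of fields that consist of
  bounded operators only almost everywhere.\<close>

definition ae_measurable_field :: "(real \<Rightarrow> operator) \<Rightarrow> bool" where
  "ae_measurable_field B \<longleftrightarrow>
     (AE \<omega> in lebesgue_on Lam. bounded_operator (B \<omega>)) \<and>
     (\<forall>f\<in>L2R. \<forall>g\<in>L2R. \<exists>c\<in>borel_measurable (lebesgue_on Lam).
        AE \<omega> in lebesgue_on Lam. L2_inner lebesgue (B \<omega> f) g = c \<omega>)"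

lemma hs_field_ae_measurable: "hs_field A \<Longrightarrow> ae_measurable_field A"
  unfolding hs_field_def ae_measurable_field_def measurable_operator_field_def hilbert_schmidt_def
  by (intro conjI ballI)
     (simp add: eventually_conj_iff, rule_tac x="\<lambda>\<omega>. L2_inner lebesgue (A \<omega> f) g" in bexI, simp_all)

lemma fourier_L1_ae_measurable:
  assumes s: "s \<in> L2N" "integrable lebesgue s"
  shows "ae_measurable_field (fourier_L1 s)"
  unfolding ae_measurable_field_def
proof (intro conjI ballI)
  show "AE \<omega> in lebesgue_on Lam. bounded_operator (fourier_L1 s \<omega>)"
    using fourier_L1_bounded_operator[OF s] by simp
  obtain s' where s': "s' \<in> borel_measurable borel" "s' \<in> L2 lborel" "integrable lborel s'"
    "AE x in lebesgue. s x = s' x" using L1_L2_borel_representative[OF s] .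
  note [measurable] = s'(1)
  fix f g assume f: "f \<in> L2R" and g: "g \<in> L2R"
  obtain f' where f': "f' \<in> borel_measurable borel" "AE x in lebesgue. f x = f' x"
    using L2_lebesgue_borel_representative[OF f] by metis
  obtain g' where g': "g' \<in> borel_measurable borel" "g' \<in> L2R" "AE x in lebesgue. g x = g' x"
    using L2_lebesgue_borel_representative[OF g] by metis
  note [measurable] = f'(1) g'(1)
  let ?c = "\<lambda>\<omega>. LINT t|lborel. (LINT x|lborel. s' x * schrodinger_rep \<omega> x f' t) * cnj (g' t)"
  have "L2_inner lebesgue (fourier_L1 s \<omega> f) g = ?c \<omega>" for \<omega>
  proof -
    have eq: "fourier_L1 s \<omega> f = (\<lambda>t. LINT x|lborel. s' x * schrodinger_rep \<omega> x f' t)"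
      by (rule ext, rule fourier_L1_cong_AE[OF s'(4,1) f'(2,1)])
    have "L2_inner lebesgue (fourier_L1 s \<omega> f) g = L2_inner lebesgue (fourier_L1 s \<omega> f) g'"
      using g'(3) by (intro L2_inner_cong_AE L2_measurable[OF g] L2_measurable[OF g'(2)]
        L2_measurable[OF bounded_operator_L2[OF fourier_L1_bounded_operator[OF s] f]]) auto
    also have "\<dots> = ?c \<omega>"
      unfolding L2_inner_def eq by (rule integral_completion) measurable
    finally show ?thesis .
  qed
  moreover have "?c \<in> borel_measurable (lebesgue_on Lam)"
    unfolding schrodinger_rep_apply by (rule borel_imp_lebesgue_on_Lam) measurable
  ultimately show "\<exists>c\<in>borel_measurable (lebesgue_on Lam).
      AE \<omega> in lebesgue_on Lam. L2_inner lebesgue (fourier_L1 s \<omega> f) g = c \<omega>"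
    by (intro bexI[of _ ?c]) simp_all
qed

lemma bounded_operator_sub:
  assumes A: "bounded_operator A" and B: "bounded_operator B"
  shows "bounded_operator (\<lambda>f t. A f t - B f t)"
proof -
  obtain C where C: "C \<ge> 0" "\<And>f. f \<in> L2R \<Longrightarrow> L2_norm lebesgue (A f) \<le> C * L2_norm lebesgue f"
    using bounded_operator_bound[OF A] by blast
  obtain D where D: "D \<ge> 0" "\<And>f. f \<in> L2R \<Longrightarrow> L2_norm lebesgue (B f) \<le> D * L2_norm lebesgue f"
    using bounded_operator_bound[OF B] by blast
  have "L2_norm lebesgue (\<lambda>t. A f t - B f t) \<le> (C + D) * L2_norm lebesgue f" if "f \<in> L2R" for f
    using L2_norm_triangle_sub[OF bounded_operator_L2[OF A that] bounded_operator_L2[OF B that]] C(2)[OF that] D(2)[OF that]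
    by (simp add: distrib_right)
  moreover have "AE t in lebesgue. A (\<lambda>s. a * f s + b * g s) t - B (\<lambda>s. a * f s + b * g s) t =
      a * (A f t - B f t) + b * (A g t - B g t)" if "f \<in> L2R" "g \<in> L2R" for a b f g
    using bounded_operator_linear[OF A that, of a b] bounded_operator_linear[OF B that, of a b]
    by eventually_elim (simp add: algebra_simps)
  moreover have "(\<lambda>t. A f t - B f t) \<in> L2R" if "f \<in> L2R" for f
    by (intro L2_diff bounded_operator_L2[OF A that] bounded_operator_L2[OF B that])
  ultimately show ?thesis unfolding bounded_operator_def by blast
qed

lemma ae_measurable_field_diff:
  assumes A: "ae_measurable_field A" and B: "ae_measurable_field B"
  shows "ae_measurable_field (\<lambda>\<omega> f t. A \<omega> f t - B \<omega> f t)"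
  unfolding ae_measurable_field_def
proof (intro conjI ballI)
  have bA: "AE \<omega> in lebesgue_on Lam. bounded_operator (A \<omega>)" and bB: "AE \<omega> in lebesgue_on Lam. bounded_operator (B \<omega>)"
    using A B by (auto simp: ae_measurable_field_def)
  then show "AE \<omega> in lebesgue_on Lam. bounded_operator (\<lambda>f t. A \<omega> f t - B \<omega> f t)"
    by eventually_elim (rule bounded_operator_sub)
  fix f g assume f: "f \<in> L2R" and g: "g \<in> L2R"
  obtain c where c: "c \<in> borel_measurable (lebesgue_on Lam)" "AE \<omega> in lebesgue_on Lam. L2_inner lebesgue (A \<omega> f) g = c \<omega>"
    using A f g unfolding ae_measurable_field_def by blast
  obtain d where d: "d \<in> borel_measurable (lebesgue_on Lam)" "AE \<omega> in lebesgue_on Lam. L2_inner lebesgue (B \<omega> f) g = d \<omega>"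
    using B f g unfolding ae_measurable_field_def by blast
  have "AE \<omega> in lebesgue_on Lam. L2_inner lebesgue (\<lambda>t. A \<omega> f t - B \<omega> f t) g = c \<omega> - d \<omega>"
    using bA bB c(2) d(2)
    by eventually_elim (use f g in \<open>simp add: L2_inner_diff_left bounded_operator_L2\<close>)
  moreover have "(\<lambda>\<omega>. c \<omega> - d \<omega>) \<in> borel_measurable (lebesgue_on Lam)" using c(1) d(1) by measurable
  ultimately show "\<exists>c\<in>borel_measurable (lebesgue_on Lam).
      AE \<omega> in lebesgue_on Lam. L2_inner lebesgue (\<lambda>t. A \<omega> f t - B \<omega> f t) g = c \<omega>"
    by (intro bexI[of _ "\<lambda>\<omega>. c \<omega> - d \<omega>"])
qed

text \<open>By Parseval's identity the Hilbert--Schmidt norm is a countable sum over matrix coefficients, each of which is measurable.\<close>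

lemma hs_norm_sq_ae_measurable:
  assumes B: "ae_measurable_field B"
  obtains h where "h \<in> borel_measurable (lebesgue_on Lam)" "AE \<omega> in lebesgue_on Lam. hs_norm_sq (B \<omega>) = h \<omega>"
proof -
  define P where "P n m c \<longleftrightarrow> c \<in> borel_measurable (lebesgue_on Lam) \<and>
      (AE \<omega> in lebesgue_on Lam. L2_inner lebesgue (B \<omega> (std_basis n)) (std_basis m) = c \<omega>)" for n m c
  define c where "c n m = (SOME c. P n m c)" for n m
  have "\<exists>c. P n m c" for n m
    using B std_basis_L2 unfolding ae_measurable_field_def P_def by blast
  then have "P n m (c n m)" for n m unfolding c_def by (rule someI_ex)
  then have c: "\<And>n m. c n m \<in> borel_measurable (lebesgue_on Lam)"
    "\<And>n m. AE \<omega> in lebesgue_on Lam. L2_inner lebesgue (B \<omega> (std_basis n)) (std_basis m) = c n m \<omega>"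
    by (simp_all add: P_def)
  note [measurable] = c(1)
  have all: "AE \<omega> in lebesgue_on Lam. \<forall>n m. L2_inner lebesgue (B \<omega> (std_basis n)) (std_basis m) = c n m \<omega>"
    unfolding AE_all_countable using c(2) by blast
  have "AE \<omega> in lebesgue_on Lam. bounded_operator (B \<omega>)" using B by (simp add: ae_measurable_field_def)
  with all have "AE \<omega> in lebesgue_on Lam. hs_norm_sq (B \<omega>) = (\<Sum>n. \<Sum>m. ennreal ((cmod (c n m \<omega>))\<^sup>2))"
  proof eventually_elim
    case (elim \<omega>)
    show ?case unfolding hs_norm_sq_eq
      using orthonormal_basis_Parseval[OF std_basis bounded_operator_L2[OF elim(2) std_basis_L2], symmetric] elim(1)
      by simp
  qed
  moreover have "(\<lambda>\<omega>. \<Sum>n. \<Sum>m. ennreal ((cmod (c n m \<omega>))\<^sup>2)) \<in> borel_measurable (lebesgue_on Lam)" by measurable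
  ultimately show ?thesis by (rule that[rotated])
qed

lemma field_norm_sq_cong:
  assumes "AE \<omega> in lebesgue_on Lam. \<forall>n. L2_norm lebesgue (A \<omega> (std_basis n)) = L2_norm lebesgue (B \<omega> (std_basis n))"
  shows "field_norm_sq A = field_norm_sq B"
  unfolding field_norm_sq_def hs_norm_sq_eq
  by (rule nn_integral_cong_AE) (use assms in \<open>eventually_elim, simp\<close>)

lemma field_norm_sq_minus_commute:
  "field_norm_sq (\<lambda>\<omega> f t. A \<omega> f t - B \<omega> f t) = field_norm_sq (\<lambda>\<omega> f t. B \<omega> f t - A \<omega> f t)"
  by (rule field_norm_sq_cong, rule AE_I2, rule allI, rule L2_norm_minus_commute)

lemma weighted_square_sum_le:
  fixes a b d :: real
  assumes "d > 0"
  shows "(a + b)\<^sup>2 \<le> (1 + d) * a\<^sup>2 + (1 + 1 / d) * b\<^sup>2"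
proof -
  have "0 \<le> (d * a - b)\<^sup>2 / d" using assms by simp
  also have "\<dots> = (1 + d) * a\<^sup>2 + (1 + 1 / d) * b\<^sup>2 - (a + b)\<^sup>2"
    using assms by (simp add: field_simps power2_eq_square)
  finally show ?thesis by simp
qed

text \<open>This form of the triangle inequality is linear in the squared norms, hence survives integration over the
frequency. Where \<open>B\<close> tends to \<open>0\<close>, the parameter \<open>d\<close> may tend to \<open>0\<close> afterwards.\<close>

lemma field_norm_sq_triangle:
  assumes A: "ae_measurable_field A" and B: "ae_measurable_field B" and d: "d > 0"
  shows "field_norm_sq (\<lambda>\<omega> f t. A \<omega> f t + B \<omega> f t) \<le>
    ennreal (1 + d) * field_norm_sq A + ennreal (1 + 1 / d) * field_norm_sq B"
proof -
  obtain h where [measurable]: "h \<in> borel_measurable (lebesgue_on Lam)" and h: "AE \<omega> in lebesgue_on Lam. hs_norm_sq (A \<omega>) = h \<omega>"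
    using hs_norm_sq_ae_measurable[OF A] .
  obtain k where [measurable]: "k \<in> borel_measurable (lebesgue_on Lam)" and k: "AE \<omega> in lebesgue_on Lam. hs_norm_sq (B \<omega>) = k \<omega>"
    using hs_norm_sq_ae_measurable[OF B] .
  have [measurable]: "(\<lambda>\<omega>. ennreal \<bar>\<omega>\<bar>) \<in> borel_measurable (lebesgue_on Lam)"
    by (rule borel_imp_lebesgue_on_Lam) measurable
  have bA: "AE \<omega> in lebesgue_on Lam. bounded_operator (A \<omega>)" and bB: "AE \<omega> in lebesgue_on Lam. bounded_operator (B \<omega>)"
    using A B by (auto simp: ae_measurable_field_def)
  have le: "AE \<omega> in lebesgue_on Lam. hs_norm_sq (\<lambda>f t. A \<omega> f t + B \<omega> f t) \<le> ennreal (1 + d) * h \<omega> + ennreal (1 + 1 / d) * k \<omega>"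
    using bA bB h k
  proof eventually_elim
    case (elim \<omega>)
    have "ennreal ((L2_norm lebesgue (\<lambda>t. A \<omega> (std_basis n) t + B \<omega> (std_basis n) t))\<^sup>2) \<le>
        ennreal (1 + d) * ennreal ((L2_norm lebesgue (A \<omega> (std_basis n)))\<^sup>2) +
        ennreal (1 + 1 / d) * ennreal ((L2_norm lebesgue (B \<omega> (std_basis n)))\<^sup>2)" for n
    proof -
      let ?a = "L2_norm lebesgue (A \<omega> (std_basis n))" and ?b = "L2_norm lebesgue (B \<omega> (std_basis n))"
      have "(L2_norm lebesgue (\<lambda>t. A \<omega> (std_basis n) t + B \<omega> (std_basis n) t))\<^sup>2 \<le> (?a + ?b)\<^sup>2"
        by (intro power_mono L2_norm_triangle bounded_operator_L2[OF elim(1)] bounded_operator_L2[OF elim(2)] std_basis_L2) auto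
      also have "\<dots> \<le> (1 + d) * ?a\<^sup>2 + (1 + 1 / d) * ?b\<^sup>2" by (rule weighted_square_sum_le[OF d])
      finally have "ennreal ((L2_norm lebesgue (\<lambda>t. A \<omega> (std_basis n) t + B \<omega> (std_basis n) t))\<^sup>2) \<le>
          ennreal ((1 + d) * ?a\<^sup>2 + (1 + 1 / d) * ?b\<^sup>2)" by (rule ennreal_leI)
      then show ?thesis using d by (simp add: ennreal_mult)
    qed
    then have "hs_norm_sq (\<lambda>f t. A \<omega> f t + B \<omega> f t) \<le> (\<Sum>n. ennreal (1 + d) * ennreal ((L2_norm lebesgue (A \<omega> (std_basis n)))\<^sup>2) +
        ennreal (1 + 1 / d) * ennreal ((L2_norm lebesgue (B \<omega> (std_basis n)))\<^sup>2))"
      unfolding hs_norm_sq_eq by (intro suminf_le) auto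
    also have "\<dots> = ennreal (1 + d) * hs_norm_sq (A \<omega>) + ennreal (1 + 1 / d) * hs_norm_sq (B \<omega>)"
      unfolding hs_norm_sq_eq by (simp add: suminf_add[symmetric] ennreal_suminf_cmult)
    finally show ?case using elim by simp
  qed
  have "field_norm_sq (\<lambda>\<omega> f t. A \<omega> f t + B \<omega> f t) \<le>
      (\<integral>\<^sup>+\<omega>. ennreal \<bar>\<omega>\<bar> * (ennreal (1 + d) * h \<omega> + ennreal (1 + 1 / d) * k \<omega>) \<partial>lebesgue_on Lam)"
    unfolding field_norm_sq_def
    by (rule nn_integral_mono_AE) (use le in \<open>eventually_elim, auto intro: mult_left_mono\<close>)
  also have "\<dots> = (\<integral>\<^sup>+\<omega>. ennreal (1 + d) * (ennreal \<bar>\<omega>\<bar> * h \<omega>) + ennreal (1 + 1 / d) * (ennreal \<bar>\<omega>\<bar> * k \<omega>) \<partial>lebesgue_on Lam)"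
    by (simp add: distrib_left mult_ac)
  also have "\<dots> = ennreal (1 + d) * (\<integral>\<^sup>+\<omega>. ennreal \<bar>\<omega>\<bar> * h \<omega> \<partial>lebesgue_on Lam) +
      ennreal (1 + 1 / d) * (\<integral>\<^sup>+\<omega>. ennreal \<bar>\<omega>\<bar> * k \<omega> \<partial>lebesgue_on Lam)"
    by (subst nn_integral_add) (auto simp: nn_integral_cmult)
  also have "(\<integral>\<^sup>+\<omega>. ennreal \<bar>\<omega>\<bar> * h \<omega> \<partial>lebesgue_on Lam) = field_norm_sq A"
    unfolding field_norm_sq_def by (rule nn_integral_cong_AE) (use h in \<open>eventually_elim, simp\<close>)
  also have "(\<integral>\<^sup>+\<omega>. ennreal \<bar>\<omega>\<bar> * k \<omega> \<partial>lebesgue_on Lam) = field_norm_sq B"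
    unfolding field_norm_sq_def by (rule nn_integral_cong_AE) (use k in \<open>eventually_elim, simp\<close>)
  finally show ?thesis .
qed

lemma field_norm_sq_fourier_L1_diff:
  assumes s: "s \<in> L2N" "integrable lebesgue s" and r: "r \<in> L2N" "integrable lebesgue r"
  shows "field_norm_sq (\<lambda>\<omega> f t. fourier_L1 s \<omega> f t - fourier_L1 r \<omega> f t) = ennreal ((L2_norm lebesgue (\<lambda>x. s x - r x))\<^sup>2)"
proof -
  have sr: "(\<lambda>x. s x - r x) \<in> L2N" "integrable lebesgue (\<lambda>x. s x - r x)"
    using s r by (auto intro: L2_diff)
  have "L2_norm lebesgue (\<lambda>t. fourier_L1 s \<omega> (std_basis n) t - fourier_L1 r \<omega> (std_basis n) t) =
      L2_norm lebesgue (fourier_L1 (\<lambda>x. s x - r x) \<omega> (std_basis n))" for \<omega> n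
  proof (rule L2_norm_cong_AE)
    show "AE t in lebesgue. fourier_L1 s \<omega> (std_basis n) t - fourier_L1 r \<omega> (std_basis n) t = fourier_L1 (\<lambda>x. s x - r x) \<omega> (std_basis n) t"
      using fourier_L1_linear[OF s r std_basis_L2, of 1 "-1" \<omega> n] by eventually_elim simp
  qed (intro L2_measurable L2_diff bounded_operator_L2[OF fourier_L1_bounded_operator[OF s]]
        bounded_operator_L2[OF fourier_L1_bounded_operator[OF r]]
        bounded_operator_L2[OF fourier_L1_bounded_operator[OF sr]] std_basis_L2)+
  then have "field_norm_sq (\<lambda>\<omega> f t. fourier_L1 s \<omega> f t - fourier_L1 r \<omega> f t) = field_norm_sq (fourier_L1 (\<lambda>x. s x - r x))"
    by (intro field_norm_sq_cong) simp
  then show ?thesis using Plancherel_heis[OF sr] by simp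
qed

lemma ennreal_le_scale_limit:
  assumes "\<And>d. d > 0 \<Longrightarrow> x \<le> ennreal (1 + d) * y" and y: "y < \<infinity>"
  shows "x \<le> y"
proof (rule ennreal_le_epsilon)
  fix e :: real assume e: "e > 0"
  obtain z where z: "y = ennreal z" "z \<ge> 0" using y by (cases y) auto
  define d where "d = e / (z + 1)"
  have d: "d > 0" using e z by (simp add: d_def)
  have "x \<le> ennreal (1 + d) * ennreal z" using assms(1)[OF d] z by simp
  also have "\<dots> = ennreal ((1 + d) * z)" using d z by (simp add: ennreal_mult)
  also have "\<dots> \<le> ennreal (z + e)"
  proof (rule ennreal_leI)
    have "d * z \<le> e" using e z by (simp add: d_def field_simps)
    then show "(1 + d) * z \<le> z + e" by (simp add: distrib_right)
  qed
  finally show "x \<le> y + ennreal e" using z e by simp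
qed

text \<open>Plancherel's theorem holds along the approximating sequence, and the triangle inequality in both directions transfers it
to the limit.\<close>

theorem fourier_isometry:
  assumes "is_fourier \<phi> A"
  shows "field_norm_sq A = ennreal ((L2_norm lebesgue \<phi>)\<^sup>2)"
proof -
  from assms have \<phi>: "\<phi> \<in> L2N" and hA: "hs_field A" by (auto simp: is_fourier_def)
  from assms obtain s where s: "\<And>n. s n \<in> L2N" "\<And>n. integrable lebesgue (s n)"
    "L2_lim lebesgue s \<phi>"
    "(\<lambda>n. field_norm_sq (\<lambda>\<omega> f t. fourier_L1 (s n) \<omega> f t - A \<omega> f t)) \<longlonglongrightarrow> 0"
    by (auto simp: is_fourier_def)
  have finA: "field_norm_sq A < \<infinity>" using hA unfolding hs_field_def by (elim conjE)
  have mA: "ae_measurable_field A" using hA by (rule hs_field_ae_measurable)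
  have mF: "ae_measurable_field (fourier_L1 (s n))" for n using s by (intro fourier_L1_ae_measurable)
  have lim: "(\<lambda>n. field_norm_sq (fourier_L1 (s n))) \<longlonglongrightarrow> ennreal ((L2_norm lebesgue \<phi>)\<^sup>2)"
    unfolding Plancherel_heis[OF s(1,2)] by (intro tendsto_intros L2_norm_tendsto[OF s(1) \<phi> s(3)])
  have "field_norm_sq A \<le> ennreal (1 + d) * ennreal ((L2_norm lebesgue \<phi>)\<^sup>2)" if d: "d > 0" for d
  proof -
    have "(\<lambda>n. ennreal (1 + d) * field_norm_sq (fourier_L1 (s n)) +
        ennreal (1 + 1 / d) * field_norm_sq (\<lambda>\<omega> f t. fourier_L1 (s n) \<omega> f t - A \<omega> f t))
      \<longlonglongrightarrow> ennreal (1 + d) * ennreal ((L2_norm lebesgue \<phi>)\<^sup>2) + ennreal (1 + 1 / d) * 0"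
      by (intro tendsto_add ennreal_tendsto_cmult lim s(4)) auto
    then have "field_norm_sq A \<le> ennreal (1 + d) * ennreal ((L2_norm lebesgue \<phi>)\<^sup>2) + ennreal (1 + 1 / d) * 0"
    proof (rule tendsto_lowerbound)
      show "\<forall>\<^sub>F n in sequentially. field_norm_sq A \<le> ennreal (1 + d) * field_norm_sq (fourier_L1 (s n)) +
        ennreal (1 + 1 / d) * field_norm_sq (\<lambda>\<omega> f t. fourier_L1 (s n) \<omega> f t - A \<omega> f t)"
      proof (rule always_eventually, rule allI)
        fix n
        show "field_norm_sq A \<le> ennreal (1 + d) * field_norm_sq (fourier_L1 (s n)) +
          ennreal (1 + 1 / d) * field_norm_sq (\<lambda>\<omega> f t. fourier_L1 (s n) \<omega> f t - A \<omega> f t)"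
          using field_norm_sq_triangle[OF mF[of n] ae_measurable_field_diff[OF mA mF[of n]] d]
          by (simp add: field_norm_sq_minus_commute[of A])
      qed
    qed simp
    then show ?thesis by simp
  qed
  then have le: "field_norm_sq A \<le> ennreal ((L2_norm lebesgue \<phi>)\<^sup>2)" by (rule ennreal_le_scale_limit) auto
  have "ennreal ((L2_norm lebesgue \<phi>)\<^sup>2) \<le> ennreal (1 + d) * field_norm_sq A" if d: "d > 0" for d
  proof -
    have "(\<lambda>n. ennreal (1 + d) * field_norm_sq A +
        ennreal (1 + 1 / d) * field_norm_sq (\<lambda>\<omega> f t. fourier_L1 (s n) \<omega> f t - A \<omega> f t))
      \<longlonglongrightarrow> ennreal (1 + d) * field_norm_sq A + ennreal (1 + 1 / d) * 0"
      by (intro tendsto_add ennreal_tendsto_cmult tendsto_const s(4)) auto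
    then have "ennreal ((L2_norm lebesgue \<phi>)\<^sup>2) \<le> ennreal (1 + d) * field_norm_sq A + ennreal (1 + 1 / d) * 0"
    proof (rule tendsto_le[OF sequentially_bot _ lim])
      show "\<forall>\<^sub>F n in sequentially. field_norm_sq (fourier_L1 (s n)) \<le> ennreal (1 + d) * field_norm_sq A +
        ennreal (1 + 1 / d) * field_norm_sq (\<lambda>\<omega> f t. fourier_L1 (s n) \<omega> f t - A \<omega> f t)"
        using field_norm_sq_triangle[OF mA ae_measurable_field_diff[OF mF mA] d] by simp
    qed
    then show ?thesis by simp
  qed
  then have "ennreal ((L2_norm lebesgue \<phi>)\<^sup>2) \<le> field_norm_sq A"
    using finA by (rule ennreal_le_scale_limit)
  with le show ?thesis by (rule antisym)
qed

definition L1_approx :: "(nat \<Rightarrow> heis \<Rightarrow> complex) \<Rightarrow> (heis \<Rightarrow> complex) \<Rightarrow> bool" where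
  "L1_approx s \<phi> \<longleftrightarrow> (\<forall>n. s n \<in> L2N \<and> integrable lebesgue (s n)) \<and> L2_lim lebesgue s \<phi>"

definition fourier_limit :: "(nat \<Rightarrow> heis \<Rightarrow> complex) \<Rightarrow> (real \<Rightarrow> operator) \<Rightarrow> real \<Rightarrow> bool" where
  "fourier_limit s A \<omega> \<longleftrightarrow> bounded_operator (A \<omega>) \<and>
     (\<forall>f\<in>L2R. L2_lim lebesgue (\<lambda>n. fourier_L1 (s n) \<omega> f) (A \<omega> f))"

lemma L1_approxD:
  assumes "L1_approx s \<phi>"
  shows "s n \<in> L2N" "integrable lebesgue (s n)" "L2_lim lebesgue s \<phi>"
  using assms by (auto simp: L1_approx_def)

lemma L1_approx_subseq: "L1_approx s \<phi> \<Longrightarrow> strict_mono \<sigma> \<Longrightarrow> L1_approx (\<lambda>n. s (\<sigma> n)) \<phi>"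
  unfolding L1_approx_def by (auto dest: LIMSEQ_subseq_LIMSEQ simp: o_def)

lemma fourier_limit_subseq: "fourier_limit s A \<omega> \<Longrightarrow> strict_mono \<sigma> \<Longrightarrow> fourier_limit (\<lambda>n. s (\<sigma> n)) A \<omega>"
  unfolding fourier_limit_def by (auto dest!: bspec dest: LIMSEQ_subseq_LIMSEQ simp: o_def)

lemma fourier_limitD:
  assumes "fourier_limit s A \<omega>" and f: "f \<in> L2R"
  shows "bounded_operator (A \<omega>)" "A \<omega> f \<in> L2R" "L2_lim lebesgue (\<lambda>n. fourier_L1 (s n) \<omega> f) (A \<omega> f)"
  using assms bounded_operator_L2[OF _ f, of "A \<omega>"] by (auto simp: fourier_limit_def)

lemma fourier_L1_L2: "s \<in> L2N \<Longrightarrow> integrable lebesgue s \<Longrightarrow> f \<in> L2R \<Longrightarrow> fourier_L1 s \<omega> f \<in> L2R"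
  by (rule bounded_operator_L2[OF fourier_L1_bounded_operator])

text \<open>The Fourier transforms of any approximation of \<open>\<phi>\<close> converge to \<open>A\<close> in the norm of fields, since they are close to those
of the approximation that defines \<open>A\<close>. A subsequence converges in Hilbert--Schmidt norm at almost every frequency, and
this norm dominates the operator norm. Identities between Fourier transforms thereby reduce to identities for
integrable functions.\<close>

lemma fourier_pointwise:
  assumes A: "is_fourier \<phi> A" and r: "L1_approx r \<phi>"
  obtains \<sigma> :: "nat \<Rightarrow> nat" where "strict_mono \<sigma>" "AE \<omega> in lborel. fourier_limit (\<lambda>n. r (\<sigma> n)) A \<omega>"
proof -
  from A have \<phi>: "\<phi> \<in> L2N" and hA: "hs_field A" by (auto simp: is_fourier_def)
  note r = L1_approxD[OF r]
  from A obtain s where s: "\<And>n. s n \<in> L2N" "\<And>n. integrable lebesgue (s n)"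
    "L2_lim lebesgue s \<phi>"
    "(\<lambda>n. field_norm_sq (\<lambda>\<omega> f t. fourier_L1 (s n) \<omega> f t - A \<omega> f t)) \<longlonglongrightarrow> 0"
    by (auto simp: is_fourier_def)
  have mA: "ae_measurable_field A" using hA by (rule hs_field_ae_measurable)
  have mF: "ae_measurable_field (fourier_L1 (s n))" for n using s by (intro fourier_L1_ae_measurable)
  have mR: "ae_measurable_field (fourier_L1 (r n))" for n using r by (intro fourier_L1_ae_measurable)
  define D where "D n = (\<lambda>\<omega> f t. fourier_L1 (r n) \<omega> f t - A \<omega> f t)" for n
  have mD: "ae_measurable_field (D n)" for n unfolding D_def by (rule ae_measurable_field_diff[OF mR mA])
  have rs: "(\<lambda>n. L2_norm lebesgue (\<lambda>x. r n x - s n x)) \<longlonglongrightarrow> 0"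
  proof (rule tendsto_sandwich[OF _ _ tendsto_const])
    show "(\<lambda>n. L2_norm lebesgue (\<lambda>x. r n x - \<phi> x) + L2_norm lebesgue (\<lambda>x. s n x - \<phi> x)) \<longlonglongrightarrow> 0"
      using tendsto_add[OF r(3) s(3)] by simp
    show "\<forall>\<^sub>F n in sequentially. L2_norm lebesgue (\<lambda>x. r n x - s n x) \<le>
        L2_norm lebesgue (\<lambda>x. r n x - \<phi> x) + L2_norm lebesgue (\<lambda>x. s n x - \<phi> x)"
      using L2_norm_triangle3[OF r(1) \<phi> s(1)] L2_norm_minus_commute[of lebesgue \<phi>] by simp
  qed simp
  have "(\<lambda>n. field_norm_sq (D n)) \<longlonglongrightarrow> 0"
  proof (rule tendsto_sandwich[OF _ _ tendsto_const])
    have "(\<lambda>n. ennreal (1 + 1) * ennreal ((L2_norm lebesgue (\<lambda>x. r n x - s n x))\<^sup>2) +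
        ennreal (1 + 1 / 1) * field_norm_sq (\<lambda>\<omega> f t. fourier_L1 (s n) \<omega> f t - A \<omega> f t))
      \<longlonglongrightarrow> ennreal (1 + 1) * ennreal (0\<^sup>2) + ennreal (1 + 1 / 1) * 0"
      by (intro tendsto_add ennreal_tendsto_cmult tendsto_ennrealI tendsto_power rs s(4)) auto
    then show "(\<lambda>n. ennreal (1 + 1) * ennreal ((L2_norm lebesgue (\<lambda>x. r n x - s n x))\<^sup>2) +
        ennreal (1 + 1 / 1) * field_norm_sq (\<lambda>\<omega> f t. fourier_L1 (s n) \<omega> f t - A \<omega> f t)) \<longlonglongrightarrow> 0" by simp
    show "\<forall>\<^sub>F n in sequentially. field_norm_sq (D n) \<le> ennreal (1 + 1) * ennreal ((L2_norm lebesgue (\<lambda>x. r n x - s n x))\<^sup>2) +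
        ennreal (1 + 1 / 1) * field_norm_sq (\<lambda>\<omega> f t. fourier_L1 (s n) \<omega> f t - A \<omega> f t)"
    proof (rule always_eventually, rule allI)
      fix n
      show "field_norm_sq (D n) \<le> ennreal (1 + 1) * ennreal ((L2_norm lebesgue (\<lambda>x. r n x - s n x))\<^sup>2) +
        ennreal (1 + 1 / 1) * field_norm_sq (\<lambda>\<omega> f t. fourier_L1 (s n) \<omega> f t - A \<omega> f t)"
        using field_norm_sq_triangle[OF ae_measurable_field_diff[OF mR[of n] mF[of n]] ae_measurable_field_diff[OF mF[of n] mA], of 1]
        unfolding field_norm_sq_fourier_L1_diff[OF r(1,2) s(1,2)] by (simp add: D_def)
    qed
  qed simp
  note field_lim = this
  define P where "P n h \<longleftrightarrow> h \<in> borel_measurable (lebesgue_on Lam) \<and>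
      (AE \<omega> in lebesgue_on Lam. hs_norm_sq (D n \<omega>) = h \<omega>)" for n h
  define h where "h n = (SOME h. P n h)" for n
  have "\<exists>h. P n h" for n unfolding P_def by (rule hs_norm_sq_ae_measurable[OF mD[of n]]) blast
  then have "P n (h n)" for n unfolding h_def by (rule someI_ex)
  then have hm [measurable]: "\<And>n. h n \<in> borel_measurable (lebesgue_on Lam)"
    and h: "\<And>n. AE \<omega> in lebesgue_on Lam. hs_norm_sq (D n \<omega>) = h n \<omega>" by (simp_all add: P_def)
  have "field_norm_sq (D n) = (\<integral>\<^sup>+\<omega>. ennreal \<bar>\<omega>\<bar> * h n \<omega> \<partial>lebesgue_on Lam)" for n
    unfolding field_norm_sq_def by (rule nn_integral_cong_AE) (use h[of n] in \<open>eventually_elim, simp\<close>)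
  with field_lim have "(\<lambda>n. \<integral>\<^sup>+\<omega>. ennreal \<bar>\<omega>\<bar> * h n \<omega> \<partial>lebesgue_on Lam) \<longlonglongrightarrow> 0" by simp
  moreover have "(\<lambda>\<omega>. ennreal \<bar>\<omega>\<bar> * h n \<omega>) \<in> borel_measurable (lebesgue_on Lam)" for n
  proof -
    have [measurable]: "(\<lambda>\<omega>. ennreal \<bar>\<omega>\<bar>) \<in> borel_measurable (lebesgue_on Lam)"
      by (rule borel_imp_lebesgue_on_Lam) measurable
    show ?thesis by measurable
  qed
  ultimately obtain \<sigma> :: "nat \<Rightarrow> nat" where \<sigma>: "strict_mono \<sigma>"
    "AE \<omega> in lebesgue_on Lam. (\<lambda>n. ennreal \<bar>\<omega>\<bar> * h (\<sigma> n) \<omega>) \<longlonglongrightarrow> 0"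
    using nn_integral_tendsto_0_AE_subseq[of "\<lambda>n \<omega>. ennreal \<bar>\<omega>\<bar> * h n \<omega>" "lebesgue_on Lam"] by blast
  have bA: "AE \<omega> in lebesgue_on Lam. bounded_operator (A \<omega>)" using mA by (simp add: ae_measurable_field_def)
  have hall: "AE \<omega> in lebesgue_on Lam. \<forall>n. hs_norm_sq (D n \<omega>) = h n \<omega>"
    unfolding AE_all_countable using h by blast
  have nz: "AE \<omega> in lebesgue_on Lam. \<omega> \<noteq> 0" by (simp add: AE_lebesgue_on_Lam AE_lborel_singleton)
  have "AE \<omega> in lebesgue_on Lam. fourier_limit (\<lambda>n. r (\<sigma> n)) A \<omega>"
    using \<sigma>(2) bA hall nz
  proof eventually_elim
    case (elim \<omega>)
    have "(\<lambda>n. ennreal (1 / \<bar>\<omega>\<bar>) * (ennreal \<bar>\<omega>\<bar> * h (\<sigma> n) \<omega>)) \<longlonglongrightarrow> ennreal (1 / \<bar>\<omega>\<bar>) * 0"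
      by (intro ennreal_tendsto_cmult elim) auto
    moreover have "ennreal (1 / \<bar>\<omega>\<bar>) * (ennreal \<bar>\<omega>\<bar> * z) = z" for z
      using elim by (simp add: mult.assoc[symmetric] ennreal_mult[symmetric])
    ultimately have hlim: "(\<lambda>n. hs_norm_sq (D (\<sigma> n) \<omega>)) \<longlonglongrightarrow> 0" using elim by simp
    have bD: "bounded_operator (D n \<omega>)" for n
      unfolding D_def using elim r by (intro bounded_operator_sub fourier_L1_bounded_operator) auto
    have "(\<lambda>n. L2_norm lebesgue (D (\<sigma> n) \<omega> f)) \<longlonglongrightarrow> 0" if f: "f \<in> L2R" for f
    proof -
      have "(\<lambda>n. ennreal ((L2_norm lebesgue f)\<^sup>2) * hs_norm_sq (D (\<sigma> n) \<omega>)) \<longlonglongrightarrow> ennreal ((L2_norm lebesgue f)\<^sup>2) * 0"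
        by (intro ennreal_tendsto_cmult hlim) auto
      then have up: "(\<lambda>n. hs_norm_sq (D (\<sigma> n) \<omega>) * ennreal ((L2_norm lebesgue f)\<^sup>2)) \<longlonglongrightarrow> 0"
        by (simp add: mult.commute)
      have "(\<lambda>n. ennreal ((L2_norm lebesgue (D (\<sigma> n) \<omega> f))\<^sup>2)) \<longlonglongrightarrow> 0"
        by (rule tendsto_sandwich[OF _ _ tendsto_const up])
           (intro always_eventually allI zero_le operator_norm_le_hs_norm[OF bD f])+
      then have "(\<lambda>n. (L2_norm lebesgue (D (\<sigma> n) \<omega> f))\<^sup>2) \<longlonglongrightarrow> 0"
        by (subst (asm) ennreal_0[symmetric], subst (asm) tendsto_ennreal_iff) auto
      then have "(\<lambda>n. sqrt ((L2_norm lebesgue (D (\<sigma> n) \<omega> f))\<^sup>2)) \<longlonglongrightarrow> sqrt 0" by (rule tendsto_real_sqrt)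
      then show ?thesis by simp
    qed
    with elim show ?case by (simp add: D_def fourier_limit_def)
  qed
  then show ?thesis using \<sigma>(1) that by (simp add: AE_lebesgue_on_Lam)
qed

lemma is_fourier_approximation:
  assumes "is_fourier \<phi> A"
  obtains s where "L1_approx s \<phi>"
  using assms unfolding is_fourier_def L1_approx_def by blast

lemma fourier_pointwise2:
  assumes A: "is_fourier \<phi> A" and r: "L1_approx r \<phi>" and B: "is_fourier \<psi> B" and q: "L1_approx q \<psi>"
  obtains \<sigma> :: "nat \<Rightarrow> nat" where "strict_mono \<sigma>" "AE \<omega> in lborel. fourier_limit (\<lambda>n. r (\<sigma> n)) A \<omega>"
    "AE \<omega> in lborel. fourier_limit (\<lambda>n. q (\<sigma> n)) B \<omega>"
proof -
  obtain \<rho> where \<rho>: "strict_mono \<rho>" "AE \<omega> in lborel. fourier_limit (\<lambda>n. r (\<rho> n)) A \<omega>"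
    using fourier_pointwise[OF A r] by blast
  obtain \<tau> where \<tau>: "strict_mono \<tau>" "AE \<omega> in lborel. fourier_limit (\<lambda>n. q (\<rho> (\<tau> n))) B \<omega>"
    using fourier_pointwise[OF B L1_approx_subseq[OF q \<rho>(1)]] by blast
  show ?thesis
  proof (rule that[of "\<lambda>n. \<rho> (\<tau> n)"])
    show "strict_mono (\<lambda>n. \<rho> (\<tau> n))" using strict_mono_o[OF \<rho>(1) \<tau>(1)] by (simp add: o_def)
    show "AE \<omega> in lborel. fourier_limit (\<lambda>n. r (\<rho> (\<tau> n))) A \<omega>"
      using \<rho>(2) by eventually_elim (rule fourier_limit_subseq[OF _ \<tau>(1)])
  qed (rule \<tau>(2))
qed

lemma L2_lim_linear:
  assumes L2: "\<And>n. u n \<in> L2 M" "\<And>n. v n \<in> L2 M" "u' \<in> L2 M" "v' \<in> L2 M"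
    and lim: "L2_lim M u u'" "L2_lim M v v'"
  shows "L2_lim M (\<lambda>n x. a * u n x + b * v n x) (\<lambda>x. a * u' x + b * v' x)"
proof (rule tendsto_sandwich[OF _ _ tendsto_const])
  have "(\<lambda>n. cmod a * L2_norm M (\<lambda>x. u n x - u' x) + cmod b * L2_norm M (\<lambda>x. v n x - v' x)) \<longlonglongrightarrow> cmod a * 0 + cmod b * 0"
    by (intro tendsto_intros lim)
  then show "(\<lambda>n. cmod a * L2_norm M (\<lambda>x. u n x - u' x) + cmod b * L2_norm M (\<lambda>x. v n x - v' x)) \<longlonglongrightarrow> 0" by simp
  have "L2_norm M (\<lambda>x. (a * u n x + b * v n x) - (a * u' x + b * v' x)) \<le>
      cmod a * L2_norm M (\<lambda>x. u n x - u' x) + cmod b * L2_norm M (\<lambda>x. v n x - v' x)" for n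
  proof -
    have "(\<lambda>x. (a * u n x + b * v n x) - (a * u' x + b * v' x)) = (\<lambda>x. a * (u n x - u' x) + b * (v n x - v' x))"
      by (simp add: algebra_simps)
    then show ?thesis
      using L2_norm_triangle[OF L2_scale[OF L2_diff[OF L2(1,3)]] L2_scale[OF L2_diff[OF L2(2,4)]], of a n b n]
      by (simp add: L2_norm_scale)
  qed
  then show "\<forall>\<^sub>F n in sequentially. L2_norm M (\<lambda>x. (a * u n x + b * v n x) - (a * u' x + b * v' x)) \<le>
      cmod a * L2_norm M (\<lambda>x. u n x - u' x) + cmod b * L2_norm M (\<lambda>x. v n x - v' x)" by simp
qed simp

lemma fourier_linear:
  assumes A: "is_fourier \<phi> A" and B: "is_fourier \<psi> B" and C: "is_fourier (\<lambda>x. a * \<phi> x + b * \<psi> x) C"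
  shows "AE \<omega> in lborel. \<forall>f\<in>L2R. AE t in lebesgue. C \<omega> f t = a * A \<omega> f t + b * B \<omega> f t"
proof -
  have \<phi>: "\<phi> \<in> L2N" and \<psi>: "\<psi> \<in> L2N" using A B by (auto simp: is_fourier_def)
  obtain r q where rq: "L1_approx r \<phi>" "L1_approx q \<psi>"
    using is_fourier_approximation[OF A] is_fourier_approximation[OF B] by metis
  obtain \<sigma> where \<sigma>: "strict_mono \<sigma>" "AE \<omega> in lborel. fourier_limit (\<lambda>n. r (\<sigma> n)) A \<omega>"
    "AE \<omega> in lborel. fourier_limit (\<lambda>n. q (\<sigma> n)) B \<omega>"
    using fourier_pointwise2[OF A rq(1) B rq(2)] by blast
  note r = L1_approxD[OF L1_approx_subseq[OF rq(1) \<sigma>(1)]] and q = L1_approxD[OF L1_approx_subseq[OF rq(2) \<sigma>(1)]]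
  define p where "p n = (\<lambda>x. a * r (\<sigma> n) x + b * q (\<sigma> n) x)" for n
  have p: "L1_approx p (\<lambda>x. a * \<phi> x + b * \<psi> x)"
    unfolding L1_approx_def p_def
    using L2_lim_linear[OF r(1) q(1) \<phi> \<psi> r(3) q(3)] L2_add[OF L2_scale[OF r(1)] L2_scale[OF q(1)]] r(2) q(2)
    by simp
  obtain \<tau> where \<tau>: "strict_mono \<tau>" "AE \<omega> in lborel. fourier_limit (\<lambda>n. p (\<tau> n)) C \<omega>"
    using fourier_pointwise[OF C p] by blast
  note p = L1_approxD[OF p]
  have limit: "AE t in lebesgue. C \<omega> f t = a * A \<omega> f t + b * B \<omega> f t"
    if lims: "fourier_limit (\<lambda>n. r (\<sigma> n)) A \<omega>" "fourier_limit (\<lambda>n. q (\<sigma> n)) B \<omega>" "fourier_limit (\<lambda>n. p (\<tau> n)) C \<omega>"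
      and f: "f \<in> L2R" for \<omega> f
  proof -
    note A = fourier_limitD[OF fourier_limit_subseq[OF lims(1) \<tau>(1)] f]
      and B = fourier_limitD[OF fourier_limit_subseq[OF lims(2) \<tau>(1)] f] and C = fourier_limitD[OF lims(3) f]
    note FL = fourier_L1_L2[OF r(1,2) f] fourier_L1_L2[OF q(1,2) f] fourier_L1_L2[OF p(1,2) f]
    have "L2_norm lebesgue (\<lambda>t. (a * fourier_L1 (r (\<sigma> (\<tau> n))) \<omega> f t + b * fourier_L1 (q (\<sigma> (\<tau> n))) \<omega> f t)
        - (a * A \<omega> f t + b * B \<omega> f t)) =
        L2_norm lebesgue (\<lambda>t. fourier_L1 (p (\<tau> n)) \<omega> f t - (a * A \<omega> f t + b * B \<omega> f t))" for n
    proof (rule L2_norm_cong_AE)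
      show "AE t in lebesgue. (a * fourier_L1 (r (\<sigma> (\<tau> n))) \<omega> f t + b * fourier_L1 (q (\<sigma> (\<tau> n))) \<omega> f t)
        - (a * A \<omega> f t + b * B \<omega> f t) = fourier_L1 (p (\<tau> n)) \<omega> f t - (a * A \<omega> f t + b * B \<omega> f t)"
        using fourier_L1_linear[OF r(1,2) q(1,2) f, of a "\<tau> n" b "\<tau> n" \<omega>]
        unfolding p_def by eventually_elim simp
    qed (intro L2_measurable L2_diff L2_add L2_scale FL A(2) B(2))+
    then have "L2_lim lebesgue (\<lambda>n. fourier_L1 (p (\<tau> n)) \<omega> f) (\<lambda>t. a * A \<omega> f t + b * B \<omega> f t)"
      using L2_lim_linear[OF FL(1) FL(2) A(2) B(2) A(3) B(3), of a b] by simp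
    then show ?thesis
      by (intro L2_limit_unique[where s="\<lambda>n. fourier_L1 (p (\<tau> n)) \<omega> f"] FL C(2,3) L2_add L2_scale A(2) B(2))
  qed
  show ?thesis using \<sigma>(2,3) \<tau>(2) by eventually_elim (use limit in blast)
qed

section \<open>Affine changes of variables on the Heisenberg group\<close>

text \<open>Left translations and dilations both have this form.\<close>

definition heis_affine :: "heis \<Rightarrow> real \<Rightarrow> real \<Rightarrow> real \<Rightarrow> real \<Rightarrow> heis \<Rightarrow> heis" where
  "heis_affine a b1 b2 b3 c y =
     (fst a + b1 * fst y, fst (snd a) + b2 * fst (snd y), snd (snd a) + b3 * snd (snd y) + c * fst (snd y))"

lemma heis_affine_measurable [measurable]: "heis_affine a b1 b2 b3 c \<in> borel_measurable borel"
  unfolding heis_affine_def by measurable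

lemma nn_integral_heis_affine:
  assumes [measurable]: "f \<in> borel_measurable borel" and b: "b1 \<noteq> 0" "b2 \<noteq> 0" "b3 \<noteq> 0"
  shows "(\<integral>\<^sup>+y. f y \<partial>lborel) = ennreal \<bar>b1 * b2 * b3\<bar> * (\<integral>\<^sup>+y. f (heis_affine a b1 b2 b3 c y) \<partial>lborel)"
proof -
  obtain a1 a2 a3 where a: "a = (a1, a2, a3)" by (cases a)
  have "(\<integral>\<^sup>+y. f y \<partial>lborel) = (\<integral>\<^sup>+x. \<integral>\<^sup>+y. \<integral>\<^sup>+z. f (x, y, z) \<partial>lborel \<partial>lborel \<partial>lborel)"
    by (simp add: nn_integral_lborel_pair)
  also have "\<dots> = (\<integral>\<^sup>+x. \<integral>\<^sup>+y. ennreal \<bar>b2\<bar> * (\<integral>\<^sup>+z. ennreal \<bar>b3\<bar> * f (x, a2 + b2 * y, a3 + b3 * z + c * y) \<partial>lborel) \<partial>lborel \<partial>lborel)"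
  proof (rule nn_integral_cong)
    fix x
    have "(\<integral>\<^sup>+y. \<integral>\<^sup>+z. f (x, y, z) \<partial>lborel \<partial>lborel) =
        ennreal \<bar>b2\<bar> * (\<integral>\<^sup>+y. \<integral>\<^sup>+z. f (x, a2 + b2 * y, z) \<partial>lborel \<partial>lborel)"
      by (rule nn_integral_real_affine[of _ b2 a2]) (use b in auto)
    also have "\<dots> = (\<integral>\<^sup>+y. ennreal \<bar>b2\<bar> * (\<integral>\<^sup>+z. f (x, a2 + b2 * y, z) \<partial>lborel) \<partial>lborel)"
      by (rule nn_integral_cmult[symmetric]) measurable
    also have "\<dots> = (\<integral>\<^sup>+y. ennreal \<bar>b2\<bar> * (\<integral>\<^sup>+z. ennreal \<bar>b3\<bar> * f (x, a2 + b2 * y, a3 + b3 * z + c * y) \<partial>lborel) \<partial>lborel)"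
    proof (rule nn_integral_cong)
      fix y
      have "(\<integral>\<^sup>+z. f (x, a2 + b2 * y, z) \<partial>lborel) = ennreal \<bar>b3\<bar> * (\<integral>\<^sup>+z. f (x, a2 + b2 * y, (a3 + c * y) + b3 * z) \<partial>lborel)"
        by (rule nn_integral_real_affine) (use b in auto)
      then show "ennreal \<bar>b2\<bar> * (\<integral>\<^sup>+z. f (x, a2 + b2 * y, z) \<partial>lborel) =
          ennreal \<bar>b2\<bar> * (\<integral>\<^sup>+z. ennreal \<bar>b3\<bar> * f (x, a2 + b2 * y, a3 + b3 * z + c * y) \<partial>lborel)"
        by (simp add: nn_integral_cmult add_ac)
    qed
    finally show "(\<integral>\<^sup>+y. \<integral>\<^sup>+z. f (x, y, z) \<partial>lborel \<partial>lborel) =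
      (\<integral>\<^sup>+y. ennreal \<bar>b2\<bar> * (\<integral>\<^sup>+z. ennreal \<bar>b3\<bar> * f (x, a2 + b2 * y, a3 + b3 * z + c * y) \<partial>lborel) \<partial>lborel)" .
  qed
  also have "\<dots> = ennreal \<bar>b1\<bar> * (\<integral>\<^sup>+x. \<integral>\<^sup>+y. ennreal \<bar>b2\<bar> * (\<integral>\<^sup>+z. ennreal \<bar>b3\<bar> * f (a1 + b1 * x, a2 + b2 * y, a3 + b3 * z + c * y) \<partial>lborel) \<partial>lborel \<partial>lborel)"
    by (rule nn_integral_real_affine[of _ b1 a1]) (use b in auto)
  also have "\<dots> = ennreal \<bar>b1\<bar> * (ennreal \<bar>b2\<bar> * (ennreal \<bar>b3\<bar> * (\<integral>\<^sup>+x. \<integral>\<^sup>+y. \<integral>\<^sup>+z. f (a1 + b1 * x, a2 + b2 * y, a3 + b3 * z + c * y) \<partial>lborel \<partial>lborel \<partial>lborel)))"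
    by (simp add: nn_integral_cmult)
  also have "(\<integral>\<^sup>+x. \<integral>\<^sup>+y. \<integral>\<^sup>+z. f (a1 + b1 * x, a2 + b2 * y, a3 + b3 * z + c * y) \<partial>lborel \<partial>lborel \<partial>lborel) =
      (\<integral>\<^sup>+y. f (heis_affine a b1 b2 b3 c y) \<partial>lborel)"
    by (simp add: nn_integral_lborel_pair heis_affine_def a)
  finally show ?thesis by (simp add: ennreal_mult abs_mult mult.assoc)
qed

lemma heis_affine_scaling:
  assumes b: "b1 \<noteq> 0" "b2 \<noteq> 0" "b3 \<noteq> 0"
  shows "lborel_scaling (heis_affine a b1 b2 b3 c) \<bar>b1 * b2 * b3\<bar>"
  using b by unfold_locales (auto intro: nn_integral_heis_affine)

text \<open>A substitution in the integral defining \<open>fourier_L1\<close>: the representation at \<open>y\<close> is expressed through the representation at the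
image of \<open>y\<close>, with another frequency, argument and point. Up to a scalar, translations change only the
point, while dilations change all three.\<close>

lemma fourier_L1_heis_affine:
  assumes b: "b1 \<noteq> 0" "b2 \<noteq> 0" "b3 \<noteq> 0"
    and s: "s \<in> L2N" "integrable lebesgue s" and f: "f \<in> L2R"
    and rep: "\<And>y f. schrodinger_rep \<omega> y f t =
      k * schrodinger_rep \<omega>' (heis_affine a b1 b2 b3 c y) (D f) t'"
    and D: "D f \<in> L2R"
    and cong: "\<And>f'. AE x in lebesgue. f x = f' x \<Longrightarrow> f' \<in> borel_measurable borel \<Longrightarrow>
      (AE x in lebesgue. D f x = D f' x) \<and> D f' \<in> borel_measurable borel"
  shows "\<bar>b1 * b2 * b3\<bar> *\<^sub>R fourier_L1 (\<lambda>y. s (heis_affine a b1 b2 b3 c y)) \<omega> f t = k * fourier_L1 s \<omega>' (D f) t'"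
proof -
  let ?T = "heis_affine a b1 b2 b3 c"
  obtain s' where s': "s' \<in> borel_measurable borel" "AE x in lebesgue. s x = s' x"
    using L1_L2_borel_representative[OF s] by metis
  obtain f' where f': "f' \<in> borel_measurable borel" "AE x in lebesgue. f x = f' x"
    using L2_lebesgue_borel_representative[OF f] by metis
  have Df': "AE x in lebesgue. D f x = D f' x" "D f' \<in> borel_measurable borel" using cong[OF f'(2,1)] by auto
  note [measurable] = s'(1) f'(1) Df'(2)
  have "fourier_L1 (\<lambda>y. s (?T y)) \<omega> f t = (LINT y|lborel. s' (?T y) * schrodinger_rep \<omega> y f' t)"
    by (rule fourier_L1_cong_AE[OF lborel_scaling.AE_lebesgue[OF heis_affine_scaling[OF b] s'(2)] _ f'(2,1)]) measurable
  also have "\<dots> = (LINT y|lborel. k * (s' (?T y) * schrodinger_rep \<omega>' (?T y) (D f') t'))"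
    by (subst rep) (simp add: mult_ac)
  finally have "\<bar>b1 * b2 * b3\<bar> *\<^sub>R fourier_L1 (\<lambda>y. s (?T y)) \<omega> f t =
      k * (\<bar>b1 * b2 * b3\<bar> *\<^sub>R (LINT y|lborel. s' (?T y) * schrodinger_rep \<omega>' (?T y) (D f') t'))" by simp
  also have "\<bar>b1 * b2 * b3\<bar> *\<^sub>R (LINT y|lborel. s' (?T y) * schrodinger_rep \<omega>' (?T y) (D f') t') =
      (LINT y|lborel. s' y * schrodinger_rep \<omega>' y (D f') t')"
    by (rule lborel_scaling.integral_borel[OF heis_affine_scaling[OF b], symmetric]) (unfold schrodinger_rep_apply, measurable)
  also have "\<dots> = fourier_L1 s \<omega>' (D f) t'"
    by (rule fourier_L1_cong_AE[OF s'(2,1) Df', symmetric])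
  finally show ?thesis .
qed

lemmas L2_heis_affine = lborel_scaling.L2_compose[OF heis_affine_scaling]
  and L1_heis_affine = lborel_scaling.integrable_compose[OF heis_affine_scaling]

section \<open>Affine changes of variables on the line\<close>

lemma L2_real_affine:
  assumes f: "f \<in> L2R" and b: "b \<noteq> 0"
  shows "(\<lambda>t. f (a + b * t)) \<in> L2R"
    and "(L2_norm lebesgue f)\<^sup>2 = \<bar>b\<bar> * (L2_norm lebesgue (\<lambda>t. f (a + b * t)))\<^sup>2"
  using lborel_scaling.L2_compose[OF real_affine_scaling[OF b] f] by blast+

lemma L2_norm_real_affine_tendsto_0:
  assumes h: "\<And>n. h n \<in> L2R" and b: "b \<noteq> 0" and lim: "(\<lambda>n. L2_norm lebesgue (h n)) \<longlonglongrightarrow> 0"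
  shows "(\<lambda>n. L2_norm lebesgue (\<lambda>t. h n (a + b * t))) \<longlonglongrightarrow> 0"
proof -
  have "L2_norm lebesgue (\<lambda>t. h n (a + b * t)) = L2_norm lebesgue (h n) / sqrt \<bar>b\<bar>" for n
  proof -
    have "sqrt ((L2_norm lebesgue (h n))\<^sup>2) = sqrt (\<bar>b\<bar> * (L2_norm lebesgue (\<lambda>t. h n (a + b * t)))\<^sup>2)"
      by (rule arg_cong[OF L2_real_affine(2)[OF h b]])
    then show ?thesis using b by (simp add: real_sqrt_mult)
  qed
  then show ?thesis using tendsto_divide_zero[OF lim, of "sqrt \<bar>b\<bar>"] by simp
qed

lemma AE_lebesgue_real_affine:
  assumes "AE y in lebesgue. P y" "c \<noteq> 0"
  shows "AE x in lebesgue. P (a + c * (x :: real))"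
  by (rule lborel_scaling.AE_lebesgue[OF real_affine_scaling[OF assms(2)] assms(1)])

lemma L2_unimodular_mult:
  fixes k f :: "real \<Rightarrow> complex"
  assumes f: "f \<in> L2R" and k: "k \<in> borel_measurable borel" "\<And>t. cmod (k t) = 1"
  shows "(\<lambda>t. k t * f t) \<in> L2R" "L2_norm lebesgue (\<lambda>t. k t * f t) = L2_norm lebesgue f"
proof -
  have "k \<in> borel_measurable lebesgue" using k(1) by (intro measurable_completion) simp
  then show "(\<lambda>t. k t * f t) \<in> L2R"
    using f k(2) by (auto simp: L2_def norm_mult)
  show "L2_norm lebesgue (\<lambda>t. k t * f t) = L2_norm lebesgue f"
    using k(2) by (simp add: L2_norm_def norm_mult)
qed

section \<open>Translations and dilations on the Fourier side\<close>

lemma transl_eq_heis_affine: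
  "transl x \<phi> = (\<lambda>y. \<phi> (heis_affine (heis_inv x) 1 1 1 (- fst x) y))"
  by (rule ext) (cases x; case_tac y; simp add: transl_def heis_affine_def)

lemma dil_eq_heis_affine:
  "a > 0 \<Longrightarrow> dil a \<phi> = (\<lambda>y. complex_of_real (inverse a) *
     \<phi> (heis_affine (0, 0, 0) (inverse a powr (1/2)) (inverse a powr (1/2)) (inverse a) 0 y))"
  by (rule ext) (case_tac y; simp add: dil_def heis_affine_def)

lemma schrodinger_rep_unitary:
  assumes f: "f \<in> L2R"
  shows "schrodinger_rep \<omega> x f \<in> L2R"
    and "L2_norm lebesgue (schrodinger_rep \<omega> x f) = L2_norm lebesgue f"
proof -
  let ?k = "\<lambda>t. cis (2 * pi * \<omega> * snd (snd x)) * cis (- (2 * pi * \<omega> * fst (snd x) * t))"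
  have eq: "schrodinger_rep \<omega> x f = (\<lambda>t. ?k t * f (- fst x + 1 * t))"
    by (rule ext) (simp add: schrodinger_rep_apply)
  have k: "?k \<in> borel_measurable borel" "cmod (?k t) = 1" for t
    by (measurable, simp add: norm_mult)
  have ft: "(\<lambda>t. f (- fst x + 1 * t)) \<in> L2R" by (rule L2_real_affine(1)[OF f]) simp
  show "schrodinger_rep \<omega> x f \<in> L2R" unfolding eq by (rule L2_unimodular_mult[OF ft k])
  have "L2_norm lebesgue (\<lambda>t. f (- fst x + 1 * t)) = L2_norm lebesgue f"
    using L2_real_affine(2)[OF f, of 1 "- fst x"] by (simp add: power2_eq_iff_nonneg)
  then show "L2_norm lebesgue (schrodinger_rep \<omega> x f) = L2_norm lebesgue f"
    unfolding eq using L2_unimodular_mult(2)[OF ft k] by simp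
qed

lemma schrodinger_rep_mult:
  "schrodinger_rep \<omega> (heis_mult x y) f = schrodinger_rep \<omega> x (schrodinger_rep \<omega> y f)"
proof (rule ext)
  fix t
  obtain x1 x2 x3 y1 y2 y3 where xy: "x = (x1, x2, x3)" "y = (y1, y2, y3)" by (metis prod_cases3)
  have "2 * pi * \<omega> * (x3 + y3 + x1 * y2) + - 2 * pi * \<omega> * (x2 + y2) * t =
      (2 * pi * \<omega> * x3 + - 2 * pi * \<omega> * x2 * t) + (2 * pi * \<omega> * y3 + - 2 * pi * \<omega> * y2 * (t - x1))"
    by (simp add: algebra_simps)
  then show "schrodinger_rep \<omega> (heis_mult x y) f t = schrodinger_rep \<omega> x (schrodinger_rep \<omega> y f) t"
    unfolding xy heis_mult.simps schrodinger_rep.simps cis_mult mult.assoc[symmetric]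
    by (simp only: cis_mult diff_diff_eq) 
qed

lemma transl_L2: "\<phi> \<in> L2N \<Longrightarrow> transl x \<phi> \<in> L2N"
  and transl_norm: "\<phi> \<in> L2N \<Longrightarrow> L2_norm lebesgue (transl x \<phi>) = L2_norm lebesgue \<phi>"
  and transl_integrable: "\<phi> \<in> L2N \<Longrightarrow> integrable lebesgue \<phi> \<Longrightarrow> integrable lebesgue (transl x \<phi>)"
  unfolding transl_eq_heis_affine
  using L2_heis_affine[of 1 1 1 \<phi> "heis_inv x" "- fst x"] L1_heis_affine[of 1 1 1 \<phi> "heis_inv x" "- fst x"]
  by (auto simp: power2_eq_iff_nonneg)

lemma dil_L2:
  assumes a: "a > 0" and \<phi>: "\<phi> \<in> L2N"
  shows "dil a \<phi> \<in> L2N" and "L2_norm lebesgue (dil a \<phi>) = L2_norm lebesgue \<phi>"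
    and "integrable lebesgue \<phi> \<Longrightarrow> integrable lebesgue (dil a \<phi>)"
proof -
  let ?r = "inverse a powr (1/2)"
  have nz: "?r \<noteq> 0" "inverse a \<noteq> 0" using a by auto
  have jac: "\<bar>?r * ?r * inverse a\<bar> = (inverse a)\<^sup>2"
    using a by (simp add: powr_add[symmetric] power2_eq_square)
  note * = L2_heis_affine[OF nz(1,1,2) \<phi>, of "(0,0,0)" 0]
  show "dil a \<phi> \<in> L2N" unfolding dil_eq_heis_affine[OF a] by (rule L2_scale[OF *(1)])
  have "(L2_norm lebesgue \<phi>)\<^sup>2 = (L2_norm lebesgue (dil a \<phi>))\<^sup>2"
    using *(2) a unfolding jac dil_eq_heis_affine[OF a] L2_norm_scale by (simp add: power_mult_distrib norm_inverse)
  then show "L2_norm lebesgue (dil a \<phi>) = L2_norm lebesgue \<phi>" by (simp add: power2_eq_iff_nonneg)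
  show "integrable lebesgue (dil a \<phi>)" if "integrable lebesgue \<phi>"
    unfolding dil_eq_heis_affine[OF a]
    using L1_heis_affine[OF nz(1,1,2) \<phi> that, of "(0,0,0)" 0] by simp
qed

lemma fourier_L1_transl:
  assumes s: "s \<in> L2N" "integrable lebesgue s" and f: "f \<in> L2R"
  shows "fourier_L1 (transl x s) \<omega> f = schrodinger_rep \<omega> x (fourier_L1 s \<omega> f)"
proof (rule ext)
  fix t
  let ?T = "heis_affine (heis_inv x) 1 1 1 (- fst x)"
  let ?k = "cis (2 * pi * \<omega> * snd (snd x)) * cis (- (2 * pi * \<omega> * fst (snd x) * t))"
  have rep: "schrodinger_rep \<omega> y f t = ?k * schrodinger_rep \<omega> (?T y) f (t - fst x)" for y f
  proof -
    have "y = heis_mult x (?T y)" by (cases x; cases y; simp add: heis_affine_def algebra_simps)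
    then have "schrodinger_rep \<omega> y f t = schrodinger_rep \<omega> x (schrodinger_rep \<omega> (?T y) f) t"
      using schrodinger_rep_mult[of \<omega> x "?T y" f] by simp
    then show ?thesis by (subst (asm) schrodinger_rep_apply[of _ x])
  qed
  have "fourier_L1 (transl x s) \<omega> f t = ?k * fourier_L1 s \<omega> f (t - fst x)"
    using fourier_L1_heis_affine[of 1 1 1 s f \<omega> t ?k \<omega> "heis_inv x" "- fst x" "\<lambda>f. f" "t - fst x", OF _ _ _ s f rep f]
    by (simp add: transl_eq_heis_affine)
  then show "fourier_L1 (transl x s) \<omega> f t = schrodinger_rep \<omega> x (fourier_L1 s \<omega> f) t"
    by (simp add: schrodinger_rep_apply)
qed

lemma C_dil_L2:
  assumes a: "a > 0" and f: "f \<in> L2R"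
  shows "C_dil a f \<in> L2R"
  unfolding C_dil_def using L2_real_affine(1)[OF f, of "a powr (1/2)" 0] a by (intro L2_scale) simp

text \<open>Conjugation by \<open>C_dil a\<close> turns the representation at frequency \<open>a * \<omega>\<close> into the dilated representation at frequency \<open>\<omega>\<close>. The
power \<open>3/4\<close> collects \<open>a\<^sup>-\<^sup>1\<close> from \<open>dil\<close>, the Jacobian \<open>a\<^sup>2\<close> and \<open>a\<^sup>-\<^sup>1\<^sup>/\<^sup>4\<close> from the inverse of \<open>C_dil a\<close>.\<close>

lemma fourier_L1_dil:
  assumes a: "a > 0" and s: "s \<in> L2N" "integrable lebesgue s" and f: "f \<in> L2R"
  shows "fourier_L1 (dil a s) \<omega> f t =
    complex_of_real (a powr (3/4)) * fourier_L1 s (a * \<omega>) (C_dil a f) (a powr (-1/2) * t)"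
proof -
  let ?r = "inverse a powr (1/2)"
  let ?T = "heis_affine (0,0,0) ?r ?r (inverse a) 0"
  let ?k = "complex_of_real (a powr (-1/4))"
  have nz: "?r \<noteq> 0" "inverse a \<noteq> 0" using a by auto
  have jac: "\<bar>?r * ?r * inverse a\<bar> = inverse a * inverse a"
    using a by (simp add: powr_add[symmetric] power2_eq_square)
  have r: "?r = a powr (-1/2)" using a by (simp add: powr_minus inverse_eq_divide powr_divide)
  have rr: "a powr (1/2) * ?r = 1" "a * ?r * ?r = 1"
    using a by (simp_all add: r powr_add[symmetric] powr_mult_base mult.assoc)
  have kk: "?k * complex_of_real (a powr (1/4)) = 1"
    using a by (simp add: of_real_mult[symmetric] powr_add[symmetric] del: of_real_mult)
  have rep: "schrodinger_rep \<omega> y f t = ?k * schrodinger_rep (a * \<omega>) (?T y) (C_dil a f) (a powr (-1/2) * t)" for y f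
  proof -
    obtain y1 y2 y3 where y: "y = (y1, y2, y3)" by (metis prod_cases3)
    have e1: "2 * pi * (a * \<omega>) * (inverse a * y3) = 2 * pi * \<omega> * y3" using a by simp
    have "2 * pi * (a * \<omega>) * (?r * y2) * (?r * t) = 2 * pi * \<omega> * y2 * t * (a * ?r * ?r)" by (simp only: mult_ac)
    then have e2: "2 * pi * (a * \<omega>) * (?r * y2) * (?r * t) = 2 * pi * \<omega> * y2 * t" by (simp add: rr)
    have "a powr (1/2) * (?r * t - ?r * y1) = (a powr (1/2) * ?r) * (t - y1)" by (simp only: algebra_simps)
    then have e3: "a powr (1/2) * (?r * t - ?r * y1) = t - y1" by (simp only: rr mult_1_left)
    have "?k * schrodinger_rep (a * \<omega>) (?T y) (C_dil a f) (?r * t) =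
        (?k * complex_of_real (a powr (1/4))) * (cis (2 * pi * \<omega> * y3) * cis (- (2 * pi * \<omega> * y2 * t)) * f (t - y1))"
      by (simp only: schrodinger_rep_apply y heis_affine_def fst_conv snd_conv C_dil_def add_0_left
          mult_zero_left add_0_right e1 e2 e3) (simp only: mult_ac)
    then show ?thesis unfolding kk r by (simp add: schrodinger_rep_apply y)
  qed
  have cong: "(AE x in lebesgue. C_dil a f x = C_dil a f' x) \<and> C_dil a f' \<in> borel_measurable borel"
    if "AE x in lebesgue. f x = f' x" "f' \<in> borel_measurable borel" for f'
  proof
    have "a powr (1/2) \<noteq> 0" using a by simp
    from AE_lebesgue_real_affine[OF that(1) this, of 0]
    show "AE x in lebesgue. C_dil a f x = C_dil a f' x" by eventually_elim (simp add: C_dil_def)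
    show "C_dil a f' \<in> borel_measurable borel" unfolding C_dil_def using that(2) by measurable
  qed
  define F where "F = fourier_L1 (\<lambda>y. s (?T y)) \<omega> f t"
  define G where "G = fourier_L1 s (a * \<omega>) (C_dil a f) (a powr (-1/2) * t)"
  have "\<bar>?r * ?r * inverse a\<bar> *\<^sub>R F = ?k * G"
    unfolding F_def G_def
    by (rule fourier_L1_heis_affine[OF nz(1,1,2) s f rep C_dil_L2[OF a f] cong])
  then have "complex_of_real (inverse a) * (complex_of_real (inverse a) * F) = ?k * G"
    unfolding jac by (simp add: scaleR_conv_of_real mult.assoc)
  then have "complex_of_real (inverse a) * F = complex_of_real a * (?k * G)"
    using a by (simp add: field_simps)
  also have "\<dots> = complex_of_real (a powr (3/4)) * G"
  proof -
    have "a * a powr (-1/4) = a powr (3/4)" using a by (simp add: powr_mult_base)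
    then have "complex_of_real a * ?k = complex_of_real (a powr (3/4))" by (simp only: of_real_mult[symmetric])
    then show ?thesis by (simp add: mult.assoc[symmetric])
  qed
  also have "complex_of_real (inverse a) * F = fourier_L1 (dil a s) \<omega> f t"
    unfolding F_def fourier_L1_def dil_eq_heis_affine[OF a]
    by (subst Bochner_Integration.integral_mult_right_zero[symmetric]) (simp add: mult.assoc)
  finally show ?thesis by (simp only: G_def)
qed

lemma fourier_transl:
  assumes A: "is_fourier \<phi> A" and B: "is_fourier (transl x \<phi>) B"
  shows "AE \<omega> in lborel. \<forall>f\<in>L2R. AE t in lebesgue. B \<omega> f t = schrodinger_rep \<omega> x (A \<omega> f) t"
proof -
  have \<phi>: "\<phi> \<in> L2N" using A by (auto simp: is_fourier_def)
  obtain r where rA: "L1_approx r \<phi>" using is_fourier_approximation[OF A] .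
  note r = L1_approxD[OF rA]
  have "(\<lambda>y. transl x (r n) y - transl x \<phi> y) = transl x (\<lambda>y. r n y - \<phi> y)" for n
    by (simp add: transl_def)
  then have qA: "L1_approx (\<lambda>n. transl x (r n)) (transl x \<phi>)"
    using r transl_norm[OF L2_diff[OF r(1) \<phi>]] by (simp add: L1_approx_def transl_L2 transl_integrable)
  note q = L1_approxD[OF qA]
  obtain \<sigma> where \<sigma>: "AE \<omega> in lborel. fourier_limit (\<lambda>n. r (\<sigma> n)) A \<omega>"
    "AE \<omega> in lborel. fourier_limit (\<lambda>n. transl x (r (\<sigma> n))) B \<omega>"
    using fourier_pointwise2[OF A rA B qA] by blast
  have limit: "AE t in lebesgue. B \<omega> f t = schrodinger_rep \<omega> x (A \<omega> f) t"
    if lims: "fourier_limit (\<lambda>n. r (\<sigma> n)) A \<omega>" "fourier_limit (\<lambda>n. transl x (r (\<sigma> n))) B \<omega>"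
      and f: "f \<in> L2R" for \<omega> f
  proof -
    note A = fourier_limitD[OF lims(1) f] and B = fourier_limitD[OF lims(2) f]
    have "(\<lambda>t. schrodinger_rep \<omega> x (fourier_L1 (r n) \<omega> f) t - schrodinger_rep \<omega> x (A \<omega> f) t) =
        schrodinger_rep \<omega> x (\<lambda>t. fourier_L1 (r n) \<omega> f t - A \<omega> f t)" for n
      by (rule ext) (simp add: schrodinger_rep_apply right_diff_distrib)
    then have "L2_lim lebesgue (\<lambda>n. fourier_L1 (transl x (r (\<sigma> n))) \<omega> f) (schrodinger_rep \<omega> x (A \<omega> f))"
      using A(3) schrodinger_rep_unitary(2)[OF L2_diff[OF fourier_L1_L2[OF r(1,2) f] A(2)]]
      by (simp add: fourier_L1_transl[OF r(1,2) f])
    then show ?thesis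
      by (intro L2_limit_unique[where s="\<lambda>n. fourier_L1 (transl x (r (\<sigma> n))) \<omega> f"] fourier_L1_L2[OF q(1,2) f] B(2,3)
          schrodinger_rep_unitary(1)[OF A(2)])
  qed
  show ?thesis using \<sigma> by eventually_elim (use limit in blast)
qed

lemma fourier_dil:
  assumes a: "a > 0" and A: "is_fourier \<phi> A" and B: "is_fourier (dil a \<phi>) B"
  shows "AE \<omega> in lborel. bounded_operator (A (a * \<omega>)) \<and> (\<forall>f\<in>L2R. AE t in lebesgue.
    B \<omega> f t = complex_of_real (a powr (3/4)) * A (a * \<omega>) (C_dil a f) (a powr (-1/2) * t))"
proof -
  have \<phi>: "\<phi> \<in> L2N" using A by (auto simp: is_fourier_def)
  obtain r where rA: "L1_approx r \<phi>" using is_fourier_approximation[OF A] .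
  note r = L1_approxD[OF rA]
  have "(\<lambda>y. dil a (r n) y - dil a \<phi> y) = dil a (\<lambda>y. r n y - \<phi> y)" for n
    by (simp add: dil_def right_diff_distrib)
  then have qA: "L1_approx (\<lambda>n. dil a (r n)) (dil a \<phi>)"
    using r dil_L2(2)[OF a L2_diff[OF r(1) \<phi>]] dil_L2(1,3)[OF a] by (simp add: L1_approx_def)
  note q = L1_approxD[OF qA]
  obtain \<sigma> where \<sigma>: "AE \<omega> in lborel. fourier_limit (\<lambda>n. r (\<sigma> n)) A \<omega>"
    "AE \<omega> in lborel. fourier_limit (\<lambda>n. dil a (r (\<sigma> n))) B \<omega>"
    using fourier_pointwise2[OF A rA B qA] by blast
  let ?c = "complex_of_real (a powr (3/4))" and ?b = "a powr (-1/2)"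
  have b: "?b \<noteq> 0" using a by simp
  have limit: "AE t in lebesgue. B \<omega> f t = ?c * A (a * \<omega>) (C_dil a f) (?b * t)"
    if lims: "fourier_limit (\<lambda>n. r (\<sigma> n)) A (a * \<omega>)" "fourier_limit (\<lambda>n. dil a (r (\<sigma> n))) B \<omega>"
      and f: "f \<in> L2R" for \<omega> f
  proof -
    note A = fourier_limitD[OF lims(1) C_dil_L2[OF a f]] and B = fourier_limitD[OF lims(2) f]
    have "(\<lambda>n. L2_norm lebesgue (\<lambda>t. (\<lambda>t. fourier_L1 (r (\<sigma> n)) (a * \<omega>) (C_dil a f) t - A (a * \<omega>) (C_dil a f) t) (0 + ?b * t))) \<longlonglongrightarrow> 0"
      by (rule L2_norm_real_affine_tendsto_0[OF _ b A(3)]) (rule L2_diff[OF fourier_L1_L2[OF r(1,2) C_dil_L2[OF a f]] A(2)])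
    then have "(\<lambda>n. cmod ?c * L2_norm lebesgue (\<lambda>t. fourier_L1 (r (\<sigma> n)) (a * \<omega>) (C_dil a f) (?b * t) - A (a * \<omega>) (C_dil a f) (?b * t))) \<longlonglongrightarrow> 0"
      by (intro tendsto_mult_right_zero) simp
    then have "L2_lim lebesgue (\<lambda>n. fourier_L1 (dil a (r (\<sigma> n))) \<omega> f) (\<lambda>t. ?c * A (a * \<omega>) (C_dil a f) (?b * t))"
      unfolding L2_norm_scale[symmetric] fourier_L1_dil[OF a r(1,2) f] by (simp only: right_diff_distrib)
    moreover have "(\<lambda>t. A (a * \<omega>) (C_dil a f) (?b * t)) \<in> L2R"
      using L2_real_affine(1)[OF A(2) b, of 0] by simp
    ultimately show ?thesis
      by (intro L2_limit_unique[where s="\<lambda>n. fourier_L1 (dil a (r (\<sigma> n))) \<omega> f"] fourier_L1_L2[OF q(1,2) f] B(2,3) L2_scale)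
  qed
  have "AE \<omega> in lborel. fourier_limit (\<lambda>n. r (\<sigma> n)) A (0 + a * \<omega>)"
    using \<sigma>(1) by (rule AE_lborel_affine) (use a in simp)
  with \<sigma>(2) show ?thesis
  proof eventually_elim
    case (elim \<omega>)
    then show ?case using limit by (simp add: fourier_limit_def)
  qed
qed

section \<open>The measure on the dual side\<close>

lemma Lam_UNIV_sets [simp]: "Lam \<times> (UNIV :: real set) \<in> sets lebesgue"
proof -
  have "open (Lam \<times> (UNIV :: real set))" unfolding Lam_def by (intro open_Times) auto
  then show ?thesis by (intro sets_completionI_sets) simp
qed

lemma dual_measurable_eq: "borel_measurable dual_measure = borel_measurable (lebesgue_on (Lam \<times> UNIV))"
  unfolding dual_measure_def by (intro measurable_cong_sets) simp_all

lemma dual_density_measurable: "(\<lambda>(\<omega>, t). ennreal \<bar>\<omega>\<bar>) \<in> borel_measurable (lebesgue_on (Lam \<times> (UNIV :: real set)))"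
proof (intro measurable_restrict_space1 measurable_completion)
  have "(\<lambda>p :: real \<times> real. ennreal \<bar>fst p\<bar>) \<in> borel_measurable borel" by measurable
  then show "(\<lambda>(\<omega>, t :: real). ennreal \<bar>\<omega>\<bar>) \<in> borel_measurable lborel" by (simp add: case_prod_beta')
qed

lemma AE_fst_nonzero: "AE p in (lborel :: (real \<times> real) measure). fst p \<noteq> 0"
  by (rule AE_lborel_fst[OF AE_lborel_singleton])

lemma AE_dual: "(AE p in dual_measure. P p) \<longleftrightarrow> (AE p in lborel. P p)"
proof -
  have "(AE p in dual_measure. P p) \<longleftrightarrow> (AE p in lborel. p \<in> Lam \<times> UNIV \<longrightarrow> fst p \<noteq> 0 \<longrightarrow> P p)"
    unfolding dual_measure_def AE_density[OF dual_density_measurable]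
    by (subst AE_restrict_space_iff) (simp_all add: AE_completion_iff case_prod_beta')
  also have "\<dots> \<longleftrightarrow> (AE p in lborel. P p)"
  proof
    assume "AE p in lborel. p \<in> Lam \<times> UNIV \<longrightarrow> fst p \<noteq> 0 \<longrightarrow> P p"
    with AE_fst_nonzero show "AE p in lborel. P p"
      by eventually_elim (auto simp: Lam_def mem_Times_iff)
  next
    assume "AE p in lborel. P p"
    then show "AE p in lborel. p \<in> Lam \<times> UNIV \<longrightarrow> fst p \<noteq> 0 \<longrightarrow> P p" by eventually_elim simp
  qed
  finally show ?thesis .
qed

lemma dual_measurableI:
  fixes f :: "real \<times> real \<Rightarrow> complex"
  assumes "f' \<in> borel_measurable borel" "AE p in lborel. f p = f' p"
  shows "f \<in> borel_measurable dual_measure"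
proof -
  have "f' \<in> borel_measurable lebesgue" using assms(1) by (intro measurable_completion) simp
  moreover have "AE p in lebesgue. f' p = f p"
    unfolding AE_completion_iff using assms(2) by eventually_elim simp
  ultimately have "f \<in> borel_measurable lebesgue" by (rule lebesgue_measurable_cong_AE)
  then show ?thesis unfolding dual_measurable_eq by (rule measurable_restrict_space1)
qed

lemma dual_borel_representative:
  fixes f :: "real \<times> real \<Rightarrow> complex"
  assumes "f \<in> borel_measurable dual_measure"
  obtains f' where "f' \<in> borel_measurable borel" "AE p in lborel. f p = f' p"
proof -
  have "(\<lambda>p. indicator (Lam \<times> UNIV) p *\<^sub>R f p) \<in> borel_measurable lebesgue"
    using assms unfolding dual_measurable_eq by (subst (asm) borel_measurable_restrict_space_iff) simp_all
  then obtain f' where f': "f' \<in> borel_measurable lborel" "AE p in lborel. indicator (Lam \<times> UNIV) p *\<^sub>R f p = f' p"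
    using completion_ex_borel_measurable_complex by blast
  have "AE p in lborel. f p = f' p"
    using f'(2) AE_fst_nonzero by eventually_elim (auto simp: Lam_def indicator_def mem_Times_iff split: if_splits)
  with f'(1) show ?thesis by (intro that[of f']) simp_all
qed

lemma nn_integral_dual:
  assumes "f \<in> borel_measurable dual_measure"
  shows "(\<integral>\<^sup>+p. f p \<partial>dual_measure) = (\<integral>\<^sup>+p. ennreal \<bar>fst p\<bar> * f p \<partial>lborel)"
proof -
  have "(\<integral>\<^sup>+p. f p \<partial>dual_measure) = (\<integral>\<^sup>+p. ennreal \<bar>fst p\<bar> * f p \<partial>lebesgue_on (Lam \<times> UNIV))"
    using assms unfolding dual_measurable_eq unfolding dual_measure_def
    by (subst nn_integral_density[OF dual_density_measurable]) (simp_all add: case_prod_beta')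
  also have "\<dots> = (\<integral>\<^sup>+p. ennreal \<bar>fst p\<bar> * f p * indicator (Lam \<times> UNIV) p \<partial>lborel)"
    by (simp add: nn_integral_restrict_space nn_integral_completion)
  also have "\<dots> = (\<integral>\<^sup>+p. ennreal \<bar>fst p\<bar> * f p \<partial>lborel)"
    by (intro nn_integral_cong) (auto simp: indicator_def Lam_def mem_Times_iff)
  finally show ?thesis .
qed

lemma integral_dual_borel:
  fixes f :: "real \<times> real \<Rightarrow> complex"
  assumes f: "f \<in> borel_measurable borel"
  shows "(LINT p|dual_measure. f p) = (LINT p|lborel. \<bar>fst p\<bar> *\<^sub>R f p)"
proof -
  have fm: "f \<in> borel_measurable (lebesgue_on (Lam \<times> UNIV))"
    using f by (intro measurable_restrict_space1 measurable_completion) simp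
  have dm: "(\<lambda>p. \<bar>fst p\<bar>) \<in> borel_measurable (lebesgue_on (Lam \<times> (UNIV :: real set)))"
    by (intro measurable_restrict_space1 measurable_completion) measurable
  have "dual_measure = density (lebesgue_on (Lam \<times> UNIV)) (\<lambda>p. ennreal \<bar>fst p\<bar>)"
    by (simp add: dual_measure_def case_prod_beta')
  then have "(LINT p|dual_measure. f p) = (LINT p|density (lebesgue_on (Lam \<times> UNIV)) (\<lambda>p. ennreal \<bar>fst p\<bar>). f p)"
    by (rule arg_cong)
  also have "\<dots> = (LINT p|lebesgue_on (Lam \<times> UNIV). \<bar>fst p\<bar> *\<^sub>R f p)"
    by (rule integral_density[OF fm dm]) simp
  also have "\<dots> = (LINT p|lebesgue. indicator (Lam \<times> UNIV) p *\<^sub>R (\<bar>fst p\<bar> *\<^sub>R f p))"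
    by (rule integral_restrict_space) simp
  also have "\<dots> = (LINT p|lebesgue. \<bar>fst p\<bar> *\<^sub>R f p)"
    by (intro Bochner_Integration.integral_cong) (auto simp: indicator_def Lam_def mem_Times_iff)
  also have "\<dots> = (LINT p|lborel. \<bar>fst p\<bar> *\<^sub>R f p)"
    using f by (intro integral_completion) measurable
  finally show ?thesis .
qed

lemma AE_lborel_pairD:
  fixes P :: "real \<times> real \<Rightarrow> bool"
  assumes "AE p in lborel. P p"
  shows "AE \<omega> in lborel. AE t in lborel. P (\<omega>, t)"
  by (rule lborel_pair.AE_pair, subst lborel_prod) (rule assms)

text \<open>The reducing isomorphism is specified slice by slice, whereas identities in \<open>L\<^sup>2\<close> are needed almost everywhere in both
variables; joint measurability closes this gap.\<close>

lemma AE_dual_iterated: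
  fixes f g :: "real \<times> real \<Rightarrow> complex"
  assumes f: "f \<in> borel_measurable dual_measure" and g: "g \<in> borel_measurable dual_measure"
    and ae: "AE \<omega> in lborel. AE t in lborel. f (\<omega>, t) = g (\<omega>, t)"
  shows "AE p in lborel. f p = g p"
proof -
  obtain f' where f' [measurable]: "f' \<in> borel_measurable borel" and ff': "AE p in lborel. f p = f' p"
    using dual_borel_representative[OF f] .
  obtain g' where g' [measurable]: "g' \<in> borel_measurable borel" and gg': "AE p in lborel. g p = g' p"
    using dual_borel_representative[OF g] .
  have "AE \<omega> in lborel. AE t in lborel. f' (\<omega>, t) = g' (\<omega>, t)"
    using ae AE_lborel_pairD[OF ff'] AE_lborel_pairD[OF gg']
  proof eventually_elim
    case (elim \<omega>)
    then show ?case by eventually_elim simp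
  qed
  moreover have "{p \<in> space (lborel \<Otimes>\<^sub>M lborel). f' p = g' p} \<in> sets (lborel \<Otimes>\<^sub>M lborel :: (real \<times> real) measure)"
    unfolding lborel_prod by measurable
  ultimately have "AE p in lborel \<Otimes>\<^sub>M lborel. f' p = g' p"
    by (intro lborel_pair.AE_pair_measure) auto
  then have "AE p in lborel. f' p = g' p" by (subst (asm) lborel_prod)
  with ff' gg' show ?thesis by eventually_elim simp
qed

section \<open>Dilations on the dual side\<close>

definition dual_dilate :: "real \<Rightarrow> real \<times> real \<Rightarrow> real \<times> real" where
  "dual_dilate a p = (a * fst p, a powr (-1/2) * snd p)"

lemma dual_dilate_measurable [measurable]: "dual_dilate a \<in> borel_measurable borel"
  unfolding dual_dilate_def by measurable

lemma dual_dilate_inverse: "a > 0 \<Longrightarrow> dual_dilate (inverse a) (dual_dilate a p) = p"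
  by (cases p) (simp add: dual_dilate_def powr_minus powr_divide inverse_eq_divide)

context
  fixes a :: real
  assumes a: "a > 0"
begin

lemma nn_integral_dual_dilate_lborel:
  assumes [measurable]: "f \<in> borel_measurable borel"
  shows "(\<integral>\<^sup>+p. f p \<partial>lborel) = ennreal (a powr (1/2)) * (\<integral>\<^sup>+p. f (dual_dilate a p) \<partial>lborel)"
proof -
  have "(\<integral>\<^sup>+p. f p \<partial>lborel) = (\<integral>\<^sup>+x. \<integral>\<^sup>+y. f (x, y) \<partial>lborel \<partial>lborel)"
    by (simp add: nn_integral_lborel_pair)
  also have "\<dots> = (\<integral>\<^sup>+x. ennreal (a powr (-1/2)) * (\<integral>\<^sup>+y. f (x, a powr (-1/2) * y) \<partial>lborel) \<partial>lborel)"
  proof (rule nn_integral_cong)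
    fix x
    show "(\<integral>\<^sup>+y. f (x, y) \<partial>lborel) = ennreal (a powr (-1/2)) * (\<integral>\<^sup>+y. f (x, a powr (-1/2) * y) \<partial>lborel)"
      using nn_integral_real_affine[of "\<lambda>y. f (x, y)" "a powr (-1/2)" 0] a by simp
  qed
  also have "\<dots> = ennreal \<bar>a\<bar> * (\<integral>\<^sup>+x. ennreal (a powr (-1/2)) * (\<integral>\<^sup>+y. f (0 + a * x, a powr (-1/2) * y) \<partial>lborel) \<partial>lborel)"
    by (rule nn_integral_real_affine) (use a in auto)
  also have "\<dots> = ennreal a * ennreal (a powr (-1/2)) * (\<integral>\<^sup>+x. \<integral>\<^sup>+y. f (a * x, a powr (-1/2) * y) \<partial>lborel \<partial>lborel)"
    using a by (simp add: nn_integral_cmult mult.assoc)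
  also have "ennreal a * ennreal (a powr (-1/2)) = ennreal (a powr (1/2))"
    using a by (simp add: ennreal_mult[symmetric] powr_mult_base)
  also have "(\<integral>\<^sup>+x. \<integral>\<^sup>+y. f (a * x, a powr (-1/2) * y) \<partial>lborel \<partial>lborel) = (\<integral>\<^sup>+p. f (dual_dilate a p) \<partial>lborel)"
    by (simp add: nn_integral_lborel_pair dual_dilate_def)
  finally show ?thesis .
qed

lemma dual_dilate_scaling: "lborel_scaling (dual_dilate a) (a powr (1/2))"
  using a by unfold_locales (auto intro: nn_integral_dual_dilate_lborel)

lemmas AE_dual_dilate = lborel_scaling.AE_lborel[OF dual_dilate_scaling]

lemma dual_measurable_dilate:
  fixes f :: "real \<times> real \<Rightarrow> complex"
  assumes "f \<in> borel_measurable dual_measure"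
  shows "(\<lambda>p. f (dual_dilate a p)) \<in> borel_measurable dual_measure"
proof -
  obtain f' where [measurable]: "f' \<in> borel_measurable borel" and ff': "AE p in lborel. f p = f' p"
    using dual_borel_representative[OF assms] .
  have "(\<lambda>p. f' (dual_dilate a p)) \<in> borel_measurable borel" by measurable
  then show ?thesis using AE_dual_dilate[OF ff'] by (rule dual_measurableI)
qed

lemma integral_dual_dilate:
  fixes f :: "real \<times> real \<Rightarrow> complex"
  assumes f: "f \<in> borel_measurable dual_measure"
  shows "(LINT p|dual_measure. f p) = (a powr (3/2)) *\<^sub>R (LINT p|dual_measure. f (dual_dilate a p))"
proof -
  obtain f' where f' [measurable]: "f' \<in> borel_measurable borel" and ff': "AE p in lborel. f p = f' p"
    using dual_borel_representative[OF f] .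
  have fS: "(\<lambda>p. f' (dual_dilate a p)) \<in> borel_measurable borel" by measurable
  have "(LINT p|dual_measure. f p) = (LINT p|dual_measure. f' p)"
    using ff' by (intro integral_cong_AE f dual_measurableI[OF f']) (simp_all add: AE_dual)
  also have "\<dots> = (LINT p|lborel. \<bar>fst p\<bar> *\<^sub>R f' p)" by (rule integral_dual_borel[OF f'])
  also have "\<dots> = (a powr (1/2)) *\<^sub>R (LINT p|lborel. \<bar>fst (dual_dilate a p)\<bar> *\<^sub>R f' (dual_dilate a p))"
    by (rule lborel_scaling.integral_borel[OF dual_dilate_scaling]) measurable
  also have "\<dots> = (a powr (1/2)) *\<^sub>R (LINT p|lborel. a *\<^sub>R (\<bar>fst p\<bar> *\<^sub>R f' (dual_dilate a p)))"
    using a by (simp add: dual_dilate_def abs_mult)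
  also have "\<dots> = (a * a powr (1/2)) *\<^sub>R (LINT p|lborel. \<bar>fst p\<bar> *\<^sub>R f' (dual_dilate a p))"
    unfolding integral_scaleR_right by (simp add: mult.commute)
  also have "a * a powr (1/2) = a powr (3/2)" using a by (simp add: powr_mult_base)
  also have "(LINT p|lborel. \<bar>fst p\<bar> *\<^sub>R f' (dual_dilate a p)) = (LINT p|dual_measure. f' (dual_dilate a p))"
    by (rule integral_dual_borel[OF fS, symmetric])
  also have "\<dots> = (LINT p|dual_measure. f (dual_dilate a p))"
    using AE_dual_dilate[OF ff']
    by (intro integral_cong_AE dual_measurable_dilate[OF f] dual_measurableI[OF fS]) (auto simp: AE_dual)
  finally show ?thesis .
qed

lemma nn_integral_norm_sq_dual_dilate:
  fixes f :: "real \<times> real \<Rightarrow> complex"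
  assumes f: "f \<in> borel_measurable dual_measure"
  shows "energy dual_measure f =
    ennreal (a powr (3/2)) * energy dual_measure (\<lambda>p. f (dual_dilate a p))"
proof -
  obtain f' where f' [measurable]: "f' \<in> borel_measurable borel" and ff': "AE p in lborel. f p = f' p"
    using dual_borel_representative[OF f] .
  have [measurable]: "f \<in> borel_measurable dual_measure" "(\<lambda>p. f (dual_dilate a p)) \<in> borel_measurable dual_measure"
    using f dual_measurable_dilate by auto
  have "energy dual_measure f = (\<integral>\<^sup>+p. ennreal \<bar>fst p\<bar> * ennreal ((cmod (f p))\<^sup>2) \<partial>lborel)"
    by (rule nn_integral_dual) measurable
  also have "\<dots> = (\<integral>\<^sup>+p. ennreal \<bar>fst p\<bar> * ennreal ((cmod (f' p))\<^sup>2) \<partial>lborel)"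
    by (rule nn_integral_cong_AE) (use ff' in \<open>eventually_elim, simp\<close>)
  also have "\<dots> = ennreal (a powr (1/2)) * (\<integral>\<^sup>+p. ennreal \<bar>fst (dual_dilate a p)\<bar> * ennreal ((cmod (f' (dual_dilate a p)))\<^sup>2) \<partial>lborel)"
    by (rule nn_integral_dual_dilate_lborel) measurable
  also have "\<dots> = ennreal (a powr (1/2)) * (\<integral>\<^sup>+p. ennreal a * (ennreal \<bar>fst p\<bar> * ennreal ((cmod (f' (dual_dilate a p)))\<^sup>2)) \<partial>lborel)"
    using a by (simp add: dual_dilate_def abs_mult ennreal_mult mult.assoc)
  also have "\<dots> = ennreal (a powr (1/2)) * (ennreal a * (\<integral>\<^sup>+p. ennreal \<bar>fst p\<bar> * ennreal ((cmod (f' (dual_dilate a p)))\<^sup>2) \<partial>lborel))"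
    by (subst nn_integral_cmult) measurable
  also have "\<dots> = ennreal (a powr (1/2)) * ennreal a * (\<integral>\<^sup>+p. ennreal \<bar>fst p\<bar> * ennreal ((cmod (f' (dual_dilate a p)))\<^sup>2) \<partial>lborel)"
    by (simp only: mult.assoc)
  also have "ennreal (a powr (1/2)) * ennreal a = ennreal (a powr (3/2))"
    using a by (simp add: ennreal_mult[symmetric] powr_mult_base mult.commute)
  also have "(\<integral>\<^sup>+p. ennreal \<bar>fst p\<bar> * ennreal ((cmod (f' (dual_dilate a p)))\<^sup>2) \<partial>lborel) =
      (\<integral>\<^sup>+p. ennreal \<bar>fst p\<bar> * ennreal ((cmod (f (dual_dilate a p)))\<^sup>2) \<partial>lborel)"
    by (rule nn_integral_cong_AE) (use AE_dual_dilate[OF ff'] in \<open>eventually_elim, simp\<close>)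
  also have "\<dots> = energy dual_measure (\<lambda>p. f (dual_dilate a p))"
    by (rule nn_integral_dual[symmetric]) measurable
  finally show ?thesis .
qed

end

lemma dual_measurable_fst:
  assumes c: "c \<in> borel_measurable (lebesgue_on Lam)"
  shows "(\<lambda>p. c (fst p) :: complex) \<in> borel_measurable dual_measure"
proof -
  have "(\<lambda>\<omega>. indicator Lam \<omega> *\<^sub>R c \<omega>) \<in> borel_measurable lebesgue"
    using c by (subst (asm) borel_measurable_restrict_space_iff) simp_all
  then obtain c' where c': "c' \<in> borel_measurable lborel" "AE \<omega> in lborel. indicator Lam \<omega> *\<^sub>R c \<omega> = c' \<omega>"
    using completion_ex_borel_measurable_complex by blast
  have [measurable]: "c' \<in> borel_measurable borel" using c'(1) by simp
  have "AE \<omega> in lborel. c \<omega> = c' \<omega>"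
    using c'(2) AE_lborel_singleton[of "0::real"]
    by eventually_elim (auto simp: Lam_def indicator_def split: if_splits)
  then have "AE p in (lborel :: (real \<times> real) measure). c (fst p) = c' (fst p)" by (rule AE_lborel_fst)
  then show ?thesis by (rule dual_measurableI[rotated]) measurable
qed

lemma L2_dual_Lam: "L2_dual Lam = L2 dual_measure"
proof -
  have "AE p in lborel. (case p of (\<omega>, t) \<Rightarrow> \<omega> \<notin> Lam \<longrightarrow> f (\<omega>, t) = 0)" for f :: "real \<times> real \<Rightarrow> complex"
    using AE_fst_nonzero by eventually_elim (auto simp: Lam_def)
  then show ?thesis by (auto simp: L2_dual_def AE_dual)
qed

lemma Dhat_apply: "Dhat chi a f p = chi a (fst p) * complex_of_real (a powr (3/4)) * f (dual_dilate a p)"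
  by (cases p) (simp add: Dhat_def dual_dilate_def)

lemma Dhat_cong_AE:
  assumes a: "a > 0" and "AE p in lborel. h p = h' p"
  shows "AE p in lborel. Dhat chi a h p = Dhat chi a h' p"
  using AE_dual_dilate[OF assms] by eventually_elim (simp add: Dhat_apply)

context
  fixes a :: real and chi :: "real \<Rightarrow> real \<Rightarrow> complex"
  assumes a: "a > 0" and chi_meas: "chi a \<in> borel_measurable (lebesgue_on Lam)"
    and chi_unit: "\<And>\<omega>. \<omega> \<in> Lam \<Longrightarrow> cmod (chi a \<omega>) = 1"
begin

lemma AE_chi_unit: "AE p in (lborel :: (real \<times> real) measure). cmod (chi a (fst p)) = 1"
  using AE_fst_nonzero by eventually_elim (simp add: chi_unit Lam_def)

lemma Dhat_measurable:
  assumes h: "h \<in> borel_measurable dual_measure"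
  shows "Dhat chi a h \<in> borel_measurable dual_measure"
proof -
  have [measurable]: "(\<lambda>p. chi a (fst p)) \<in> borel_measurable dual_measure"
    "(\<lambda>p. h (dual_dilate a p)) \<in> borel_measurable dual_measure"
    using dual_measurable_fst[OF chi_meas] dual_measurable_dilate[OF a h] by auto
  show ?thesis unfolding Dhat_apply[abs_def] by measurable
qed

lemma Dhat_L2:
  assumes h: "h \<in> L2 dual_measure"
  shows "Dhat chi a h \<in> L2 dual_measure"
proof -
  have hm: "h \<in> borel_measurable dual_measure" using h by (rule L2_measurable)
  have [measurable]: "(\<lambda>p. h (dual_dilate a p)) \<in> borel_measurable dual_measure"
    by (rule dual_measurable_dilate[OF a hm])
  have "energy dual_measure (Dhat chi a h) =
      (\<integral>\<^sup>+p. ennreal (a powr (3/2)) * ennreal ((cmod (h (dual_dilate a p)))\<^sup>2) \<partial>dual_measure)"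
  proof (rule nn_integral_cong_AE, unfold AE_dual, use AE_chi_unit in eventually_elim)
    case (elim p)
    have "(a powr (3/4))\<^sup>2 = a powr (3/2)" using a by (simp add: power2_eq_square powr_add[symmetric])
    then have "(cmod (Dhat chi a h p))\<^sup>2 = a powr (3/2) * (cmod (h (dual_dilate a p)))\<^sup>2"
      using elim by (simp add: Dhat_apply norm_mult power_mult_distrib)
    then show ?case by (simp add: ennreal_mult)
  qed
  also have "\<dots> = ennreal (a powr (3/2)) * energy dual_measure (\<lambda>p. h (dual_dilate a p))"
    by (rule nn_integral_cmult) measurable
  also have "\<dots> = energy dual_measure h"
    by (rule nn_integral_norm_sq_dual_dilate[OF a hm, symmetric])
  also have "\<dots> < \<infinity>" using h by (simp add: L2_iff_nn)
  finally show ?thesis using Dhat_measurable[OF hm] by (simp add: L2_iff_nn)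
qed

text \<open>The adjoint of the unitary operator \<open>Dhat chi a\<close>, followed by restriction to \<open>I\<close>.\<close>

definition Dhat_adjoint_on :: "real set \<Rightarrow> (real \<times> real \<Rightarrow> complex) \<Rightarrow> real \<times> real \<Rightarrow> complex" where
  "Dhat_adjoint_on I f p = indicator I (fst p) *
     (cnj (chi a (fst (dual_dilate (inverse a) p))) * complex_of_real (a powr (-3/4)) * f (dual_dilate (inverse a) p))"

lemma Dhat_adjoint_on_measurable:
  assumes I: "I \<in> sets lebesgue" and f: "f \<in> borel_measurable dual_measure"
  shows "Dhat_adjoint_on I f \<in> borel_measurable dual_measure"
proof -
  have ia: "inverse a > 0" using a by simp
  have "(indicator I :: real \<Rightarrow> complex) \<in> borel_measurable (lebesgue_on Lam)"
    using I by (intro measurable_restrict_space1 borel_measurable_indicator)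
  from dual_measurable_fst[OF this]
  have [measurable]: "(\<lambda>p. indicator I (fst p) :: complex) \<in> borel_measurable dual_measure" .
  have [measurable]: "(\<lambda>p. chi a (fst (dual_dilate (inverse a) p))) \<in> borel_measurable dual_measure"
    using dual_measurable_dilate[OF ia dual_measurable_fst[OF chi_meas]] .
  have [measurable]: "(\<lambda>p. f (dual_dilate (inverse a) p)) \<in> borel_measurable dual_measure"
    by (rule dual_measurable_dilate[OF ia f])
  show ?thesis unfolding Dhat_adjoint_on_def[abs_def] by measurable
qed

lemma Dhat_adjoint_on_dilate:
  "Dhat_adjoint_on I f (dual_dilate a p) =
     indicator I (a * fst p) * (cnj (chi a (fst p)) * complex_of_real (a powr (-3/4)) * f p)"
  unfolding Dhat_adjoint_on_def dual_dilate_inverse[OF a] by (simp add: dual_dilate_def)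

lemma Dhat_adjoint_on_norm:
  assumes I: "I \<in> sets lebesgue" and f: "f \<in> borel_measurable dual_measure"
  shows "energy dual_measure (Dhat_adjoint_on I f) =
    (\<integral>\<^sup>+p. indicator I (a * fst p) * ennreal ((cmod (f p))\<^sup>2) \<partial>dual_measure)"
proof -
  have [measurable]: "(\<lambda>p. Dhat_adjoint_on I f (dual_dilate a p)) \<in> borel_measurable dual_measure"
    by (rule dual_measurable_dilate[OF a Dhat_adjoint_on_measurable[OF assms]])
  have "energy dual_measure (Dhat_adjoint_on I f) =
      ennreal (a powr (3/2)) * energy dual_measure (\<lambda>p. Dhat_adjoint_on I f (dual_dilate a p))"
    by (rule nn_integral_norm_sq_dual_dilate[OF a Dhat_adjoint_on_measurable[OF assms]])
  also have "\<dots> = (\<integral>\<^sup>+p. ennreal (a powr (3/2)) * ennreal ((cmod (Dhat_adjoint_on I f (dual_dilate a p)))\<^sup>2) \<partial>dual_measure)"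
    by (rule nn_integral_cmult[symmetric]) measurable
  also have "\<dots> = (\<integral>\<^sup>+p. indicator I (a * fst p) * ennreal ((cmod (f p))\<^sup>2) \<partial>dual_measure)"
  proof (rule nn_integral_cong_AE, unfold AE_dual, use AE_chi_unit in eventually_elim)
    case (elim p)
    have "(a powr (-3/4))\<^sup>2 = a powr (-3/2)" using a by (simp add: power2_eq_square powr_add[symmetric])
    then have "(cmod (Dhat_adjoint_on I f (dual_dilate a p)))\<^sup>2 = indicator I (a * fst p) * (a powr (-3/2) * (cmod (f p))\<^sup>2)"
      using elim by (simp add: Dhat_adjoint_on_dilate norm_mult power_mult_distrib indicator_def)
    moreover have "a powr (3/2) * a powr (-3/2) = 1"
      using a by (simp add: powr_add[symmetric])
    ultimately show ?case
      by (simp add: ennreal_mult[symmetric] indicator_def mult.assoc[symmetric])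
  qed
  finally show ?thesis .
qed

lemma Dhat_adjoint_on_L2_dual:
  assumes I: "I \<in> sets lebesgue" and f: "f \<in> L2 dual_measure"
  shows "Dhat_adjoint_on I f \<in> L2_dual I"
proof -
  have fm: "f \<in> borel_measurable dual_measure" using f by (rule L2_measurable)
  have "energy dual_measure (Dhat_adjoint_on I f) \<le> energy dual_measure f"
    unfolding Dhat_adjoint_on_norm[OF I fm] by (intro nn_integral_mono) (auto simp: indicator_def)
  also have "\<dots> < \<infinity>" using f by (simp add: L2_iff_nn)
  finally have "Dhat_adjoint_on I f \<in> L2 dual_measure"
    using Dhat_adjoint_on_measurable[OF I fm] by (simp add: L2_iff_nn)
  then show ?thesis by (auto simp: L2_dual_def Dhat_adjoint_on_def)
qed

text \<open>Restriction to \<open>I\<close> is harmless because \<open>h\<close> vanishes off \<open>I\<close>; it moves the left factor into the space of the given frame.\<close>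

lemma Dhat_adjoint_on_inner:
  assumes I: "I \<in> sets lebesgue" and f: "f \<in> L2 dual_measure" and h: "h \<in> L2_dual I"
  shows "L2_inner dual_measure f (Dhat chi a h) = L2_inner dual_measure (Dhat_adjoint_on I f) h"
proof -
  have fm [measurable]: "f \<in> borel_measurable dual_measure" using f by (rule L2_measurable)
  have hm [measurable]: "h \<in> borel_measurable dual_measure" using h by (auto simp: L2_dual_def L2_def)
  note [measurable] = Dhat_adjoint_on_measurable[OF I fm] Dhat_measurable[OF hm]
    dual_measurable_dilate[OF a Dhat_adjoint_on_measurable[OF I fm]] dual_measurable_dilate[OF a hm]
  have supp: "AE p in lborel. fst p \<notin> I \<longrightarrow> h p = 0"
    using h by (auto simp: L2_dual_def AE_dual case_prod_beta')
  have "L2_inner dual_measure (Dhat_adjoint_on I f) h =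
      (a powr (3/2)) *\<^sub>R (LINT p|dual_measure. Dhat_adjoint_on I f (dual_dilate a p) * cnj (h (dual_dilate a p)))"
    unfolding L2_inner_def by (rule integral_dual_dilate[OF a]) measurable
  also have "\<dots> = (LINT p|dual_measure. (a powr (3/2)) *\<^sub>R (Dhat_adjoint_on I f (dual_dilate a p) * cnj (h (dual_dilate a p))))"
    by simp
  also have "\<dots> = (LINT p|dual_measure. f p * cnj (Dhat chi a h p))"
  proof (rule integral_cong_AE)
    show "AE p in dual_measure. (a powr (3/2)) *\<^sub>R (Dhat_adjoint_on I f (dual_dilate a p) * cnj (h (dual_dilate a p))) =
        f p * cnj (Dhat chi a h p)"
      unfolding AE_dual using AE_dual_dilate[OF a supp]
    proof eventually_elim
      case (elim p)
      have "a powr (3/2) * a powr (-3/4) = a powr (3/4)" using a by (simp add: powr_add[symmetric])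
      then have *: "complex_of_real (a powr (3/2)) * complex_of_real (a powr (-3/4)) = complex_of_real (a powr (3/4))"
        by (simp only: of_real_mult[symmetric])
      have I: "h (dual_dilate a p) = 0" if "a * fst p \<notin> I" using elim that by (simp add: dual_dilate_def)
      have "(a powr (3/2)) *\<^sub>R (Dhat_adjoint_on I f (dual_dilate a p) * cnj (h (dual_dilate a p))) =
        (complex_of_real (a powr (3/2)) * complex_of_real (a powr (-3/4))) *
        (indicator I (a * fst p) * (cnj (chi a (fst p)) * f p * cnj (h (dual_dilate a p))))"
        by (simp add: Dhat_adjoint_on_dilate scaleR_conv_of_real mult_ac)
      also have "\<dots> = f p * cnj (Dhat chi a h p)"
        unfolding * using I by (cases "a * fst p \<in> I") (simp_all add: Dhat_apply mult_ac)
      finally show ?case .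
    qed
  qed measurable
  finally show ?thesis by (simp add: L2_inner_def)
qed

end

section \<open>Dyadic tilings\<close>

lemma two_powr_bounds:
  fixes u :: real
  shows "1/2 \<le> 2 powr u \<longleftrightarrow> -1 \<le> u" "1/2 < 2 powr u \<longleftrightarrow> -1 < u"
    "2 powr u < 1 \<longleftrightarrow> u < 0" "2 powr u \<le> 1 \<longleftrightarrow> u \<le> 0"
  using powr_le_cancel_iff[of 2 "-1" u] powr_less_cancel_iff[of 2 "-1" u]
    powr_le_cancel_iff[of 2 u 0] powr_less_cancel_iff[of 2 u 0]
  by (simp_all add: powr_minus)

lemma shannon_tiling:
  fixes x :: real
  assumes "x \<noteq> 0"
  shows "\<exists>!j :: int. 2 powi j * x \<in> shannon_set"
proof (cases "x > 0")
  case True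
  have "2 powi j * x \<in> shannon_set \<longleftrightarrow> j = - \<lfloor>log 2 x\<rfloor> - 1" for j :: int
  proof -
    have "2 powi j * x = 2 powr (real_of_int j + log 2 x)"
      using True by (simp add: powr_add powr_real_of_int')
    moreover have "2 powi j * x \<in> shannon_set \<longleftrightarrow> 1/2 \<le> 2 powi j * x \<and> 2 powi j * x < 1"
    proof -
      have "2 powi j * x > 0" using True by simp
      then show ?thesis unfolding shannon_set_def by auto
    qed
    ultimately have "2 powi j * x \<in> shannon_set \<longleftrightarrow> -1 \<le> real_of_int j + log 2 x \<and> real_of_int j + log 2 x < 0"
      by (simp only: two_powr_bounds)
    also have "\<dots> \<longleftrightarrow> j = - \<lfloor>log 2 x\<rfloor> - 1" by linarith
    finally show ?thesis .
  qed
  then show ?thesis by simp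
next
  case False
  with assms have neg: "- x > 0" by simp
  have "2 powi j * x \<in> shannon_set \<longleftrightarrow> j = - \<lceil>log 2 (- x)\<rceil>" for j :: int
  proof -
    have "2 powi j * (- x) = 2 powr (real_of_int j + log 2 (- x))"
      using neg by (simp add: powr_add powr_real_of_int')
    moreover have "2 powi j * x \<in> shannon_set \<longleftrightarrow> 1/2 < 2 powi j * (- x) \<and> 2 powi j * (- x) \<le> 1"
    proof -
      have "2 powi j * x < 0" using neg by (simp add: mult_pos_neg)
      then show ?thesis unfolding shannon_set_def by auto
    qed
    ultimately have "2 powi j * x \<in> shannon_set \<longleftrightarrow> -1 < real_of_int j + log 2 (- x) \<and> real_of_int j + log 2 (- x) \<le> 0"
      by (simp only: two_powr_bounds)
    also have "\<dots> \<longleftrightarrow> j = - \<lceil>log 2 (- x)\<rceil>" by linarith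
    finally show ?thesis .
  qed
  then show ?thesis by simp
qed

text \<open>Off a null set, the dyadic orbit of a point meets the Shannon set exactly once; a dilation
  congruence moves points along their orbits, so the orbit meets \<open>I\<close> exactly once as well.\<close>

lemma dyadic_tiling:
  assumes "dilation_congruent I shannon_set"
  shows "AE \<omega> in lborel. \<exists>!j :: int. 2 powi j * \<omega> \<in> I"
proof -
  obtain I' J' \<delta> and j :: "real \<Rightarrow> int" where
    II': "sym_diff I I' \<in> null_sets lebesgue" and JJ': "sym_diff shannon_set J' \<in> null_sets lebesgue"
    and bij: "bij_betw \<delta> I' J'" and \<delta>: "\<And>\<omega>. \<omega> \<in> I' \<Longrightarrow> \<delta> \<omega> = 2 powi (j \<omega>) * \<omega>"
    using assms unfolding dilation_congruent_def by blast
  define N where "N = sym_diff I I' \<union> sym_diff shannon_set J'"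
  have "N \<in> null_sets lebesgue" unfolding N_def using II' JJ' by (rule null_sets.Un)
  then have "AE \<omega> in lebesgue. \<omega> \<notin> N" by (rule AE_not_in)
  then have N0: "AE \<omega> in lborel. \<omega> \<notin> N" by (simp add: AE_completion_iff)
  have "AE \<omega> in lborel. 2 powi k * \<omega> \<notin> N" for k :: int
    using AE_lborel_affine[OF N0, of "2 powi k" 0] by simp
  then have N: "AE \<omega> in lborel. \<forall>k :: int. 2 powi k * \<omega> \<notin> N" unfolding AE_all_countable by blast
  show ?thesis using N AE_lborel_singleton[of "0::real"]
  proof eventually_elim
    case (elim \<omega>)
    have I_iff: "2 powi k * \<omega> \<in> I \<longleftrightarrow> 2 powi k * \<omega> \<in> I'" and J_iff: "2 powi k * \<omega> \<in> shannon_set \<longleftrightarrow> 2 powi k * \<omega> \<in> J'" for k :: int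
      using elim(1) by (auto simp: N_def)
    obtain m :: int where m: "2 powi m * \<omega> \<in> J'" and m_unique: "\<And>k :: int. 2 powi k * \<omega> \<in> J' \<Longrightarrow> k = m"
      using shannon_tiling[OF elim(2)] unfolding J_iff by blast
    have hit: "\<delta> (2 powi k * \<omega>) = 2 powi m * \<omega>" if "2 powi k * \<omega> \<in> I'" for k :: int
    proof -
      have "\<delta> (2 powi k * \<omega>) = 2 powi (j (2 powi k * \<omega>) + k) * \<omega>"
        using \<delta>[OF that] by (simp add: power_int_add)
      moreover have "\<delta> (2 powi k * \<omega>) \<in> J'" using bij that by (auto simp: bij_betw_def)
      ultimately show ?thesis using m_unique by metis
    qed
    show ?case unfolding I_iff
    proof (rule ex_ex1I)
      obtain y where y: "y \<in> I'" "\<delta> y = 2 powi m * \<omega>" using bij m by (auto simp: bij_betw_def)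
      have "2 powi (m - j y) * \<omega> = 2 powi (- j y) * (2 powi m * \<omega>)"
        by (simp add: power_int_add[symmetric] mult.assoc[symmetric])
      also have "\<dots> = y"
        unfolding y(2)[symmetric] \<delta>[OF y(1)] by (simp add: mult.assoc[symmetric] power_int_add[symmetric])
      finally show "\<exists>k. 2 powi k * \<omega> \<in> I'" using y(1) by metis
    next
      fix k l :: int assume k: "2 powi k * \<omega> \<in> I'" and l: "2 powi l * \<omega> \<in> I'"
      then have "2 powi k * \<omega> = 2 powi l * \<omega>"
        using hit[OF k] hit[OF l] bij by (metis bij_betw_imp_inj_on inj_onD)
      then have "(2::real) powi k = 2 powi l" using elim(2) by simp
      then show "k = l"
        using power_int_strict_increasing[of k l "2::real"] power_int_strict_increasing[of l k "2::real"]
        by (cases k l rule: linorder_cases) auto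
    qed
  qed
qed

section \<open>The Parseval frame on the dual side\<close>

text \<open>Almost every point lies in exactly one of the sets over which the parts \<open>F j\<close> are taken, so monotone convergence adds up their energies.\<close>

lemma tiling_norm_has_sum:
  assumes I: "I \<in> sets lebesgue" and tiling: "AE \<omega> in lborel. \<exists>!j :: int. 2 powi j * \<omega> \<in> I"
    and f: "f \<in> L2 dual_measure"
    and F: "\<And>j. F j \<in> L2 dual_measure"
      "\<And>j. energy dual_measure (F j) =
        (\<integral>\<^sup>+p. indicator I (2 powi j * fst p) * ennreal ((cmod (f p))\<^sup>2) \<partial>dual_measure)"
  shows "((\<lambda>j :: int. (L2_norm dual_measure (F j))\<^sup>2) has_sum (L2_norm dual_measure f)\<^sup>2) UNIV"
proof -
  have [measurable]: "f \<in> borel_measurable dual_measure" using f by (rule L2_measurable)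
  have ind [measurable]: "(\<lambda>p. indicator I (2 powi j * fst p) :: ennreal) \<in> borel_measurable dual_measure" for j :: int
  proof -
    have pos: "(2::real) powi j > 0" by simp
    have "(indicator I :: real \<Rightarrow> complex) \<in> borel_measurable (lebesgue_on Lam)"
      using I by (intro measurable_restrict_space1 borel_measurable_indicator)
    from dual_measurable_dilate[OF pos dual_measurable_fst[OF this]]
    have [measurable]: "(\<lambda>p. indicator I (2 powi j * fst p) :: complex) \<in> borel_measurable dual_measure"
      by (simp add: dual_dilate_def)
    have "(\<lambda>p. ennreal (cmod (indicator I (2 powi j * fst p)))) \<in> borel_measurable dual_measure" by measurable
    moreover have "ennreal (cmod (indicator I x)) = indicator I x" for x by (simp add: indicator_def)
    ultimately show ?thesis by simp
  qed
  \<comment> \<open>integrals commute with sums over \<open>nat\<close>, so the scales are enumerated\<close>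
  let ?j = int_decode
  have "(\<Sum>n. ennreal ((L2_norm dual_measure (F (?j n)))\<^sup>2)) =
      (\<Sum>n. \<integral>\<^sup>+p. indicator I (2 powi (?j n) * fst p) * ennreal ((cmod (f p))\<^sup>2) \<partial>dual_measure)"
    by (simp add: L2_norm_nn[OF F(1)] F(2))
  also have "\<dots> = (\<integral>\<^sup>+p. (\<Sum>n. indicator I (2 powi (?j n) * fst p) * ennreal ((cmod (f p))\<^sup>2)) \<partial>dual_measure)"
    by (rule nn_integral_suminf[symmetric]) measurable
  also have "\<dots> = energy dual_measure f"
  proof (rule nn_integral_cong_AE, unfold AE_dual, use AE_lborel_fst[OF tiling] in eventually_elim)
    case (elim p)
    then obtain k :: int where k: "2 powi k * fst p \<in> I" "\<And>l. 2 powi l * fst p \<in> I \<Longrightarrow> l = k" by blast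
    have "(\<lambda>n. if n = int_encode k then ennreal ((cmod (f p))\<^sup>2) else 0) sums ennreal ((cmod (f p))\<^sup>2)"
      by (rule sums_single)
    moreover have "indicator I (2 powi (?j n) * fst p) * ennreal ((cmod (f p))\<^sup>2) =
        (if n = int_encode k then ennreal ((cmod (f p))\<^sup>2) else 0)" for n
    proof (cases "n = int_encode k")
      case True
      then show ?thesis using k(1) by simp
    next
      case False
      then have "?j n \<noteq> k" by auto
      then have "2 powi (?j n) * fst p \<notin> I" using k(2) by blast
      then show ?thesis using False by simp
    qed
    ultimately show ?case by (simp add: sums_iff)
  qed
  also have "\<dots> = ennreal ((L2_norm dual_measure f)\<^sup>2)" by (rule L2_norm_nn[OF f, symmetric])
  finally have sum: "(\<Sum>n. ennreal ((L2_norm dual_measure (F (?j n)))\<^sup>2)) = ennreal ((L2_norm dual_measure f)\<^sup>2)" .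
  have summ: "summable (\<lambda>n. (L2_norm dual_measure (F (?j n)))\<^sup>2)"
    by (rule summable_suminf_not_top) (simp_all add: sum)
  have "(\<lambda>n. (L2_norm dual_measure (F (?j n)))\<^sup>2) sums (L2_norm dual_measure f)\<^sup>2"
  proof -
    have "ennreal (\<Sum>n. (L2_norm dual_measure (F (?j n)))\<^sup>2) = ennreal ((L2_norm dual_measure f)\<^sup>2)"
      using sum summ by (subst (asm) suminf_ennreal2) simp_all
    then have "(\<Sum>n. (L2_norm dual_measure (F (?j n)))\<^sup>2) = (L2_norm dual_measure f)\<^sup>2"
      by (subst (asm) ennreal_inj) (auto intro: suminf_nonneg summ)
    then show ?thesis using summ by (simp add: sums_iff)
  qed
  then have "((\<lambda>n. (L2_norm dual_measure (F (?j n)))\<^sup>2) has_sum (L2_norm dual_measure f)\<^sup>2) UNIV"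
    by (rule sums_nonneg_imp_has_sum) simp
  then show ?thesis
    using has_sum_reindex_bij_betw[OF bij_int_decode, of "\<lambda>j. (L2_norm dual_measure (F j))\<^sup>2"] by simp
qed

text \<open>At scale \<open>j\<close> the coefficients of \<open>f\<close> are those of \<open>F j\<close>, the pullback to \<open>I\<close> of the part of \<open>f\<close> over \<open>2\<^sup>-\<^sup>j I\<close>, with respect to
the given frame.\<close>

lemma dual_parseval_frame:
  assumes chi: "\<And>a. a > 0 \<Longrightarrow> chi a \<in> borel_measurable (lebesgue_on Lam)"
      "\<And>a \<omega>. a > 0 \<Longrightarrow> \<omega> \<in> Lam \<Longrightarrow> cmod (chi a \<omega>) = 1"
    and I: "I \<in> sets lebesgue" and cong: "dilation_congruent I shannon_set"
    and frame: "parseval_frame dual_measure (L2_dual I) L (\<lambda>x. That x g)"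
  shows "parseval_frame dual_measure (L2_dual Lam) (UNIV \<times> L) (dual_wavelet_system g chi)"
  unfolding parseval_frame_def L2_dual_Lam
proof (intro conjI ballI)
  have pos: "(2::real) powi j > 0" for j :: int by simp
  note chi_j = chi(1)[OF pos] chi(2)[OF pos]
  have gI: "That x g \<in> L2_dual I" if "x \<in> L" for x using frame that by (simp add: parseval_frame_def)
  show "dual_wavelet_system g chi i \<in> L2 dual_measure" if i: "i \<in> UNIV \<times> L" for i
  proof -
    obtain j x where jx: "i = (j, x)" "x \<in> L" using i by auto
    have "That x g \<in> L2 dual_measure" using gI[OF jx(2)] by (simp add: L2_dual_def)
    from Dhat_L2[where a="2 powi j" and chi=chi, OF pos chi_j this] show ?thesis
      by (simp add: dual_wavelet_system_def jx)
  qed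
  fix f assume f: "f \<in> L2 dual_measure"
  define F where "F j = Dhat_adjoint_on (2 powi j) chi I f" for j :: int
  have FI: "F j \<in> L2_dual I" for j
    unfolding F_def by (rule Dhat_adjoint_on_L2_dual[where a="2 powi j" and chi=chi, OF pos chi_j I f])
  have F2: "F j \<in> L2 dual_measure" for j using FI by (simp add: L2_dual_def)
  have "((\<lambda>j :: int. (L2_norm dual_measure (F j))\<^sup>2) has_sum (L2_norm dual_measure f)\<^sup>2) UNIV"
  proof (rule tiling_norm_has_sum[OF I dyadic_tiling[OF cong] f F2])
    show "energy dual_measure (F j) =
        (\<integral>\<^sup>+p. indicator I (2 powi j * fst p) * ennreal ((cmod (f p))\<^sup>2) \<partial>dual_measure)" for j
      unfolding F_def by (rule Dhat_adjoint_on_norm[where a="2 powi j" and chi=chi, OF pos chi_j I L2_measurable[OF f]])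
  qed
  moreover have "((\<lambda>x. (cmod (L2_inner dual_measure f (dual_wavelet_system g chi (j, x))))\<^sup>2) has_sum (L2_norm dual_measure (F j))\<^sup>2) L"
    for j :: int
  proof -
    have "((\<lambda>x. (cmod (L2_inner dual_measure (F j) (That x g)))\<^sup>2) has_sum (L2_norm dual_measure (F j))\<^sup>2) L"
      using frame FI by (simp add: parseval_frame_def)
    moreover have "L2_inner dual_measure f (dual_wavelet_system g chi (j, x)) = L2_inner dual_measure (F j) (That x g)"
      if "x \<in> L" for x
      unfolding F_def dual_wavelet_system_def
      using Dhat_adjoint_on_inner[where a="2 powi j" and chi=chi, OF pos chi_j I f gI[OF that]] by simp
    ultimately show ?thesis by (subst has_sum_cong) simp_all
  qed
  ultimately show "((\<lambda>i. (cmod (L2_inner dual_measure f (dual_wavelet_system g chi i)))\<^sup>2) has_sum (L2_norm dual_measure f)\<^sup>2) (UNIV \<times> L)"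
    by (intro has_sum_SigmaI summable_on_SigmaI has_sum_imp_summable) auto
qed

section \<open>The reducing isomorphism\<close>

text \<open>The projection fixes \<open>e\<close>, so the coefficient of \<open>P f\<close> along \<open>e\<close> can be computed by moving the projection to the other side of the inner product.\<close>

lemma projection_onto_line:
  assumes P: "orthogonal_projection P" and span: "range_is_span P e"
    and e: "e \<in> L2R" "L2_norm lebesgue e = 1" and f: "f \<in> L2R"
  shows "AE t in lebesgue. P f t = L2_inner lebesgue f e * e t"
proof -
  have bP: "bounded_operator P" and idem: "\<And>f. f \<in> L2R \<Longrightarrow> AE t in lebesgue. P (P f) t = P f t"
    and sym: "\<And>f g. f \<in> L2R \<Longrightarrow> g \<in> L2R \<Longrightarrow> L2_inner lebesgue (P f) g = L2_inner lebesgue f (P g)"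
    using P by (auto simp: orthogonal_projection_def)
  note PL = bounded_operator_L2[OF bP]
  have "\<exists>f0\<in>L2R. AE t in lebesgue. P f0 t = 1 * e t" using span unfolding range_is_span_def by blast
  then obtain f0 where f0: "f0 \<in> L2R" "AE t in lebesgue. P f0 t = e t" by auto
  have Pe: "AE t in lebesgue. P e t = e t"
    using bounded_operator_cong_AE[OF bP PL[OF f0(1)] e(1) f0(2)] idem[OF f0(1)] f0(2)
    by eventually_elim simp
  obtain c where c: "AE t in lebesgue. P f t = c * e t" using span f unfolding range_is_span_def by blast
  have "c = c * L2_inner lebesgue e e" using e(2) by (simp add: L2_inner_self)
  also have "\<dots> = L2_inner lebesgue (\<lambda>t. c * e t) e" by (simp add: L2_inner_scale_left)
  also have "\<dots> = L2_inner lebesgue (P f) e"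
    using c by (intro L2_inner_cong_AE L2_measurable[OF L2_scale[OF e(1)]] L2_measurable[OF PL[OF f]] L2_measurable[OF e(1)])
       (auto elim: eventually_mono)
  also have "\<dots> = L2_inner lebesgue f (P e)" by (rule sym[OF f e(1)])
  also have "\<dots> = L2_inner lebesgue f e"
    using Pe by (intro L2_inner_cong_AE L2_measurable[OF f] L2_measurable[OF PL[OF e(1)]] L2_measurable[OF e(1)]) auto
  finally show ?thesis using c by simp
qed

lemma hs_norm_sq_rank_one:
  assumes P: "orthogonal_projection P" and span: "range_is_span P e"
    and e: "e \<in> L2R" "L2_norm lebesgue e = 1" and B: "bounded_operator B"
  shows "hs_norm_sq (\<lambda>f. B (P f)) = ennreal ((L2_norm lebesgue (B e))\<^sup>2)"
proof -
  have bP: "bounded_operator P" using P by (simp add: orthogonal_projection_def)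
  have "(L2_norm lebesgue (B (P (std_basis n))))\<^sup>2 = (cmod (L2_inner lebesgue e (std_basis n)))\<^sup>2 * (L2_norm lebesgue (B e))\<^sup>2" for n
  proof -
    let ?u = "std_basis n" and ?c = "L2_inner lebesgue (std_basis n) e"
    have cL: "(\<lambda>t. ?c * e t) \<in> L2R" by (rule L2_scale[OF e(1)])
    have "AE t in lebesgue. B (P ?u) t = B (\<lambda>t. ?c * e t) t"
      by (rule bounded_operator_cong_AE[OF B bounded_operator_L2[OF bP std_basis_L2] cL
            projection_onto_line[OF P span e std_basis_L2]])
    moreover have "AE t in lebesgue. B (\<lambda>t. ?c * e t) t = ?c * B e t"
      using bounded_operator_linear[OF B e(1) e(1), of ?c 0] by simp
    ultimately have "AE t in lebesgue. B (P ?u) t = ?c * B e t" by eventually_elim simp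
    then have "L2_norm lebesgue (B (P ?u)) = L2_norm lebesgue (\<lambda>t. ?c * B e t)"
      by (rule L2_norm_cong_AE) (rule L2_measurable, rule bounded_operator_L2[OF B], rule bounded_operator_L2[OF bP std_basis_L2],
         rule L2_measurable, rule L2_scale, rule bounded_operator_L2[OF B e(1)])
    also have "\<dots> = cmod (L2_inner lebesgue e ?u) * L2_norm lebesgue (B e)"
      by (simp add: L2_norm_scale L2_inner_cnj[of lebesgue ?u e])
    finally show ?thesis by (simp add: power_mult_distrib)
  qed
  then have "hs_norm_sq (\<lambda>f. B (P f)) =
      (\<Sum>n. ennreal ((cmod (L2_inner lebesgue e (std_basis n)))\<^sup>2) * ennreal ((L2_norm lebesgue (B e))\<^sup>2))"
    by (simp add: hs_norm_sq_eq ennreal_mult)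
  also have "\<dots> = ennreal ((L2_norm lebesgue (B e))\<^sup>2)"
    by (simp add: ennreal_suminf_multc orthonormal_basis_Parseval[OF std_basis e(1)] e(2))
  finally show ?thesis .
qed

lemma is_fourier_bounded:
  assumes "is_fourier \<phi> A"
  shows "AE \<omega> in lborel. bounded_operator (A \<omega>)"
proof -
  have "hs_field A" using assms by (simp add: is_fourier_def)
  then have "AE \<omega> in lebesgue_on Lam. hilbert_schmidt (A \<omega>)" by (simp add: hs_field_def)
  then show ?thesis unfolding AE_lebesgue_on_Lam by eventually_elim (simp add: hilbert_schmidt_def)
qed

lemma unit_vector_field_AE:
  assumes "unit_vector_field e"
  shows "AE \<omega> in lborel. e \<omega> \<in> L2R \<and> L2_norm lebesgue (e \<omega>) = 1"
  using AE_lborel_singleton[of "0::real"]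
  by eventually_elim (use assms in \<open>auto simp: unit_vector_field_def Lam_def\<close>)

lemma reducing_isomorphism_fourier:
  assumes V: "reducing_isomorphism H e V" and \<eta>: "\<eta> \<in> H"
  obtains A where "is_fourier \<eta> A" "AE \<omega> in lborel. AE t in lborel. V \<eta> (\<omega>, t) = A \<omega> (e \<omega>) t"
proof -
  obtain A where A: "is_fourier \<eta> A" "AE \<omega> in lebesgue_on Lam. AE t in lebesgue. V \<eta> (\<omega>, t) = A \<omega> (e \<omega>) t"
    using V \<eta> unfolding reducing_isomorphism_def by blast
  show ?thesis using A(2) by (intro that[OF A(1)]) (simp add: AE_lebesgue_on_Lam AE_completion_iff)
qed

lemma reducing_isomorphism_L2:
  "reducing_isomorphism H e V \<Longrightarrow> \<eta> \<in> H \<Longrightarrow> V \<eta> \<in> L2 dual_measure"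
  unfolding reducing_isomorphism_def L2_dual_Lam[symmetric] by blast

text \<open>An element of \<open>H\<close> is its own projection, so composing with the projection field does not change its
  Fourier transform; on the range of a rank-one projection the Hilbert--Schmidt norm is the norm of the
  value at the unit vector.\<close>

lemma reducing_isomorphism_norm:
  assumes V: "reducing_isomorphism H e V" and H: "closed_L2_subspace lebesgue H" and \<eta>: "\<eta> \<in> H"
  shows "L2_norm dual_measure (V \<eta>) = L2_norm lebesgue \<eta>"
proof -
  have \<eta>L: "\<eta> \<in> L2N" using H \<eta> by (auto simp: closed_L2_subspace_def)
  have e: "unit_vector_field e" using V by (simp add: reducing_isomorphism_def)
  obtain P where P: "projection_field H P" "AE \<omega> in lebesgue_on Lam. range_is_span (P \<omega>) (e \<omega>)"
    using V unfolding reducing_isomorphism_def by blast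
  obtain A where A: "is_fourier \<eta> A" "AE \<omega> in lborel. AE t in lborel. V \<eta> (\<omega>, t) = A \<omega> (e \<omega>) t"
    using reducing_isomorphism_fourier[OF V \<eta>] .
  have VL: "V \<eta> \<in> L2 dual_measure" by (rule reducing_isomorphism_L2[OF V \<eta>])
  have Vm [measurable]: "V \<eta> \<in> borel_measurable dual_measure" using VL by (rule L2_measurable)
  obtain v where [measurable]: "v \<in> borel_measurable borel" and v: "AE p in lborel. V \<eta> p = v p"
    using dual_borel_representative[OF Vm] .
  have "is_L2_projection lebesgue H \<eta> \<eta>" using \<eta> by (simp add: is_L2_projection_def)
  then have AP: "is_fourier \<eta> (\<lambda>\<omega> f. A \<omega> (P \<omega> f))"
    using P(1) \<eta>L A(1) unfolding projection_field_def by blast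
  have proj: "AE \<omega> in lborel. orthogonal_projection (P \<omega>)"
    using P(1) unfolding projection_field_def AE_lebesgue_on_Lam by blast
  have span: "AE \<omega> in lborel. range_is_span (P \<omega>) (e \<omega>)" using P(2) by (simp add: AE_lebesgue_on_Lam)
  have "ennreal ((L2_norm dual_measure (V \<eta>))\<^sup>2) = (\<integral>\<^sup>+p. ennreal \<bar>fst p\<bar> * ennreal ((cmod (V \<eta> p))\<^sup>2) \<partial>lborel)"
    by (subst L2_norm_nn[OF VL], rule nn_integral_dual) measurable
  also have "\<dots> = (\<integral>\<^sup>+p. ennreal \<bar>fst p\<bar> * ennreal ((cmod (v p))\<^sup>2) \<partial>lborel)"
    by (rule nn_integral_cong_AE) (use v in \<open>eventually_elim, simp\<close>)
  also have "\<dots> = (\<integral>\<^sup>+\<omega>. \<integral>\<^sup>+t. ennreal \<bar>\<omega>\<bar> * ennreal ((cmod (v (\<omega>, t)))\<^sup>2) \<partial>lborel \<partial>lborel)"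
    by (subst nn_integral_lborel_pair) simp_all
  also have "\<dots> = (\<integral>\<^sup>+\<omega>. ennreal \<bar>\<omega>\<bar> * hs_norm_sq (\<lambda>f. A \<omega> (P \<omega> f)) \<partial>lborel)"
  proof (rule nn_integral_cong_AE, use AE_lborel_pairD[OF v] A(2) proj span unit_vector_field_AE[OF e] is_fourier_bounded[OF A(1)] in eventually_elim)
    case (elim \<omega>)
    have AeL: "A \<omega> (e \<omega>) \<in> L2R" using bounded_operator_L2[OF elim(6)] elim(5) by blast
    have "energy lborel (\<lambda>t. v (\<omega>, t)) = energy lborel (A \<omega> (e \<omega>))"
      by (rule nn_integral_cong_AE) (use elim(1,2) in \<open>eventually_elim, simp\<close>)
    also have "\<dots> = ennreal ((L2_norm lebesgue (A \<omega> (e \<omega>)))\<^sup>2)"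
      by (simp add: L2_norm_nn[OF AeL] nn_integral_completion)
    also have "\<dots> = hs_norm_sq (\<lambda>f. A \<omega> (P \<omega> f))"
      using elim by (intro hs_norm_sq_rank_one[symmetric]) auto
    finally show ?case by (simp add: nn_integral_cmult)
  qed
  also have "\<dots> = field_norm_sq (\<lambda>\<omega> f. A \<omega> (P \<omega> f))"
    by (simp add: field_norm_sq_def nn_integral_lebesgue_on_Lam)
  also have "\<dots> = ennreal ((L2_norm lebesgue \<eta>)\<^sup>2)" by (rule fourier_isometry[OF AP])
  finally have "(L2_norm dual_measure (V \<eta>))\<^sup>2 = (L2_norm lebesgue \<eta>)\<^sup>2" by (subst (asm) ennreal_inj) auto
  then show ?thesis by (simp add: power2_eq_iff_nonneg)
qed

lemma reducing_isomorphism_linear: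
  assumes V: "reducing_isomorphism H e V" and \<eta>: "\<eta> \<in> H" and \<zeta>: "\<zeta> \<in> H"
    and sum: "(\<lambda>x. a * \<eta> x + b * \<zeta> x) \<in> H"
  shows "AE p in dual_measure. V (\<lambda>x. a * \<eta> x + b * \<zeta> x) p = a * V \<eta> p + b * V \<zeta> p"
proof -
  have e: "unit_vector_field e" using V by (simp add: reducing_isomorphism_def)
  obtain A where A: "is_fourier \<eta> A" "AE \<omega> in lborel. AE t in lborel. V \<eta> (\<omega>, t) = A \<omega> (e \<omega>) t"
    using reducing_isomorphism_fourier[OF V \<eta>] .
  obtain B where B: "is_fourier \<zeta> B" "AE \<omega> in lborel. AE t in lborel. V \<zeta> (\<omega>, t) = B \<omega> (e \<omega>) t"
    using reducing_isomorphism_fourier[OF V \<zeta>] .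
  obtain C where C: "is_fourier (\<lambda>x. a * \<eta> x + b * \<zeta> x) C"
    "AE \<omega> in lborel. AE t in lborel. V (\<lambda>x. a * \<eta> x + b * \<zeta> x) (\<omega>, t) = C \<omega> (e \<omega>) t"
    using reducing_isomorphism_fourier[OF V sum] .
  have [measurable]: "V \<eta> \<in> borel_measurable dual_measure" "V \<zeta> \<in> borel_measurable dual_measure"
    using reducing_isomorphism_L2[OF V \<eta>] reducing_isomorphism_L2[OF V \<zeta>] by (auto intro: L2_measurable)
  have "AE \<omega> in lborel. AE t in lborel. V (\<lambda>x. a * \<eta> x + b * \<zeta> x) (\<omega>, t) = a * V \<eta> (\<omega>, t) + b * V \<zeta> (\<omega>, t)"
    using A(2) B(2) C(2) fourier_linear[OF A(1) B(1) C(1)] unit_vector_field_AE[OF e]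
  proof eventually_elim
    case (elim \<omega>)
    then have "AE t in lborel. C \<omega> (e \<omega>) t = a * A \<omega> (e \<omega>) t + b * B \<omega> (e \<omega>) t"
      by (auto simp: AE_completion_iff)
    with elim(1-3) show ?case by eventually_elim simp
  qed
  then show ?thesis unfolding AE_dual
    by (intro AE_dual_iterated L2_measurable[OF reducing_isomorphism_L2[OF V sum]]) auto
qed

text \<open>Polarisation: the norms of \<open>\<eta> - c \<zeta>\<close> for \<open>c = 1\<close> and \<open>c = \<i>\<close> determine the real and imaginary parts.\<close>

lemma reducing_isomorphism_inner:
  assumes V: "reducing_isomorphism H e V" and H: "closed_L2_subspace lebesgue H" and \<eta>: "\<eta> \<in> H" and \<zeta>: "\<zeta> \<in> H"
  shows "L2_inner dual_measure (V \<eta>) (V \<zeta>) = L2_inner lebesgue \<eta> \<zeta>"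
proof -
  have comb: "(\<lambda>x. a * \<xi> x + b * \<xi>' x) \<in> H" if "\<xi> \<in> H" "\<xi>' \<in> H" for a b \<xi> \<xi>'
    using H that unfolding closed_L2_subspace_def by (auto dest!: bspec)
  have HL: "\<xi> \<in> L2N" if "\<xi> \<in> H" for \<xi> using H that by (auto simp: closed_L2_subspace_def)
  note VL = reducing_isomorphism_L2[OF V]
  have Re_eq: "Re (cnj c * L2_inner dual_measure (V \<eta>) (V \<zeta>)) = Re (cnj c * L2_inner lebesgue \<eta> \<zeta>)" for c
  proof -
    let ?d = "\<lambda>x. 1 * \<eta> x + (- c) * \<zeta> x"
    have d: "?d \<in> H" by (rule comb[OF \<eta> \<zeta>])
    have "L2_norm dual_measure (\<lambda>p. V \<eta> p - c * V \<zeta> p) = L2_norm dual_measure (V ?d)"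
    proof (rule L2_norm_cong_AE)
      show "AE p in dual_measure. V \<eta> p - c * V \<zeta> p = V ?d p"
        using reducing_isomorphism_linear[OF V \<eta> \<zeta> d] by eventually_elim simp
    qed (intro L2_measurable L2_diff L2_scale VL \<eta> \<zeta> d)+
    also have "\<dots> = L2_norm lebesgue (\<lambda>x. \<eta> x - c * \<zeta> x)"
      using reducing_isomorphism_norm[OF V H d] by simp
    finally have "(L2_norm dual_measure (\<lambda>p. V \<eta> p - c * V \<zeta> p))\<^sup>2 = (L2_norm lebesgue (\<lambda>x. \<eta> x - c * \<zeta> x))\<^sup>2"
      by simp
    then show ?thesis
      unfolding L2_norm_diff_sq[OF VL[OF \<eta>] L2_scale[OF VL[OF \<zeta>]]] L2_norm_diff_sq[OF HL[OF \<eta>] L2_scale[OF HL[OF \<zeta>]]]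
        L2_norm_scale L2_inner_scale_right reducing_isomorphism_norm[OF V H \<eta>] reducing_isomorphism_norm[OF V H \<zeta>]
      by simp
  qed
  show ?thesis using Re_eq[of 1] Re_eq[of \<i>] by (simp add: complex_eq_iff)
qed

lemma reducing_isomorphism_transl:
  assumes V: "reducing_isomorphism H e V" and \<eta>: "\<eta> \<in> H" and T: "transl x \<eta> \<in> H"
  shows "AE \<omega> in lborel. AE t in lborel. V (transl x \<eta>) (\<omega>, t) = That x (V \<eta>) (\<omega>, t)"
proof -
  have e: "unit_vector_field e" using V by (simp add: reducing_isomorphism_def)
  obtain k l m where x: "x = (k, l, m)" by (metis prod_cases3)
  obtain A where A: "is_fourier \<eta> A" "AE \<omega> in lborel. AE t in lborel. V \<eta> (\<omega>, t) = A \<omega> (e \<omega>) t"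
    using reducing_isomorphism_fourier[OF V \<eta>] .
  obtain B where B: "is_fourier (transl x \<eta>) B" "AE \<omega> in lborel. AE t in lborel. V (transl x \<eta>) (\<omega>, t) = B \<omega> (e \<omega>) t"
    using reducing_isomorphism_fourier[OF V T] .
  show ?thesis using A(2) B(2) fourier_transl[OF A(1) B(1)] unit_vector_field_AE[OF e]
  proof eventually_elim
    case (elim \<omega>)
    have 1: "AE t in lborel. V \<eta> (\<omega>, - k + 1 * t) = A \<omega> (e \<omega>) (- k + 1 * t)"
      using elim(1) by (rule AE_lborel_affine) simp
    have 2: "AE t in lborel. B \<omega> (e \<omega>) t = schrodinger_rep \<omega> x (A \<omega> (e \<omega>)) t"
      using elim(3,4) by (auto simp: AE_completion_iff)
    from elim(2) 1 2 show ?case by eventually_elim (simp add: x)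
  qed
qed

text \<open>The multiplier enters because dilating \<open>\<eta>\<close> replaces \<open>e \<omega>\<close> by \<open>C_dil a (e \<omega>)\<close>, and this is \<open>chi a \<omega>\<close> times the unit vector at
frequency \<open>a * \<omega>\<close>.\<close>

lemma reducing_isomorphism_dil:
  assumes V: "reducing_isomorphism H e V" and chi: "associated_multiplier e chi"
    and a: "a > 0" and \<eta>: "\<eta> \<in> H" and D: "dil a \<eta> \<in> H"
  shows "AE p in lborel. V (dil a \<eta>) p = Dhat chi a (V \<eta>) p"
proof -
  have e: "unit_vector_field e" using V by (simp add: reducing_isomorphism_def)
  have chi_a: "chi a \<in> borel_measurable (lebesgue_on Lam)" "\<And>\<omega>. \<omega> \<in> Lam \<Longrightarrow> cmod (chi a \<omega>) = 1"
    "AE \<omega> in lborel. AE t in lebesgue. C_dil a (e \<omega>) t = chi a \<omega> * e (a * \<omega>) t"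
    using chi a unfolding associated_multiplier_def AE_lebesgue_on_Lam by auto
  obtain A where A: "is_fourier \<eta> A" "AE \<omega> in lborel. AE t in lborel. V \<eta> (\<omega>, t) = A \<omega> (e \<omega>) t"
    using reducing_isomorphism_fourier[OF V \<eta>] .
  obtain B where B: "is_fourier (dil a \<eta>) B" "AE \<omega> in lborel. AE t in lborel. V (dil a \<eta>) (\<omega>, t) = B \<omega> (e \<omega>) t"
    using reducing_isomorphism_fourier[OF V D] .
  let ?b = "a powr (-1/2)" and ?c = "complex_of_real (a powr (3/4))"
  have b: "?b \<noteq> 0" using a by simp
  have A': "AE \<omega> in lborel. AE t in lborel. V \<eta> (0 + a * \<omega>, t) = A (0 + a * \<omega>) (e (0 + a * \<omega>)) t"
    using A(2) by (rule AE_lborel_affine) (use a in simp)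
  have e': "AE \<omega> in lborel. e (0 + a * \<omega>) \<in> L2R \<and> L2_norm lebesgue (e (0 + a * \<omega>)) = 1"
    using unit_vector_field_AE[OF e] by (rule AE_lborel_affine) (use a in simp)
  have "AE \<omega> in lborel. AE t in lborel. V (dil a \<eta>) (\<omega>, t) = Dhat chi a (V \<eta>) (\<omega>, t)"
    using A' B(2) fourier_dil[OF a A(1) B(1)] unit_vector_field_AE[OF e] e' chi_a(3)
  proof eventually_elim
    case (elim \<omega>)
    have bA: "bounded_operator (A (a * \<omega>))" and e1: "e \<omega> \<in> L2R" and e2: "e (a * \<omega>) \<in> L2R"
      using elim(3-5) by auto
    have "AE t in lborel. V \<eta> (0 + a * \<omega>, 0 + ?b * t) = A (0 + a * \<omega>) (e (0 + a * \<omega>)) (0 + ?b * t)"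
      using elim(1) b by (rule AE_lborel_affine)
    then have 1: "AE t in lborel. V \<eta> (a * \<omega>, ?b * t) = A (a * \<omega>) (e (a * \<omega>)) (?b * t)" by simp
    have 2: "AE t in lborel. B \<omega> (e \<omega>) t = ?c * A (a * \<omega>) (C_dil a (e \<omega>)) (?b * t)"
      using elim(3) e1 by (auto simp: AE_completion_iff)
    have "AE t in lebesgue. A (a * \<omega>) (C_dil a (e \<omega>)) t = A (a * \<omega>) (\<lambda>t. chi a \<omega> * e (a * \<omega>) t) t"
      by (rule bounded_operator_cong_AE[OF bA C_dil_L2[OF a e1] L2_scale[OF e2] elim(6)])
    moreover have "AE t in lebesgue. A (a * \<omega>) (\<lambda>t. chi a \<omega> * e (a * \<omega>) t) t = chi a \<omega> * A (a * \<omega>) (e (a * \<omega>)) t"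
      using bounded_operator_linear[OF bA e2 e2, of "chi a \<omega>" 0] by simp
    ultimately have "AE t in lebesgue. A (a * \<omega>) (C_dil a (e \<omega>)) t = chi a \<omega> * A (a * \<omega>) (e (a * \<omega>)) t"
      by eventually_elim simp
    then have "AE t in lborel. A (a * \<omega>) (C_dil a (e \<omega>)) (0 + ?b * t) = chi a \<omega> * A (a * \<omega>) (e (a * \<omega>)) (0 + ?b * t)"
      using b by (intro AE_lborel_affine) (simp_all add: AE_completion_iff)
    with elim(2) 1 2 show ?case by eventually_elim (simp add: Dhat_def)
  qed
  moreover have "Dhat chi a (V \<eta>) \<in> borel_measurable dual_measure"
    by (rule Dhat_measurable[where a=a and chi=chi, OF a chi_a(1,2) L2_measurable[OF reducing_isomorphism_L2[OF V \<eta>]]])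
  ultimately show ?thesis
    by (intro AE_dual_iterated L2_measurable[OF reducing_isomorphism_L2[OF V D]]) auto
qed

lemma reducing_isomorphism_transl_generator:
  assumes V: "reducing_isomorphism H e V" and \<psi>: "\<psi> \<in> H" and T: "transl x \<psi> \<in> H"
    and g: "AE p in lborel. V \<psi> p = g p" and gm: "That x g \<in> borel_measurable dual_measure"
  shows "AE p in lborel. V (transl x \<psi>) p = That x g p"
proof -
  obtain k l m where x: "x = (k, l, m)" by (metis prod_cases3)
  have "AE \<omega> in lborel. AE t in lborel. V (transl x \<psi>) (\<omega>, t) = That x g (\<omega>, t)"
    using reducing_isomorphism_transl[OF V \<psi> T] AE_lborel_pairD[OF g]
  proof eventually_elim
    case (elim \<omega>)
    have "AE t in lborel. V \<psi> (\<omega>, - k + 1 * t) = g (\<omega>, - k + 1 * t)"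
      using elim(2) by (rule AE_lborel_affine) simp
    with elim(1) show ?case by eventually_elim (simp add: x)
  qed
  then show ?thesis by (intro AE_dual_iterated L2_measurable[OF reducing_isomorphism_L2[OF V T]] gm)
qed

theorem proposition3p9:
  fixes H :: "(heis \<Rightarrow> complex) set"
    and e :: "real \<Rightarrow> real \<Rightarrow> complex"
    and V :: "(heis \<Rightarrow> complex) \<Rightarrow> (real \<times> real \<Rightarrow> complex)"
    and chi :: "real \<Rightarrow> real \<Rightarrow> complex"
    and \<alpha> \<beta> :: real
    and I :: "real set"
    and g :: "real \<times> real \<Rightarrow> complex"
    and \<psi> :: "heis \<Rightarrow> complex"
  assumes "invariant_multiplicity_one H"
    and "reducing_isomorphism H e V"
    and "associated_multiplier e chi"
    and "\<alpha> > 0" and "\<beta> > 0"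
    and "I \<in> sets lebesgue" and "I \<subseteq> Lam"
    and "dilation_congruent I shannon_set"
    and "g \<in> L2_dual I"
    and "\<psi> \<in> H" and "AE z in dual_measure. V \<psi> z = g z"
    and "parseval_frame dual_measure (L2_dual I) (lattice \<alpha> \<beta>) (\<lambda>x. That x g)"
  shows "parseval_frame lebesgue H (UNIV \<times> lattice \<alpha> \<beta>) (wavelet_system \<psi>) \<and>
         parseval_frame dual_measure (L2_dual Lam) (UNIV \<times> lattice \<alpha> \<beta>) (dual_wavelet_system g chi)"
proof
  note V = assms(2) and chi = assms(3) and \<psi> = assms(10) and frame = assms(12)
  have pos: "(2::real) powi j > 0" for j :: int by simp
  have H: "closed_L2_subspace lebesgue H" and HT: "\<And>x \<phi>. \<phi> \<in> H \<Longrightarrow> transl x \<phi> \<in> H"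
    and HD: "\<And>a \<phi>. a > 0 \<Longrightarrow> \<phi> \<in> H \<Longrightarrow> dil a \<phi> \<in> H"
    using assms(1) by (auto simp: invariant_multiplicity_one_def multiplicity_one_def translation_invariant_def)
  have chi1: "\<And>a. a > 0 \<Longrightarrow> chi a \<in> borel_measurable (lebesgue_on Lam)"
    and chi2: "\<And>a \<omega>. a > 0 \<Longrightarrow> \<omega> \<in> Lam \<Longrightarrow> cmod (chi a \<omega>) = 1"
    using chi by (auto simp: associated_multiplier_def)
  show dual: "parseval_frame dual_measure (L2_dual Lam) (UNIV \<times> lattice \<alpha> \<beta>) (dual_wavelet_system g chi)"
    by (rule dual_parseval_frame[OF chi1 chi2 assms(6) assms(8) frame])
  have inH: "wavelet_system \<psi> (j, x) \<in> H" for j x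
    unfolding wavelet_system_def by (simp add: HD[OF pos HT[OF \<psi>]])
  have gI: "That x g \<in> borel_measurable dual_measure" if "x \<in> lattice \<alpha> \<beta>" for x
    using frame that by (auto simp: parseval_frame_def L2_dual_def intro: L2_measurable)
  have VU: "AE p in dual_measure. V (wavelet_system \<psi> (j, x)) p = dual_wavelet_system g chi (j, x) p"
    if x: "x \<in> lattice \<alpha> \<beta>" for j x
  proof -
    have "AE p in lborel. V (transl x \<psi>) p = That x g p"
      by (rule reducing_isomorphism_transl_generator[OF V \<psi> HT[OF \<psi>] _ gI[OF x]])
         (use assms(11) in \<open>simp add: AE_dual\<close>)
    from Dhat_cong_AE[OF pos[of j] this, of chi]
      reducing_isomorphism_dil[OF V chi pos HT[OF \<psi>] HD[OF pos HT[OF \<psi>]], of j x]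
    show ?thesis unfolding AE_dual by eventually_elim (simp add: wavelet_system_def dual_wavelet_system_def)
  qed
  show "parseval_frame lebesgue H (UNIV \<times> lattice \<alpha> \<beta>) (wavelet_system \<psi>)"
    unfolding parseval_frame_def
  proof (intro conjI ballI)
    show "wavelet_system \<psi> i \<in> H" for i using inH by (cases i) auto
    fix \<phi> assume \<phi>: "\<phi> \<in> H"
    have V\<phi>: "V \<phi> \<in> L2_dual Lam" unfolding L2_dual_Lam by (rule reducing_isomorphism_L2[OF V \<phi>])
    have eq: "L2_inner lebesgue \<phi> (wavelet_system \<psi> i) = L2_inner dual_measure (V \<phi>) (dual_wavelet_system g chi i)"
      if i_in: "i \<in> UNIV \<times> lattice \<alpha> \<beta>" for i
    proof -
      obtain j x where i: "i = (j, x)" "x \<in> lattice \<alpha> \<beta>" using i_in by auto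
      have "dual_wavelet_system g chi i \<in> L2 dual_measure"
        using dual i_in by (auto simp: parseval_frame_def L2_dual_Lam)
      then have "L2_inner dual_measure (V \<phi>) (V (wavelet_system \<psi> i)) = L2_inner dual_measure (V \<phi>) (dual_wavelet_system g chi i)"
        using VU[OF i(2), of j] V\<phi> reducing_isomorphism_L2[OF V inH, of j x]
        by (intro L2_inner_cong_AE) (auto simp: i L2_dual_Lam intro: L2_measurable)
      then show ?thesis using reducing_isomorphism_inner[OF V H \<phi> inH, of j x] by (simp add: i)
    qed
    have "((\<lambda>i. (cmod (L2_inner dual_measure (V \<phi>) (dual_wavelet_system g chi i)))\<^sup>2) has_sum
        (L2_norm dual_measure (V \<phi>))\<^sup>2) (UNIV \<times> lattice \<alpha> \<beta>)"
      using dual V\<phi> by (simp add: parseval_frame_def)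
    then show "((\<lambda>i. (cmod (L2_inner lebesgue \<phi> (wavelet_system \<psi> i)))\<^sup>2) has_sum (L2_norm lebesgue \<phi>)\<^sup>2)
        (UNIV \<times> lattice \<alpha> \<beta>)"
      unfolding reducing_isomorphism_norm[OF V H \<phi>] by (subst has_sum_cong) (simp_all add: eq)
  qed
qed

end
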